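(* Let $\Omega\subset\mathbb R^n$ be a bounded $C^4$ domain, let $0<\theta<n\pi/2$, let $\underline u\in C^3(\overline\Omega)$ be convex, and let $K\subset\mathbb R^n$ be compact and convex. Suppose that, for an arbitrary $t\in[0,1]$, $u\in C^4(\overline\Omega)$ is a convex solution of $$G_t(Du,D^2u)=\theta\ \text{ in }\Omega,\qquad u=\underline u\ \text{ on }\partial\Omega,$$ and assume $$Du(\overline\Omega)\subset K,\qquad u\ge\underline u\ \text{ in }\Omega.$$ If the mixed recession compatibility condition (MRC) holds on $\partial\Omega$, then $$\sup_{x\in\partial\Omega}\ \sup_{\substack{\xi\in T_x\partial\Omega\\|\xi|=1}}|D^2u(\xi,\nu)|\le C .$$ The same constant $C$ works for every $t\in[0,1]$ and every such solution $u$ with fixed $\Omega,\theta,\underline u,K$, provided the positive margins $\inf_{(j,g)\in\mathcal R^*_{x_0}}(j+\tau_{x_0}g)$ in (MRC) are uniform for $x_0\in\partial\Omega$.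
   Context: Let $n\ge2$, $\mathrm{Sym}(n)$ the real symmetric $n\times n$ matrices, $X:Y=\mathrm{tr}(XY)$, $|X|$ the operator norm, and $\nu$ the inward unit normal of $\partial\Omega$. For $t\in[0,1]$, $p\in\mathbb R^n$, $X\in\mathrm{Sym}(n)$ set $$w_t(p)=\sqrt{1+t^2|p|^2},\quad B_t(p)=(I+t^2p\otimes p)^{-1/2},\quad A_t(p,X)=\tfrac1{w_t(p)}B_t(p)XB_t(p),$$ $$F(M)=\sum_{i=1}^n\arctan\lambda_i(M),\qquad G_t(p,X)=F(A_t(p,X)).$$ A convex function $u$ means $D^2u\ge0$. Level jets. A level jet is $(t,p,X)\in[0,1]\times K\times\mathrm{Sym}(n)$ with $X\ge0$ and $G_t(p,X)=\theta$; a level jet $(x,t,p,X)$ also carries a base point $x$. On a level jet write $a=(a^{ij})$, $a^{ij}=\partial G_t/\partial X_{ij}(p,X)$, and $b=(b^k)$, $b^k=\partial G_t/\partial p_k(p,X)$; regard $a$ as a bilinear form, $a(\xi,\eta)=a^{ij}\xi_i\eta_j$. Let $d$ be the inward distance to $\partial\Omega$ in a fixed collar of $\partial\Omega$ (where it is regular), and define $$\mathcal J(x;t,p,X)=a:(D^2\underline u(x)-X)+b\cdot(D\underline u(x)-p),$$ $$\ell(x;t,p,X)=a:D^2d(x)+b\cdot Dd(x),\qquad Q(x;t,p,X)=a(p-D\underline u(x),p-D\underline u(x))\ge0.$$ Doubly degenerate recession sequences. Fix $x_0\in\partial\Omega$. A sequence $(x_m,t_m,p_m,X_m)$ of level jets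 with $x_m$ in the fixed boundary collar is a doubly degenerate recession sequence based at $x_0$ if $x_m\to x_0$, $|X_m|\to\infty$, $a^{(m)}(Dd(x_m),Dd(x_m))\to0$ and $Q^{(m)}\to0$, where the superscript $(m)$ denotes evaluation at $(x_m,t_m,p_m,X_m)$. A recession limit pair is a subsequential limit $(j,g)$ of $(\mathcal J^{(m)},-\ell^{(m)})$ along such a sequence; $\mathcal R^*_{x_0}$ is the set of all such pairs (empty if there are no such sequences). (MRC) holds at $x_0\in\partial\Omega$ if there is $\tau_{x_0}>0$ with $\inf_{(j,g)\in\mathcal R^*_{x_0}}(j+\tau_{x_0}g)>0$, the infimum over the empty set being $+\infty$. (MRC) holds on $\partial\Omega$ if it holds at every boundary point. *)

theory Defs
  imports "HOL-Analysis.Analysis" "HOL-Computational_Algebra.Polynomial"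
begin

definition sym_mats :: "(real^'n^'n) set" where
  "sym_mats = {X. transpose X = X}"

definition psd :: "real^'n^'n \<Rightarrow> bool" where
  "psd X \<longleftrightarrow> X \<in> sym_mats \<and> (\<forall>v. 0 \<le> v \<bullet> (X *v v))"

definition frob :: "real^'n^'n \<Rightarrow> real^'n^'n \<Rightarrow> real" where
  "frob X Y = trace (X ** Y)"

definition mat_norm :: "real^'n^'n \<Rightarrow> real" where
  "mat_norm X = onorm ((*v) X)"

definition outer :: "real^'n \<Rightarrow> real^'n \<Rightarrow> real^'n^'n" where
  "outer p q = (\<chi> i j. p $ i * q $ j)"

text \<open>Square root in the sense of positive semidefinite symmetric matrices, where it is unique.\<close>

definition mat_sqrt :: "real^'n^'n \<Rightarrow> real^'n^'n" where
  "mat_sqrt M = (THE R. psd R \<and> R ** R = M)"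

text \<open>Eigenvalues with multiplicity, as the real roots of the characteristic polynomial;
  for a symmetric matrix there are exactly \<open>CARD('n)\<close> of them.\<close>

definition eigvals :: "real^'n^'n \<Rightarrow> real multiset" where
  "eigvals M = proots (det (mat [:0, 1:] - map_matrix (\<lambda>c. [:c:]) M))"

definition F_op :: "real^'n^'n \<Rightarrow> real" where
  "F_op M = sum_mset (image_mset arctan (eigvals M))"

definition w_fac :: "real \<Rightarrow> real^'n \<Rightarrow> real" where
  "w_fac t p = sqrt (1 + t\<^sup>2 * (norm p)\<^sup>2)"

definition B_mat :: "real \<Rightarrow> real^'n \<Rightarrow> real^'n^'n" where
  "B_mat t p = mat_sqrt (matrix_inv (mat 1 + t\<^sup>2 *\<^sub>R outer p p))"

definition A_mat :: "real \<Rightarrow> real^'n \<Rightarrow> real^'n^'n \<Rightarrow> real^'n^'n" where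
  "A_mat t p X = (1 / w_fac t p) *\<^sub>R (B_mat t p ** X ** B_mat t p)"

definition G_op :: "real \<Rightarrow> real^'n \<Rightarrow> real^'n^'n \<Rightarrow> real" where
  "G_op t p X = F_op (A_mat t p X)"

text \<open>The matrix \<open>a\<close> of derivatives in \<open>X\<close>. The operator lives on symmetric matrices only, so
  \<open>a\<close> is the symmetric matrix that represents the differential along symmetric increments
  \<open>H\<close> by \<open>a : H\<close> (off-diagonal entries are not counted twice).\<close>

definition a_mat :: "real \<Rightarrow> real^'n \<Rightarrow> real^'n^'n \<Rightarrow> real^'n^'n" where
  "a_mat t p X = (THE a. a \<in> sym_mats \<and>
     ((\<lambda>Y. G_op t p Y) has_derivative (\<lambda>H. frob a H)) (at X within sym_mats))"

definition b_vec :: "real \<Rightarrow> real^'n \<Rightarrow> real^'n^'n \<Rightarrow> real^'n" where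
  "b_vec t p X = (\<chi> k. frechet_derivative (\<lambda>q. G_op t q X) (at p) (axis k 1))"

definition bilin :: "real^'n^'n \<Rightarrow> real^'n \<Rightarrow> real^'n \<Rightarrow> real" where
  "bilin a \<xi> \<eta> = \<xi> \<bullet> (a *v \<eta>)"

text \<open>Partial derivatives in the open set \<open>U\<close>; at points outside \<open>U\<close> (in practice: boundary
  points) the value is the limit from inside \<open>U\<close>, i.e. the continuous extension.\<close>

definition pd :: "(real^'n) set \<Rightarrow> 'n \<Rightarrow> (real^'n \<Rightarrow> real) \<Rightarrow> real^'n \<Rightarrow> real" where
  "pd U i f x =
     (if x \<in> U then frechet_derivative f (at x) (axis i 1)
      else Lim (at x within U) (\<lambda>y. frechet_derivative f (at y) (axis i 1)))"

definition grad :: "(real^'n) set \<Rightarrow> (real^'n \<Rightarrow> real) \<Rightarrow> real^'n \<Rightarrow> real^'n" where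
  "grad U f x = (\<chi> i. pd U i f x)"

definition hess :: "(real^'n) set \<Rightarrow> (real^'n \<Rightarrow> real) \<Rightarrow> real^'n \<Rightarrow> real^'n^'n" where
  "hess U f x = (\<chi> i j. pd U i (pd U j f) x)"

text \<open>For \<open>U\<close> open and \<open>S\<close> relatively open in \<open>closure U\<close>: \<open>f\<close> is of class \<open>C\<^sup>k\<close> in
  \<open>S \<inter> U\<close> and its derivatives of order at most \<open>k\<close> extend continuously to \<open>S\<close>. In particular
  \<open>Ck_on k U (closure U)\<close> is the class of functions that are \<open>C\<^sup>k\<close> on the closure of \<open>U\<close>.
  If \<open>pd U i f\<close> is continuous on \<open>S\<close>, then the limits in its definition exist at the points
  of \<open>S\<close> outside \<open>U\<close>.\<close>

primrec Ck_on :: "nat \<Rightarrow> (real^'n) set \<Rightarrow> (real^'n) set \<Rightarrow> (real^'n \<Rightarrow> real) \<Rightarrow> bool" where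
  "Ck_on 0 U S f \<longleftrightarrow> continuous_on S f"
| "Ck_on (Suc k) U S f \<longleftrightarrow>
     continuous_on S f \<and> (\<forall>x\<in>S \<inter> U. f differentiable (at x)) \<and> (\<forall>i. Ck_on k U S (pd U i f))"

text \<open>Near each boundary point, a \<open>C\<^sup>k\<close> domain is the region above the graph of a \<open>C\<^sup>k\<close>
  function over the hyperplane orthogonal to a unit vector \<open>e\<close>; that function is written as a
  function on the whole space, and used only on the hyperplane.\<close>

definition Ck_domain :: "nat \<Rightarrow> (real^'n) set \<Rightarrow> bool" where
  "Ck_domain k \<Omega> \<longleftrightarrow> open \<Omega> \<and> connected \<Omega> \<and> \<Omega> \<noteq> {} \<and>
     (\<forall>x0\<in>frontier \<Omega>. \<exists>r e \<gamma>. 0 < r \<and> norm e = 1 \<and> Ck_on k UNIV UNIV \<gamma> \<and>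
        \<Omega> \<inter> ball x0 r = {x \<in> ball x0 r. \<gamma> (x - (x \<bullet> e) *\<^sub>R e) < x \<bullet> e})"

definition tangent_space :: "(real^'n) set \<Rightarrow> real^'n \<Rightarrow> (real^'n) set" where
  "tangent_space \<Omega> x = {v. \<exists>c \<epsilon>. 0 < \<epsilon> \<and> c 0 = x \<and> (\<forall>s. \<bar>s\<bar> < \<epsilon> \<longrightarrow> c s \<in> frontier \<Omega>) \<and>
     (c has_vector_derivative v) (at (0::real))}"

definition inner_normal :: "(real^'n) set \<Rightarrow> real^'n \<Rightarrow> real^'n" where
  "inner_normal \<Omega> x = (THE \<nu>. norm \<nu> = 1 \<and> (\<forall>\<xi>\<in>tangent_space \<Omega> x. \<xi> \<bullet> \<nu> = 0) \<and>
     (\<exists>\<epsilon>>0. \<forall>s. 0 < s \<and> s < \<epsilon> \<longrightarrow> x + s *\<^sub>R \<nu> \<in> \<Omega>))"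

definition bdist :: "(real^'n) set \<Rightarrow> real^'n \<Rightarrow> real" where
  "bdist \<Omega> x = infdist x (frontier \<Omega>)"

definition collar :: "(real^'n) set \<Rightarrow> real \<Rightarrow> (real^'n) set" where
  "collar \<Omega> \<delta> = {x \<in> closure \<Omega>. bdist \<Omega> x < \<delta>}"

text \<open>For a bounded \<open>C\<^sup>4\<close> domain the distance function is \<open>C\<^sup>4\<close> on the collar for all
  sufficiently small \<open>\<delta>\<close> (Gilbarg--Trudinger, Lemma 14.16).\<close>

definition regular_collar :: "(real^'n) set \<Rightarrow> real \<Rightarrow> bool" where
  "regular_collar \<Omega> \<delta> \<longleftrightarrow> 0 < \<delta> \<and> Ck_on 4 \<Omega> (collar \<Omega> \<delta>) (bdist \<Omega>)"

definition hess_convex :: "(real^'n) set \<Rightarrow> (real^'n \<Rightarrow> real) \<Rightarrow> bool" where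
  "hess_convex \<Omega> f \<longleftrightarrow> (\<forall>x\<in>\<Omega>. psd (hess \<Omega> f x))"

definition level_jet ::
  "(real^'n) set \<Rightarrow> real \<Rightarrow> real \<Rightarrow> real^'n \<Rightarrow> real^'n^'n \<Rightarrow> bool" where
  "level_jet K \<theta> t p X \<longleftrightarrow> t \<in> {0..1} \<and> p \<in> K \<and> psd X \<and> G_op t p X = \<theta>"

definition J_jet :: "(real^'n) set \<Rightarrow> (real^'n \<Rightarrow> real) \<Rightarrow>
    real^'n \<Rightarrow> real \<Rightarrow> real^'n \<Rightarrow> real^'n^'n \<Rightarrow> real" where
  "J_jet \<Omega> ub x t p X =
     frob (a_mat t p X) (hess \<Omega> ub x - X) + b_vec t p X \<bullet> (grad \<Omega> ub x - p)"

definition l_jet :: "(real^'n) set \<Rightarrow> real^'n \<Rightarrow> real \<Rightarrow> real^'n \<Rightarrow> real^'n^'n \<Rightarrow> real" where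
  "l_jet \<Omega> x t p X =
     frob (a_mat t p X) (hess \<Omega> (bdist \<Omega>) x) + b_vec t p X \<bullet> grad \<Omega> (bdist \<Omega>) x"

definition Q_jet :: "(real^'n) set \<Rightarrow> (real^'n \<Rightarrow> real) \<Rightarrow>
    real^'n \<Rightarrow> real \<Rightarrow> real^'n \<Rightarrow> real^'n^'n \<Rightarrow> real" where
  "Q_jet \<Omega> ub x t p X = bilin (a_mat t p X) (p - grad \<Omega> ub x) (p - grad \<Omega> ub x)"

definition recession_seq :: "(real^'n) set \<Rightarrow> (real^'n) set \<Rightarrow> real \<Rightarrow> real \<Rightarrow> (real^'n \<Rightarrow> real) \<Rightarrow>
    real^'n \<Rightarrow> (nat \<Rightarrow> real^'n) \<Rightarrow> (nat \<Rightarrow> real) \<Rightarrow> (nat \<Rightarrow> real^'n) \<Rightarrow> (nat \<Rightarrow> real^'n^'n) \<Rightarrow> bool" where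
  "recession_seq \<Omega> K \<theta> \<delta> ub x0 x t p X \<longleftrightarrow>
     (\<forall>m. x m \<in> collar \<Omega> \<delta> \<and> level_jet K \<theta> (t m) (p m) (X m)) \<and>
     x \<longlonglongrightarrow> x0 \<and>
     filterlim (\<lambda>m. mat_norm (X m)) at_top sequentially \<and>
     (\<lambda>m. bilin (a_mat (t m) (p m) (X m))
            (grad \<Omega> (bdist \<Omega>) (x m)) (grad \<Omega> (bdist \<Omega>) (x m))) \<longlonglongrightarrow> 0 \<and>
     (\<lambda>m. Q_jet \<Omega> ub (x m) (t m) (p m) (X m)) \<longlonglongrightarrow> 0"

definition recession_pairs :: "(real^'n) set \<Rightarrow> (real^'n) set \<Rightarrow> real \<Rightarrow> real \<Rightarrow>
    (real^'n \<Rightarrow> real) \<Rightarrow> real^'n \<Rightarrow> (real \<times> real) set" where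
  "recession_pairs \<Omega> K \<theta> \<delta> ub x0 =
     {(j, g). \<exists>x t p X r. recession_seq \<Omega> K \<theta> \<delta> ub x0 x t p X \<and> strict_mono (r :: nat \<Rightarrow> nat) \<and>
        (\<lambda>m. (J_jet \<Omega> ub (x (r m)) (t (r m)) (p (r m)) (X (r m)),
              - l_jet \<Omega> (x (r m)) (t (r m)) (p (r m)) (X (r m)))) \<longlonglongrightarrow> (j, g)}"

text \<open>The margin is an extended real, so that the infimum over the empty set is \<open>\<infinity>\<close>.\<close>

definition mrc_margin :: "(real^'n) set \<Rightarrow> (real^'n) set \<Rightarrow> real \<Rightarrow> real \<Rightarrow>
    (real^'n \<Rightarrow> real) \<Rightarrow> real^'n \<Rightarrow> real \<Rightarrow> ereal" where
  "mrc_margin \<Omega> K \<theta> \<delta> ub x0 \<tau> =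
     (INF (j, g)\<in>recession_pairs \<Omega> K \<theta> \<delta> ub x0. ereal (j + \<tau> * g))"

definition mrc_at :: "(real^'n) set \<Rightarrow> (real^'n) set \<Rightarrow> real \<Rightarrow> real \<Rightarrow>
    (real^'n \<Rightarrow> real) \<Rightarrow> real^'n \<Rightarrow> bool" where
  "mrc_at \<Omega> K \<theta> \<delta> ub x0 \<longleftrightarrow> (\<exists>\<tau>>0. mrc_margin \<Omega> K \<theta> \<delta> ub x0 \<tau> > 0)"

definition mrc_on_boundary :: "(real^'n) set \<Rightarrow> (real^'n) set \<Rightarrow> real \<Rightarrow> real \<Rightarrow>
    (real^'n \<Rightarrow> real) \<Rightarrow> bool" where
  "mrc_on_boundary \<Omega> K \<theta> \<delta> ub \<longleftrightarrow> (\<forall>x0\<in>frontier \<Omega>. mrc_at \<Omega> K \<theta> \<delta> ub x0)"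

definition mrc_uniform :: "(real^'n) set \<Rightarrow> (real^'n) set \<Rightarrow> real \<Rightarrow> real \<Rightarrow>
    (real^'n \<Rightarrow> real) \<Rightarrow> bool" where
  "mrc_uniform \<Omega> K \<theta> \<delta> ub \<longleftrightarrow>
     (\<exists>\<tau> \<mu>. 0 < \<mu> \<and> (\<forall>x0\<in>frontier \<Omega>. 0 < \<tau> x0 \<and> ereal \<mu> \<le> mrc_margin \<Omega> K \<theta> \<delta> ub x0 (\<tau> x0)))"

definition admissible_solution :: "(real^'n) set \<Rightarrow> (real^'n) set \<Rightarrow> real \<Rightarrow>
    (real^'n \<Rightarrow> real) \<Rightarrow> real \<Rightarrow> (real^'n \<Rightarrow> real) \<Rightarrow> bool" where
  "admissible_solution \<Omega> K \<theta> ub t u \<longleftrightarrow>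
     Ck_on 4 \<Omega> (closure \<Omega>) u \<and> hess_convex \<Omega> u \<and>
     (\<forall>x\<in>\<Omega>. G_op t (grad \<Omega> u x) (hess \<Omega> u x) = \<theta>) \<and>
     (\<forall>x\<in>frontier \<Omega>. u x = ub x) \<and>
     grad \<Omega> u ` closure \<Omega> \<subseteq> K \<and>
     (\<forall>x\<in>\<Omega>. ub x \<le> u x)"

definition mixed_sup :: "(real^'n) set \<Rightarrow> (real^'n \<Rightarrow> real) \<Rightarrow> ereal" where
  "mixed_sup \<Omega> u =
     (SUP x\<in>frontier \<Omega>. SUP \<xi>\<in>{\<xi> \<in> tangent_space \<Omega> x. norm \<xi> = 1}.
        ereal \<bar>bilin (hess \<Omega> u x) \<xi> (inner_normal \<Omega> x)\<bar>)"

end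

theory Submission
  imports Defs
begin

text \<open>
  Write \<open>\<phi> = u - ub\<close> and let \<open>L = a : D\<^sup>2 + b \<bullet> D\<close> be the linearized operator at \<open>u\<close>. Although \<open>|D\<^sup>2u|\<close> is not
  controlled, \<open>a\<close>, \<open>b\<close> and \<open>a D\<^sup>2u\<close> are, because the derivative of \<open>F\<close> at \<open>A\<close> is \<open>(1 + A\<^sup>2)\<^sup>-\<^sup>1\<close>. If
  \<open>T\<close> is a first-order operator tangential to the boundary, then \<open>T \<phi>\<close> vanishes on the boundary and \<open>L (T \<phi>)\<close> is
  bounded. The function \<open>v = \<phi> + \<tau> d - N d\<^sup>2 - N \<phi>\<^sup>2\<close> satisfies
  \<open>L v = -(J - \<tau> l) - 2 N (a(Dd, Dd) + Q) + O(N (d + \<phi>))\<close>. The recession condition and a compactness argument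
  show that near a boundary point at least one of \<open>a(Dd, Dd)\<close>, \<open>Q\<close> and \<open>J - \<tau> l\<close> is bounded below by a positive
  constant on all level jets, so that \<open>L v\<close> is uniformly negative for a large \<open>N\<close> on a small ball. The maximum
  principle for \<open>A1 v + A2 |x - x1|\<^sup>2 \<plusminus> T \<phi>\<close> bounds the normal derivative of \<open>T \<phi>\<close> at \<open>x1\<close>. The
  constants are locally uniform in \<open>x1\<close>, and finitely many balls cover the boundary.
\<close>

section \<open>Symmetric matrices and the trace of the arctangent\<close>

text \<open>What blocks a standard barrier is that \<open>D\<^sup>2u\<close> may be arbitrarily
  large, so \<open>a\<close> has no positive lower bound and no combination of \<open>d\<close> and
  \<open>\<phi>\<close> is a supersolution for free. All constants must come from jets
  \<open>(t, p, X)\<close> with \<open>p\<close> bounded and \<open>X\<close> unrestricted. This is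
  possible because \<open>A = C X C\<close> with \<open>C\<close> depending on
  \<open>t *\<^sub>R p\<close> only: then \<open>a = C R C\<close> with
  \<open>R = (1 + A\<^sup>2)\<^sup>-\<^sup>1\<close>, and \<open>C X = A C\<^sup>-\<^sup>1\<close>,
  so \<open>X\<close> enters the estimates through \<open>R\<close> and \<open>R A\<close>, whose
  operator norms are at most 1.

  The summand \<open>\<tau> d\<close> is there because \<open>L \<phi> = -J\<close> has no sign by
  itself, while \<open>J - \<tau> l\<close> is the quantity whose limits the margin controls. The
  corrections in \<open>v\<close> are harmless near the boundary, where they are dominated by
  \<open>\<phi>\<close> and \<open>\<tau> d\<close>. The term \<open>A2 |x - x1|\<^sup>2\<close>
  pays for \<open>T \<phi>\<close> on the part of the sphere inside \<Omega>, where only a bound on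
  \<open>T \<phi>\<close> is known.

  Derivatives at boundary points are limits from inside, so boundary identities are obtained by the
  mean value theorem in \<Omega> followed by a limit.\<close>

lemma frob_eq_inner: "frob X Y = X \<bullet> transpose Y"
  by (simp add: frob_def trace_def matrix_matrix_mult_def inner_vec_def transpose_def)

lemma sym_mats_iff: "X \<in> sym_mats \<longleftrightarrow> (\<forall>x y. x \<bullet> (X *v y) = (X *v x) \<bullet> y)"
proof -
  have *: "(X *v x) \<bullet> y = x \<bullet> (transpose X *v y)" for x y
    by (metis dot_lmul_matrix transpose_matrix_vector transpose_transpose)
  show ?thesis
    unfolding * sym_mats_def mem_Collect_eq
    by (metis matrix_eq vector_eq_ldot)
qed

lemma sym_matsD: "X \<in> sym_mats \<Longrightarrow> (X *v x) \<bullet> y = x \<bullet> (X *v y)"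
  by (simp add: sym_mats_iff)

lemma subspace_sym_mats: "subspace (sym_mats :: (real^'n^'n) set)"
  unfolding subspace_def sym_mats_def by (auto simp: transpose_def vec_eq_iff)

lemma frob_sym: "Y \<in> sym_mats \<Longrightarrow> frob X Y = X \<bullet> Y"
  by (simp add: frob_eq_inner sym_mats_def)

text \<open>Indexing by \<open>'n\<close> makes an orthonormal family automatically a basis and
  records eigenvalues with multiplicity.\<close>

definition eigenbasis :: "real^'n^'n \<Rightarrow> ('n \<Rightarrow> real^'n) \<Rightarrow> ('n \<Rightarrow> real) \<Rightarrow> bool" where
  "eigenbasis M v d \<longleftrightarrow>
     (\<forall>i j. v i \<bullet> v j = (if i = j then 1 else 0)) \<and> (\<forall>i. M *v v i = d i *\<^sub>R v i)"

text \<open>A maximizer of the Rayleigh quotient is an eigenvector.\<close>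

lemma sym_eigenvector_exists:
  fixes M :: "real^'n^'n"
  assumes M: "M \<in> sym_mats" and S: "subspace S" and inv: "\<And>x. x \<in> S \<Longrightarrow> M *v x \<in> S"
    and z: "z \<in> S" "z \<noteq> 0"
  obtains x l where "x \<in> S" "norm x = 1" "M *v x = l *\<^sub>R x"
proof -
  let ?K = "S \<inter> sphere 0 1"
  have cont: "continuous_on ?K (\<lambda>x. x \<bullet> (M *v x))"
    by (intro continuous_intros linear_continuous_on_compose[OF continuous_on_id]
        matrix_vector_mul_linear)
  have "compact ?K"
    using closed_Int_compact[OF closed_subspace[OF S] compact_sphere] .
  moreover have "(1 / norm z) *\<^sub>R z \<in> ?K"
    using z S by (simp add: subspace_scale)
  ultimately obtain x where x: "x \<in> ?K" and mx: "\<And>y. y \<in> ?K \<Longrightarrow> y \<bullet> (M *v y) \<le> x \<bullet> (M *v x)"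
    using continuous_attains_sup[OF _ _ cont] by (metis empty_iff)
  define l where "l = x \<bullet> (M *v x)"
  have xx: "x \<bullet> x = 1" using x by (simp add: norm_eq_1)
  have le: "y \<bullet> (M *v y) \<le> l * (y \<bullet> y)" if "y \<in> S" for y
  proof (cases "y = 0")
    case False
    have "(1 / norm y) *\<^sub>R y \<in> ?K" using that S False by (simp add: subspace_scale)
    from mx[OF this] have "(1 / norm y) * ((1 / norm y) * (y \<bullet> (M *v y))) \<le> l"
      by (simp add: l_def matrix_vector_mult_scaleR)
    then have "(y \<bullet> (M *v y)) / (norm y)\<^sup>2 \<le> l"
      by (simp add: power2_eq_square)
    then show ?thesis using False by (simp add: divide_le_eq dot_square_norm)
  qed simp
  define w where "w = M *v x - l *\<^sub>R x"
  have wS: "w \<in> S" unfolding w_def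
    using x inv S by (simp add: subspace_diff subspace_scale)
  have xw: "x \<bullet> w = 0" by (simp add: w_def inner_diff_right xx l_def)
  have ww: "w \<bullet> (M *v x) = w \<bullet> w"
    using xw by (simp add: w_def inner_diff_right inner_diff_left inner_commute)
  \<comment> \<open>Maximality is tested at \<open>x + s *\<^sub>R w\<close>, where \<open>w\<close>
    is the part of \<open>M *v x\<close> orthogonal to \<open>x\<close>. The gain is linear in
    \<open>s\<close>, the loss quadratic, so a small positive \<open>s\<close> is contradictory
    unless \<open>w = 0\<close>.\<close>
  have key: "2 * s * (w \<bullet> w) \<le> s\<^sup>2 * (l * (w \<bullet> w) - w \<bullet> (M *v w))" for s
  proof -
    have "x + s *\<^sub>R w \<in> S" using x wS S by (simp add: subspace_add subspace_scale)
    from le[OF this] have "(x + s *\<^sub>R w) \<bullet> (M *v (x + s *\<^sub>R w)) \<le> l * ((x + s *\<^sub>R w) \<bullet> (x + s *\<^sub>R w))" .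
    moreover have "x \<bullet> (M *v w) = w \<bullet> w"
      using M ww by (simp add: sym_mats_iff) (metis inner_commute)
    ultimately have "l + s * (w \<bullet> w) + s * (w \<bullet> w) + s * (s * (w \<bullet> (M *v w))) \<le> l * (1 + s * (s * (w \<bullet> w)))"
      using xw ww xx by (simp add: matrix_vector_mult_scaleR matrix_vector_right_distrib inner_add_left
          inner_add_right inner_commute[of w x] l_def algebra_simps)
    then show ?thesis by (simp add: algebra_simps power2_eq_square)
  qed
  have "w \<bullet> w = 0"
  proof (rule ccontr)
    assume "w \<bullet> w \<noteq> 0"
    then have pos: "w \<bullet> w > 0" using inner_ge_zero[of w] by linarith
    define c where "c = \<bar>l * (w \<bullet> w) - w \<bullet> (M *v w)\<bar> + 1"
    have c: "c > 0" "l * (w \<bullet> w) - w \<bullet> (M *v w) \<le> c" by (auto simp: c_def)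
    define s where "s = (w \<bullet> w) / c"
    have s: "s > 0" using pos c by (simp add: s_def)
    have "2 * s * (w \<bullet> w) \<le> s\<^sup>2 * c"
      using key[of s] mult_left_mono[OF c(2), of "s\<^sup>2"] by simp
    also have "\<dots> = s * (w \<bullet> w)" using c by (simp add: s_def power2_eq_square)
    finally show False using s pos by (simp add: mult_le_cancel_right)
  qed
  then have "M *v x = l *\<^sub>R x" by (simp add: w_def)
  then show ?thesis using that x by auto
qed

text \<open>Take an orthonormal set of eigenvectors of largest cardinality. If it had fewer than
  \<open>CARD('n)\<close> elements, its orthogonal complement would be a nonzero invariant subspace
  and would supply one more eigenvector.\<close>

lemma eigenbasis_exists:
  fixes M :: "real^'n^'n"
  assumes M: "M \<in> sym_mats"
  obtains v d where "eigenbasis M v d"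
proof -
  define P where "P B \<longleftrightarrow> pairwise orthogonal B \<and> (\<forall>b\<in>B. norm b = 1 \<and> (\<exists>l. M *v b = l *\<^sub>R b))"
    for B :: "(real^'n) set"
  have ind: "independent B" if "P B" for B
    using that by (intro pairwise_orthogonal_independent) (auto simp: P_def)
  have bd: "card B \<le> CARD('n)" if "P B" for B
    using independent_bound[OF ind[OF that]] by simp
  have "P {}" by (simp add: P_def)
  then obtain B where B: "P B" and mx: "\<And>B'. P B' \<Longrightarrow> card B' \<le> card B"
    using arg_max_nat_lemma[of P "{}" card "CARD('n) + 1"] bd
    by (metis Suc_eq_plus1 le_imp_less_Suc)
  have fin: "finite B" using independent_bound[OF ind[OF B]] by simp
  have "card B = CARD('n)"
  proof (rule ccontr)
    assume "card B \<noteq> CARD('n)"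
    then have "card B < CARD('n)" using bd[OF B] by simp
    then have "dim (span B) < DIM(real^'n)"
      using ind[OF B] by (simp add: dim_eq_card_independent)
    then obtain z where z: "z \<noteq> 0" "\<And>y. y \<in> span B \<Longrightarrow> orthogonal z y"
      using orthogonal_to_subspace_exists by (metis dim_span)
    define S where "S = {x. \<forall>b\<in>B. b \<bullet> x = 0}"
    have S: "subspace S" by (auto simp: S_def subspace_def inner_add_right)
    have zS: "z \<in> S" using z(2) by (auto simp: S_def span_base orthogonal_def inner_commute)
    have inv: "M *v x \<in> S" if x: "x \<in> S" for x
      unfolding S_def
    proof (safe)
      fix b assume b: "b \<in> B"
      then obtain l where "M *v b = l *\<^sub>R b" using B by (auto simp: P_def)
      then show "b \<bullet> (M *v x) = 0"
        using M x b by (simp add: sym_mats_iff S_def)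
    qed
    obtain x l where x: "x \<in> S" "norm x = 1" "M *v x = l *\<^sub>R x"
      using sym_eigenvector_exists[OF M S inv zS z(1)] by metis
    have "x \<notin> B"
    proof
      assume "x \<in> B"
      then have "x \<bullet> x = 0" using x by (auto simp: S_def)
      then show False using x by simp
    qed
    moreover have "P (insert x B)"
      using B x unfolding P_def
      by (auto simp: pairwise_insert orthogonal_def S_def inner_commute)
    ultimately show False using mx[of "insert x B"] fin by simp
  qed
  then obtain v where v: "bij_betw v (UNIV :: 'n set) B"
    using fin by (metis finite_same_card_bij finite)
  have vB: "v i \<in> B" for i using v by (auto simp: bij_betw_def)
  have "\<forall>i. \<exists>l. M *v v i = l *\<^sub>R v i"
    using vB B by (auto simp: P_def)
  from choice[OF this] have "\<exists>d. \<forall>i. M *v v i = d i *\<^sub>R v i" .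
  then obtain d where d: "\<And>i. M *v v i = d i *\<^sub>R v i" by blast
  have "v i \<bullet> v j = (if i = j then 1 else 0)" for i j
  proof (cases "i = j")
    case True
    then show ?thesis using vB[of j] B by (simp add: P_def norm_eq_1)
  next
    case False
    then have "v i \<noteq> v j" using v by (metis UNIV_I bij_betw_def inj_on_def)
    then show ?thesis using vB B False unfolding P_def pairwise_def orthogonal_def by simp
  qed
  then have "eigenbasis M v d" using d by (simp add: eigenbasis_def)
  then show ?thesis by (rule that)
qed

definition row_mat :: "('n \<Rightarrow> real^'n) \<Rightarrow> real^'n^'n" where
  "row_mat v = (\<chi> i. v i)"

lemma
  assumes "eigenbasis M v d"
  shows eigenbasis_row_transpose: "row_mat v ** transpose (row_mat v) = mat 1"
    and eigenbasis_transpose_row: "transpose (row_mat v) ** row_mat v = mat 1"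
proof -
  show *: "row_mat v ** transpose (row_mat v) = mat 1"
    using assms by (simp add: eigenbasis_def row_mat_def matrix_matrix_mult_def transpose_def mat_def
        vec_eq_iff inner_vec_def)
  then show "transpose (row_mat v) ** row_mat v = mat 1"
    by (rule matrix_left_right_inverse[THEN iffD1])
qed

lemma eigenbasis_expand:
  assumes "eigenbasis M v d"
  shows "x = (\<Sum>i\<in>UNIV. (v i \<bullet> x) *\<^sub>R v i)"
proof -
  have "x = transpose (row_mat v) *v (row_mat v *v x)"
    using eigenbasis_transpose_row[OF assms] by (simp add: matrix_vector_mul_assoc)
  also have "\<dots> = (\<Sum>i\<in>UNIV. (v i \<bullet> x) *\<^sub>R v i)"
    by (simp add: vec_eq_iff matrix_vector_mult_def row_mat_def transpose_def inner_vec_def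
        sum_component mult.commute)
  finally show ?thesis .
qed

lemma eigenbasis_parseval:
  assumes "eigenbasis M v d"
  shows "x \<bullet> y = (\<Sum>i\<in>UNIV. (v i \<bullet> x) * (v i \<bullet> y))"
proof -
  have "x \<bullet> y = (\<Sum>i\<in>UNIV. (v i \<bullet> x) *\<^sub>R v i) \<bullet> y"
    using eigenbasis_expand[OF assms, of x] by simp
  then show ?thesis by (simp add: inner_sum_left)
qed

lemma eigenbasis_norm:
  assumes "eigenbasis M v d"
  shows "(norm x)\<^sup>2 = (\<Sum>i\<in>UNIV. (v i \<bullet> x)\<^sup>2)"
  unfolding power2_norm_eq_inner eigenbasis_parseval[OF assms, of x x] by (simp add: power2_eq_square)

lemma eigenbasis_trace:
  assumes "eigenbasis M v d"
  shows "trace T = (\<Sum>i\<in>UNIV. v i \<bullet> (T *v v i))"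
proof -
  have "trace T = trace (T ** (transpose (row_mat v) ** row_mat v))"
    using eigenbasis_transpose_row[OF assms] by simp
  also have "\<dots> = trace (row_mat v ** (T ** transpose (row_mat v)))"
    by (metis matrix_mul_assoc trace_mul_sym)
  also have "\<dots> = (\<Sum>i\<in>UNIV. v i \<bullet> (T *v v i))"
    by (simp add: trace_def matrix_matrix_mult_def matrix_vector_mult_def row_mat_def transpose_def
        inner_vec_def)
  finally show ?thesis .
qed

text \<open>The norm of the type \<open>real^'n^'n\<close> is the Frobenius norm, that is, the
  square root of the trace of \<open>transpose T ** T\<close>, and a trace can be computed in any
  orthonormal basis.\<close>

lemma eigenbasis_frobenius:
  fixes T :: "real^'n^'n"
  assumes "eigenbasis M v d"
  shows "(norm T)\<^sup>2 = (\<Sum>i\<in>UNIV. (norm (T *v v i))\<^sup>2)"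
proof -
  have "(norm T)\<^sup>2 = trace (transpose T ** T)"
    using frob_eq_inner[of T "transpose T"]
    by (simp add: frob_def trace_mul_sym[of T] power2_norm_eq_inner)
  also have "\<dots> = (\<Sum>i\<in>UNIV. v i \<bullet> (transpose T *v (T *v v i)))"
    by (subst eigenbasis_trace[OF assms]) (simp add: matrix_vector_mul_assoc)
  also have "\<dots> = (\<Sum>i\<in>UNIV. (T *v v i) \<bullet> (T *v v i))"
    by (metis dot_lmul_matrix inner_commute transpose_matrix_vector transpose_transpose)
  finally show ?thesis by (simp add: power2_norm_eq_inner)
qed

lemma eigenbasis_mat_1: "eigenbasis (mat 1) (\<lambda>i. axis i 1) (\<lambda>_. 1)"
  by (simp add: eigenbasis_def inner_axis_axis)

section \<open>Frobenius norm and operator bounds\<close>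

lemma norm_matrix_vector_le: "norm ((A :: real^'n^'n) *v x) \<le> norm A * norm x"
proof -
  have "(norm (A *v x))\<^sup>2 = (\<Sum>i\<in>UNIV. (A $ i \<bullet> x)\<^sup>2)"
    by (simp add: norm_vec_def L2_set_def matrix_vector_mul_component sum_nonneg)
  also have "\<dots> \<le> (\<Sum>i\<in>UNIV. (norm (A $ i))\<^sup>2 * (norm x)\<^sup>2)"
    by (intro sum_mono) (metis Cauchy_Schwarz_ineq power2_norm_eq_inner)
  also have "\<dots> = (norm A * norm x)\<^sup>2"
    by (simp add: norm_vec_def[of A] L2_set_def sum_nonneg power_mult_distrib sum_distrib_right)
  finally show ?thesis by (rule power2_le_imp_le) simp
qed

text \<open>The square root of \<open>CARD('n)\<close> would do as the factor; the cruder one avoids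
  a root in later constants.\<close>

lemma norm_matrix_le_op:
  fixes T :: "real^'n^'n"
  assumes "\<And>x. norm (T *v x) \<le> c * norm x" and c: "0 \<le> c"
  shows "norm T \<le> real CARD('n) * c"
proof (rule power2_le_imp_le)
  have "(norm T)\<^sup>2 \<le> (\<Sum>i\<in>(UNIV::'n set). c\<^sup>2)"
    unfolding eigenbasis_frobenius[OF eigenbasis_mat_1, of T]
    by (intro sum_mono) (metis assms(1) mult.right_neutral norm_axis_1 norm_ge_zero power_mono)
  also have "\<dots> = real CARD('n) * c\<^sup>2" by simp
  also have "\<dots> \<le> (real CARD('n) * real CARD('n)) * c\<^sup>2"
    by (intro mult_right_mono) (auto simp: Suc_leI)
  finally show "(norm T)\<^sup>2 \<le> (real CARD('n) * c)\<^sup>2" by (simp add: power2_eq_square mult_ac)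
qed (use c in simp)

lemma norm_matrix_mult_le: "norm ((A :: real^'n^'n) ** B) \<le> norm A * norm (B :: real^'n^'n)"
proof (rule power2_le_imp_le)
  have "(norm (A ** B))\<^sup>2 \<le> (\<Sum>i\<in>UNIV. (norm A)\<^sup>2 * (norm (B *v axis i 1))\<^sup>2)"
    unfolding eigenbasis_frobenius[OF eigenbasis_mat_1, of "A ** B"]
    by (intro sum_mono)
      (metis matrix_vector_mul_assoc norm_ge_zero norm_matrix_vector_le power_mono power_mult_distrib)
  also have "\<dots> = (norm A * norm B)\<^sup>2"
    unfolding eigenbasis_frobenius[OF eigenbasis_mat_1, of B] power_mult_distrib
    by (simp add: sum_distrib_left)
  finally show "(norm (A ** B))\<^sup>2 \<le> (norm A * norm B)\<^sup>2" .
qed simp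

lemma bounded_bilinear_matrix_mult:
  "bounded_bilinear ((**) :: real^'n^'n \<Rightarrow> real^'n^'n \<Rightarrow> real^'n^'n)"
proof
  show "\<exists>K. \<forall>a b. norm ((a :: real^'n^'n) ** (b :: real^'n^'n)) \<le> norm a * norm b * K"
    by (rule exI[of _ 1]) (simp add: norm_matrix_mult_le)
qed (auto simp: matrix_matrix_mult_def vec_eq_iff algebra_simps sum.distrib sum_distrib_left)

lemma norm_transpose: "norm (transpose (A :: real^'n^'n)) = norm A"
  by (metis (no_types) frob_def frob_eq_inner norm_eq_sqrt_inner trace_mul_sym transpose_transpose)

lemma norm_frob_le: "\<bar>frob X Y\<bar> \<le> norm X * norm Y"
  by (metis Cauchy_Schwarz_ineq2 frob_eq_inner norm_transpose)

section \<open>Eigenvalues as roots of the characteristic polynomial\<close>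

lemma map_matrix_const_mult:
  fixes A B :: "real^'n^'n"
  shows "map_matrix (\<lambda>c. [:c:]) (A ** B) = map_matrix (\<lambda>c. [:c:]) A ** map_matrix (\<lambda>c. [:c:]) B"
proof -
  have "(\<Sum>k\<in>S. [:f k:]) = [:\<Sum>k\<in>S. f k:]" for f :: "'n \<Rightarrow> real" and S
    by (induction S rule: infinite_finite_induct) auto
  then show ?thesis by (simp add: vec_eq_iff matrix_matrix_mult_def mult.commute)
qed

text \<open>Diagonalization is carried out over polynomial matrices: conjugating the characteristic
  matrix by the constant orthogonal matrix of eigenvectors makes it diagonal, and the two outer
  determinants multiply to 1.\<close>

lemma eigvals_eigenbasis:
  assumes "eigenbasis M v d"
  shows "eigvals M = image_mset d (mset_set UNIV)"
proof -
  let ?c = "map_matrix (\<lambda>c. [:c:]) :: real^'n^'n \<Rightarrow> _"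
  let ?V = "row_mat v"
  let ?x = "mat [:0, 1:] :: real poly^'n^'n"
  have id: "?c (mat 1) = mat 1" by (auto simp: vec_eq_iff mat_def)
  have tr: "?c (transpose ?V) = transpose (?c ?V)" by (simp add: vec_eq_iff transpose_def)
  have VV: "?c ?V ** transpose (?c ?V) = mat 1"
    using eigenbasis_row_transpose[OF assms] map_matrix_const_mult[of ?V "transpose ?V"] id tr by metis
  have comm: "A ** ?x = ?x ** A" for A :: "real poly^'n^'n"
    by (simp add: vec_eq_iff matrix_matrix_mult_def mat_def if_distrib if_distribR mult.commute cong: if_cong)
  have diag: "(?V ** M ** transpose ?V) $ i $ j = (if i = j then d i else 0)" for i j
  proof -
    have "(?V ** M ** transpose ?V) $ i $ j = v i \<bullet> (M *v v j)"
      unfolding matrix_mul_assoc[symmetric]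
      by (simp add: matrix_matrix_mult_def matrix_vector_mult_def row_mat_def transpose_def
          inner_vec_def)
    then show ?thesis using assms by (simp add: eigenbasis_def)
  qed
  have dl: "A ** (B - C) = A ** B - A ** C" and dr: "(B - C) ** A = B ** A - C ** A"
    for A B C :: "real poly^'n^'n"
    by (simp_all add: matrix_matrix_mult_def vec_eq_iff algebra_simps sum_subtractf)
  have "?c ?V ** (?x - ?c M) ** transpose (?c ?V)
      = ?x ** ?c ?V ** transpose (?c ?V) - ?c ?V ** ?c M ** transpose (?c ?V)"
    by (simp only: dl dr comm)
  also have "?x ** ?c ?V ** transpose (?c ?V) = ?x"
    by (metis VV matrix_mul_assoc matrix_mul_rid)
  finally have "?c ?V ** (?x - ?c M) ** transpose (?c ?V) = ?x - ?c (?V ** M ** transpose ?V)"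
    by (simp only: map_matrix_const_mult tr)
  then have "det (?c ?V) * det (?x - ?c M) * det (transpose (?c ?V))
      = det (?x - ?c (?V ** M ** transpose ?V))"
    by (metis det_mul)
  also have "\<dots> = (\<Prod>i\<in>UNIV. [:- d i, 1:])"
    by (subst det_diagonal) (auto simp: diag mat_def)
  finally have "det (?c ?V) * det (?x - ?c M) * det (transpose (?c ?V)) = (\<Prod>i\<in>UNIV. [:- d i, 1:])" .
  moreover have "a = p" if "v * a * w = p" "v * w = 1" for a p v w :: "real poly"
    using that by (metis mult.commute mult.left_commute mult.right_neutral)
  ultimately have "det (?x - ?c M) = (\<Prod>i\<in>UNIV. [:- d i, 1:])"
    using arg_cong[OF VV, of det] unfolding det_mul det_I by blast
  then have "eigvals M = (\<Sum>i\<in>UNIV. {# d i #})"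
    unfolding eigvals_def by (simp add: proots_prod)
  moreover have "(\<Sum>i\<in>A. {# d i #}) = image_mset d (mset_set A)" if "finite A" for A
    using that by (induction A) auto
  ultimately show ?thesis by simp
qed

lemma F_op_eigenbasis:
  assumes "eigenbasis M v d"
  shows "F_op M = (\<Sum>i\<in>UNIV. arctan (d i))"
  unfolding F_op_def eigvals_eigenbasis[OF assms]
  by (simp add: sum_unfold_sum_mset image_mset.compositionality comp_def)

section \<open>Arctangent, resolvent and the differential of \<open>F_op\<close>\<close>

lemma one_plus_square_ge: "1 \<le> 1 + (x::real)\<^sup>2" "\<bar>x\<bar> \<le> 1 + x\<^sup>2" "0 < 1 + x\<^sup>2"
proof -
  have "2 * \<bar>x\<bar> \<le> 1 + x\<^sup>2" using zero_le_power2[of "\<bar>x\<bar> - 1"] by (simp add: power2_diff)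
  then show "\<bar>x\<bar> \<le> 1 + x\<^sup>2" by linarith
  show "0 < 1 + x\<^sup>2" by (smt (verit) zero_le_power2)
qed simp

text \<open>The derivative of the arctangent is 1-Lipschitz. Hence the derivative of arctangent
  minus its linear part at \<open>x\<close> is at most \<open>\<bar>y - x\<bar>\<close> on the
  segment, and the mean value inequality contributes a second factor.\<close>

lemma arctan_taylor: "\<bar>arctan y - arctan x - (y - x) / (1 + x\<^sup>2)\<bar> \<le> (y - x)\<^sup>2"
proof -
  have lip: "\<bar>1 / (1 + z\<^sup>2) - 1 / (1 + x\<^sup>2)\<bar> \<le> \<bar>z - x\<bar>" for z :: real
  proof -
    note pos = one_plus_square_ge(3)[of z] one_plus_square_ge(3)[of x]
    have "\<bar>x + z\<bar> \<le> (1 + z\<^sup>2) * (1 + x\<^sup>2)"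
    proof -
      have "2 * \<bar>x\<bar> \<le> 1 + x\<^sup>2" "2 * \<bar>z\<bar> \<le> 1 + z\<^sup>2"
        using zero_le_power2[of "\<bar>x\<bar> - 1"] zero_le_power2[of "\<bar>z\<bar> - 1"]
        by (auto simp: power2_diff)
      then have "\<bar>x + z\<bar> \<le> 1 + x\<^sup>2 + z\<^sup>2" by (smt (verit) zero_le_power2)
      then show ?thesis using mult_nonneg_nonneg[OF zero_le_power2[of z] zero_le_power2[of x]]
        unfolding distrib_left distrib_right by linarith
    qed
    then have "\<bar>x - z\<bar> * \<bar>x + z\<bar> \<le> \<bar>x - z\<bar> * ((1 + z\<^sup>2) * (1 + x\<^sup>2))"
      by (intro mult_left_mono) auto
    moreover have "1 / (1 + z\<^sup>2) - 1 / (1 + x\<^sup>2) = (x - z) * (x + z) / ((1 + z\<^sup>2) * (1 + x\<^sup>2))"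
      using pos by (simp add: field_simps power2_eq_square)
    ultimately show ?thesis using pos
      by (simp add: abs_mult abs_minus_commute[of z x] divide_le_eq)
  qed
  define g where "g z = arctan z - z / (1 + x\<^sup>2)" for z
  have "norm (g y - g x) \<le> \<bar>y - x\<bar> * norm (y - x)"
  proof (rule differentiable_bound[OF convex_closed_segment])
    fix z assume z: "z \<in> closed_segment x y"
    have "(g has_real_derivative 1 / (1 + z\<^sup>2) - 1 / (1 + x\<^sup>2)) (at z within closed_segment x y)"
      unfolding g_def using one_plus_square_ge(3)[of x]
      by (auto intro!: derivative_eq_intros simp: inverse_eq_divide)
    then show "(g has_derivative (*) (1 / (1 + z\<^sup>2) - 1 / (1 + x\<^sup>2))) (at z within closed_segment x y)"
      by (simp only: has_field_derivative_def)
    have "\<bar>z - x\<bar> \<le> \<bar>y - x\<bar>"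
      using dist_in_closed_segment[OF z] by (simp add: dist_real_def abs_minus_commute)
    then show "onorm ((*) (1 / (1 + z\<^sup>2) - 1 / (1 + x\<^sup>2))) \<le> \<bar>y - x\<bar>"
      by (intro onorm_le) (simp add: abs_mult mult_right_mono order_trans[OF lip])
  qed auto
  then show ?thesis by (simp add: g_def power2_eq_square diff_divide_distrib algebra_simps)
qed

lemma matrix_inv_left:
  fixes A :: "real^'n^'n"
  assumes "invertible A"
  shows "matrix_inv A ** A = mat 1"
proof -
  have "\<exists>A'. A ** A' = mat 1 \<and> A' ** A = mat 1"
    using assms by (simp add: invertible_def)
  from someI_ex[OF this] show ?thesis by (simp add: matrix_inv_def)
qed

text \<open>This is the derivative of the arctangent applied to the matrix \<open>M\<close>; it
  represents the differential of \<open>F_op\<close> at \<open>M\<close>.\<close>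

definition resolv :: "real^'n^'n \<Rightarrow> real^'n^'n" where
  "resolv M = matrix_inv (mat 1 + M ** M)"

lemma resolv_eigenbasis:
  assumes M: "M \<in> sym_mats" and eb: "eigenbasis M v d"
  shows "resolv M *v v i = (1 / (1 + (d i)\<^sup>2)) *\<^sub>R v i"
proof -
  let ?N = "mat 1 + M ** M"
  have N: "?N *v x = x + M *v (M *v x)" for x
    by (simp add: matrix_vector_mult_add_rdistrib matrix_vector_mul_assoc)
  have "x = 0" if "?N *v x = 0" for x
  proof -
    have "x \<bullet> x + (M *v x) \<bullet> (M *v x) = 0"
      using arg_cong[OF that, of "\<lambda>y. x \<bullet> y"] M by (simp add: N inner_add_right sym_matsD)
    then have "x \<bullet> x = 0" using inner_ge_zero[of "M *v x"] inner_ge_zero[of x] by linarith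
    then show ?thesis by simp
  qed
  then have "invertible ?N"
    using matrix_left_invertible_ker[of ?N] invertible_left_inverse by blast
  then have R: "resolv M ** ?N = mat 1"
    unfolding resolv_def by (rule matrix_inv_left)
  note pos = one_plus_square_ge(3)[of "d i"]
  have "?N *v v i = (1 + (d i)\<^sup>2) *\<^sub>R v i"
    using eb unfolding N eigenbasis_def
    by (simp only: matrix_vector_mult_scaleR scaleR_scaleR scaleR_left_distrib scaleR_one power2_eq_square)
  then have "v i = (1 + (d i)\<^sup>2) *\<^sub>R (resolv M *v v i)"
    using R by (metis matrix_vector_mul_assoc matrix_vector_mul_lid matrix_vector_mult_scaleR)
  then show ?thesis using pos
    by (metis (no_types, lifting) divide_inverse mult_1 scaleR_left_imp_eq scaleR_scaleR
        less_irrefl right_inverse scaleR_one mult.commute)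
qed

lemma resolv_apply:
  assumes M: "M \<in> sym_mats" and eb: "eigenbasis M v d"
  shows "resolv M *v x = (\<Sum>i\<in>UNIV. ((v i \<bullet> x) / (1 + (d i)\<^sup>2)) *\<^sub>R v i)"
proof -
  have "resolv M *v x = resolv M *v (\<Sum>i\<in>UNIV. (v i \<bullet> x) *\<^sub>R v i)"
    using eigenbasis_expand[OF eb, of x] by simp
  also have "\<dots> = (\<Sum>i\<in>UNIV. (v i \<bullet> x) *\<^sub>R (resolv M *v v i))"
    by (simp add: linear_sum[OF matrix_vector_mul_linear] matrix_vector_mult_scaleR)
  finally show ?thesis by (simp add: resolv_eigenbasis[OF assms])
qed

lemma resolv_inner:
  assumes M: "M \<in> sym_mats" and eb: "eigenbasis M v d"
  shows "v i \<bullet> (resolv M *v x) = (v i \<bullet> x) / (1 + (d i)\<^sup>2)"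
proof -
  have "v i \<bullet> (resolv M *v x) = (\<Sum>j\<in>UNIV. (v j \<bullet> x) / (1 + (d j)\<^sup>2) * (v i \<bullet> v j))"
    by (simp add: resolv_apply[OF assms] inner_sum_right)
  also have "\<dots> = (\<Sum>j\<in>UNIV. if j = i then (v i \<bullet> x) / (1 + (d i)\<^sup>2) else 0)"
    using eb by (intro sum.cong) (auto simp: eigenbasis_def)
  finally show ?thesis by simp
qed

lemma resolv_sym:
  assumes M: "M \<in> sym_mats"
  shows "resolv M \<in> sym_mats"
proof -
  obtain v d where eb: "eigenbasis M v d" using eigenbasis_exists[OF M] .
  show ?thesis unfolding sym_mats_iff
  proof (intro allI)
    fix x y
    show "x \<bullet> (resolv M *v y) = (resolv M *v x) \<bullet> y"
      using eigenbasis_parseval[OF eb, of x "resolv M *v y"]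
        eigenbasis_parseval[OF eb, of "resolv M *v x" y]
      by (simp add: resolv_inner[OF M eb])
  qed
qed

text \<open>On eigenvectors the factors are \<open>1 / (1 + d\<^sup>2)\<close> and
  \<open>d / (1 + d\<^sup>2)\<close>, both at most 1 in absolute value. The second bound is what
  later controls \<open>a\<close> times the Hessian without any bound on the Hessian.\<close>

lemma
  assumes M: "M \<in> sym_mats"
  shows norm_resolv_apply: "norm (resolv M *v x) \<le> norm x"
    and norm_resolv_mult_apply: "norm (resolv M *v (M *v x)) \<le> norm x"
proof -
  obtain v d where eb: "eigenbasis M v d" using eigenbasis_exists[OF M] .
  show "norm (resolv M *v x) \<le> norm x"
  proof (rule power2_le_imp_le)
    show "(norm (resolv M *v x))\<^sup>2 \<le> (norm x)\<^sup>2"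
      unfolding eigenbasis_norm[OF eb] resolv_inner[OF M eb]
    proof (intro sum_mono)
      fix i
      have "\<bar>(v i \<bullet> x) / (1 + (d i)\<^sup>2)\<bar> \<le> \<bar>v i \<bullet> x\<bar>"
        using one_plus_square_ge(1,3)[of "d i"] by (simp add: divide_le_eq mult_left_le[of 1] mult_le_cancel_left1)
      then show "((v i \<bullet> x) / (1 + (d i)\<^sup>2))\<^sup>2 \<le> (v i \<bullet> x)\<^sup>2"
        by (metis abs_le_square_iff)
    qed
  qed simp
  have Mi: "v i \<bullet> (M *v x) = d i * (v i \<bullet> x)" for i
    using eb M by (simp add: eigenbasis_def sym_mats_iff)
  show "norm (resolv M *v (M *v x)) \<le> norm x"
  proof (rule power2_le_imp_le)
    show "(norm (resolv M *v (M *v x)))\<^sup>2 \<le> (norm x)\<^sup>2"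
      unfolding eigenbasis_norm[OF eb] resolv_inner[OF M eb] Mi
    proof (intro sum_mono)
      fix i
      have "\<bar>d i * (v i \<bullet> x) / (1 + (d i)\<^sup>2)\<bar> \<le> \<bar>v i \<bullet> x\<bar>"
        using one_plus_square_ge(2,3)[of "d i"]
        by (simp add: divide_le_eq abs_mult mult.commute[of "\<bar>d i\<bar>"] mult_left_mono)
      then show "(d i * (v i \<bullet> x) / (1 + (d i)\<^sup>2))\<^sup>2 \<le> (v i \<bullet> x)\<^sup>2"
        by (metis abs_le_square_iff)
    qed
  qed simp
qed

text \<open>All eigenvalues lie in \<open>[-m, m]\<close>, so positivity can be lost only when
  \<open>M\<close> becomes large.\<close>

lemma resolv_lower:
  assumes M: "M \<in> sym_mats" and bd: "\<And>x. norm (M *v x) \<le> m * norm x"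
  shows "(norm x)\<^sup>2 / (1 + m\<^sup>2) \<le> x \<bullet> (resolv M *v x)"
proof -
  obtain v d where eb: "eigenbasis M v d" using eigenbasis_exists[OF M] .
  have "(norm x)\<^sup>2 / (1 + m\<^sup>2) = (\<Sum>i\<in>UNIV. (v i \<bullet> x)\<^sup>2 / (1 + m\<^sup>2))"
    unfolding eigenbasis_norm[OF eb] by (simp add: sum_divide_distrib)
  also have "\<dots> \<le> (\<Sum>i\<in>UNIV. (v i \<bullet> x)\<^sup>2 / (1 + (d i)\<^sup>2))"
  proof (intro sum_mono divide_left_mono)
    fix i
    have "norm (v i) = 1" using eb by (simp add: eigenbasis_def norm_eq_1)
    then have "\<bar>d i\<bar> \<le> m" using bd[of "v i"] eb by (simp add: eigenbasis_def)
    then show "1 + (d i)\<^sup>2 \<le> 1 + m\<^sup>2" by (simp add: abs_le_square_iff[symmetric])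
    show "0 < (1 + m\<^sup>2) * (1 + (d i)\<^sup>2)" by (simp add: one_plus_square_ge(3))
  qed simp
  also have "\<dots> = x \<bullet> (resolv M *v x)"
    unfolding eigenbasis_parseval[OF eb, of x] resolv_inner[OF M eb] by (simp add: power2_eq_square)
  finally show ?thesis .
qed

text \<open>Klein's argument: in the joint expansion over both eigenbases the matrix remainder becomes
  a convex combination of scalar Taylor remainders.\<close>

lemma F_op_taylor:
  fixes M N :: "real^'n^'n"
  assumes M: "M \<in> sym_mats" and N: "N \<in> sym_mats"
  shows "\<bar>F_op N - F_op M - frob (resolv M) (N - M)\<bar> \<le> (norm (N - M))\<^sup>2"
proof -
  obtain v d where v: "eigenbasis M v d" using eigenbasis_exists[OF M] .
  obtain w e where w: "eigenbasis N w e" using eigenbasis_exists[OF N] .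
  \<comment> \<open>The squared inner products of two orthonormal bases form a doubly stochastic
    matrix. Its row and column sums insert the missing index into every single sum, so all terms
    become double sums with the same weights.\<close>
  define c where "c i j = (v i \<bullet> w j)\<^sup>2" for i j
  have c1: "(\<Sum>i\<in>UNIV. c i j) = 1" for j
    using eigenbasis_norm[OF v, of "w j"] w by (simp add: c_def eigenbasis_def power2_norm_eq_inner)
  have c2: "(\<Sum>j\<in>UNIV. c i j) = 1" for i
    using eigenbasis_norm[OF w, of "v i"] v
    by (simp add: c_def eigenbasis_def power2_norm_eq_inner inner_commute)
  have FN: "F_op N = (\<Sum>i\<in>UNIV. \<Sum>j\<in>UNIV. c i j * arctan (e j))"
    unfolding F_op_eigenbasis[OF w]
    by (subst sum.swap) (simp add: sum_distrib_right[symmetric] c1)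
  have FM: "F_op M = (\<Sum>i\<in>UNIV. \<Sum>j\<in>UNIV. c i j * arctan (d i))"
    unfolding F_op_eigenbasis[OF v] by (simp add: sum_distrib_right[symmetric] c2)
  have wN: "w j \<bullet> (N *v v i) = e j * (w j \<bullet> v i)" for i j
    using w N by (simp add: eigenbasis_def sym_mats_iff)
  have Nv: "v i \<bullet> (N *v v i) = (\<Sum>j\<in>UNIV. c i j * e j)" for i
    unfolding eigenbasis_parseval[OF w, of "v i"] wN
    by (simp add: c_def power2_eq_square inner_commute mult_ac)
  have fr: "frob (resolv M) (N - M) = (\<Sum>i\<in>UNIV. \<Sum>j\<in>UNIV. c i j * ((e j - d i) / (1 + (d i)\<^sup>2)))"
  proof -
    have "frob (resolv M) (N - M) = (\<Sum>i\<in>UNIV. v i \<bullet> (resolv M *v ((N - M) *v v i)))"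
      unfolding frob_def eigenbasis_trace[OF v] by (simp add: matrix_vector_mul_assoc)
    also have "\<dots> = (\<Sum>i\<in>UNIV. (v i \<bullet> ((N - M) *v v i)) / (1 + (d i)\<^sup>2))"
      by (simp add: resolv_inner[OF M v])
    also have "\<dots> = (\<Sum>i\<in>UNIV. \<Sum>j\<in>UNIV. c i j * ((e j - d i) / (1 + (d i)\<^sup>2)))"
    proof (intro sum.cong refl)
      fix i
      have "v i \<bullet> ((N - M) *v v i) = (\<Sum>j\<in>UNIV. c i j * e j) - d i"
        using v by (simp add: matrix_vector_mult_diff_rdistrib inner_diff_right Nv eigenbasis_def)
      also have "\<dots> = (\<Sum>j\<in>UNIV. c i j * e j) - (\<Sum>j\<in>UNIV. c i j) * d i" by (simp add: c2)
      also have "\<dots> = (\<Sum>j\<in>UNIV. c i j * (e j - d i))"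
        by (simp add: sum_distrib_right sum_subtractf right_diff_distrib)
      finally show "(v i \<bullet> ((N - M) *v v i)) / (1 + (d i)\<^sup>2)
          = (\<Sum>j\<in>UNIV. c i j * ((e j - d i) / (1 + (d i)\<^sup>2)))"
        by (simp add: sum_divide_distrib)
    qed
    finally show ?thesis .
  qed
  have nm: "(norm (N - M))\<^sup>2 = (\<Sum>i\<in>UNIV. \<Sum>j\<in>UNIV. c i j * (e j - d i)\<^sup>2)"
    unfolding eigenbasis_frobenius[OF v] eigenbasis_norm[OF w]
  proof (intro sum.cong refl)
    fix i j
    have "w j \<bullet> ((N - M) *v v i) = (e j - d i) * (w j \<bullet> v i)"
      using v by (simp add: matrix_vector_mult_diff_rdistrib inner_diff_right wN eigenbasis_def
          left_diff_distrib)
    then show "(w j \<bullet> ((N - M) *v v i))\<^sup>2 = c i j * (e j - d i)\<^sup>2"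
      by (simp add: c_def power_mult_distrib inner_commute)
  qed
  have "F_op N - F_op M - frob (resolv M) (N - M)
      = (\<Sum>i\<in>UNIV. \<Sum>j\<in>UNIV. c i j * (arctan (e j) - arctan (d i) - (e j - d i) / (1 + (d i)\<^sup>2)))"
    unfolding FN FM fr sum_subtractf[symmetric] by (simp add: algebra_simps)
  also have "\<bar>\<dots>\<bar> \<le> (\<Sum>i\<in>UNIV. \<Sum>j\<in>UNIV. c i j * (e j - d i)\<^sup>2)"
    by (intro order_trans[OF sum_abs] sum_mono)
      (auto simp: c_def abs_mult intro!: mult_left_mono arctan_taylor)
  finally show ?thesis by (simp add: nm)
qed

lemma bounded_linear_frob: "bounded_linear (frob X)"
  unfolding bounded_linear_def bounded_linear_axioms_def
proof
  show "linear (frob X)"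
    by (intro linearI) (auto simp: frob_eq_inner transpose_def inner_vec_def algebra_simps sum.distrib sum_distrib_left)
  show "\<exists>K. \<forall>x. norm (frob X x) \<le> norm x * K"
    by (rule exI[of _ "norm X"]) (metis mult.commute norm_frob_le real_norm_def)
qed

lemma F_op_has_derivative:
  assumes M: "M \<in> sym_mats"
  shows "(F_op has_derivative frob (resolv M)) (at M within sym_mats)"
  unfolding has_derivative_within_alt
proof (intro conjI allI impI bounded_linear_frob)
  fix e :: real assume e: "0 < e"
  show "\<exists>d>0. \<forall>y\<in>sym_mats. norm (y - M) < d \<longrightarrow>
          norm (F_op y - F_op M - frob (resolv M) (y - M)) \<le> e * norm (y - M)"
  proof (intro exI[of _ e] conjI ballI impI e)
    fix y assume y: "y \<in> sym_mats" "norm (y - M) < e"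
    have "norm (F_op y - F_op M - frob (resolv M) (y - M)) \<le> norm (y - M) * norm (y - M)"
      using F_op_taylor[OF M y(1)] by (simp add: power2_eq_square)
    also have "\<dots> \<le> e * norm (y - M)" using y by (intro mult_right_mono) auto
    finally show "norm (F_op y - F_op M - frob (resolv M) (y - M)) \<le> e * norm (y - M)" .
  qed
qed

section \<open>The operator and its linearization\<close>

lemma bounded_bilinear_outer: "bounded_bilinear (outer :: real^'n \<Rightarrow> real^'n \<Rightarrow> real^'n^'n)"
proof
  show "\<exists>K. \<forall>a b. norm (outer (a :: real^'n) b) \<le> norm a * norm b * K"
  proof (intro exI allI)
    fix a b :: "real^'n"
    have row: "outer a b $ i = (a $ i) *\<^sub>R b" for i
      by (simp add: outer_def vec_eq_iff)
    have "(norm (outer a b))\<^sup>2 = (norm a * norm b)\<^sup>2"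
      unfolding norm_vec_def[of "outer a b"] norm_vec_def[of a] row
      by (simp add: L2_set_def sum_nonneg power_mult_distrib sum_distrib_right)
    then have "norm (outer a b) = norm a * norm b"
      by (rule power2_eq_imp_eq) auto
    then show "norm (outer a b) \<le> norm a * norm b * 1" by simp
  qed
qed (auto simp: outer_def vec_eq_iff algebra_simps)

lemmas outer_bilinear_simps =
  bounded_bilinear.add_left[OF bounded_bilinear_outer]
  bounded_bilinear.add_right[OF bounded_bilinear_outer]
  bounded_bilinear.scaleR_left[OF bounded_bilinear_outer]
  bounded_bilinear.scaleR_right[OF bounded_bilinear_outer]

lemmas matrix_bilinear_simps =
  bounded_bilinear.add_left[OF bounded_bilinear_matrix_mult]
  bounded_bilinear.add_right[OF bounded_bilinear_matrix_mult]
  bounded_bilinear.diff_left[OF bounded_bilinear_matrix_mult]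
  bounded_bilinear.diff_right[OF bounded_bilinear_matrix_mult]
  bounded_bilinear.scaleR_left[OF bounded_bilinear_matrix_mult]
  bounded_bilinear.scaleR_right[OF bounded_bilinear_matrix_mult]

lemma outer_apply: "outer p q *v x = (q \<bullet> x) *\<^sub>R p"
  by (simp add: vec_eq_iff outer_def matrix_vector_mult_def inner_vec_def sum_distrib_left mult_ac)

lemma outer_sym: "outer y y \<in> sym_mats"
  by (simp add: sym_mats_iff outer_apply inner_commute)

lemma outer_mult: "outer y y ** outer y y = (y \<bullet> y) *\<^sub>R outer y y"
  by (simp add: matrix_eq outer_apply matrix_vector_mul_assoc[symmetric] scaleR_matrix_vector_assoc[symmetric])

lemma mat_1_sym: "mat 1 \<in> sym_mats"
  by (simp add: sym_mats_def)

lemma sym_conj: "C \<in> sym_mats \<Longrightarrow> X \<in> sym_mats \<Longrightarrow> C ** X ** C \<in> sym_mats"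
  by (simp add: sym_mats_def matrix_transpose_mul matrix_mul_assoc)

text \<open>With \<open>D = R - S\<close> one has \<open>R D + D S = 0\<close>. Tested on an
  eigenvector of \<open>D\<close> with eigenvalue \<open>d\<close> this reads
  \<open>d * (v \<bullet> R v + v \<bullet> S v) = 0\<close>; if \<open>d\<close> is not zero, both
  nonnegative terms vanish, and so does their difference \<open>d\<close>. This gives meaning to the
  definite description in \<open>mat_sqrt\<close>.\<close>

lemma psd_square_inj:
  fixes R S :: "real^'n^'n"
  assumes R: "psd R" and S: "psd S" and eq: "R ** R = S ** S"
  shows "R = S"
proof -
  let ?D = "R - S"
  have D: "?D \<in> sym_mats" using R S by (intro subspace_diff[OF subspace_sym_mats]) (simp_all add: psd_def)
  obtain v d where eb: "eigenbasis ?D v d" using eigenbasis_exists[OF D] .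
  have Dv: "?D *v v i = d i *\<^sub>R v i" for i using eb by (simp add: eigenbasis_def)
  have "d i = 0" for i
  proof -
    have "R ** ?D + ?D ** S = 0" by (simp add: matrix_bilinear_simps eq)
    then have "R *v (?D *v v i) + ?D *v (S *v v i) = 0"
      by (metis matrix_vector_mul_assoc matrix_vector_mult_0 matrix_vector_mult_add_rdistrib)
    then have "0 = v i \<bullet> (R *v (?D *v v i)) + v i \<bullet> (?D *v (S *v v i))"
      by (metis inner_add_right inner_zero_right)
    also have "\<dots> = d i * (v i \<bullet> (R *v v i) + v i \<bullet> (S *v v i))"
      unfolding sym_matsD[OF D, symmetric] Dv
      by (simp add: matrix_vector_mult_scaleR distrib_left)
    finally consider "d i = 0" | "v i \<bullet> (R *v v i) + v i \<bullet> (S *v v i) = 0" by auto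
    then show ?thesis
    proof cases
      case 2
      then have "v i \<bullet> (R *v v i) = 0" "v i \<bullet> (S *v v i) = 0"
        using R S unfolding psd_def by (metis add_nonneg_eq_0_iff)+
      then have "v i \<bullet> (?D *v v i) = 0"
        by (simp add: matrix_vector_mult_diff_rdistrib inner_diff_right)
      then show ?thesis using eb by (simp add: eigenbasis_def)
    qed
  qed
  then have "?D *v x = 0" for x
    using eigenbasis_expand[OF eb, of x] Dv
    by (metis (no_types, lifting) linear_sum matrix_vector_mul_linear matrix_vector_mult_scaleR
        scaleR_zero_left scaleR_zero_right sum.neutral)
  then have "?D = 0" by (simp add: matrix_eq)
  then show ?thesis by simp
qed

lemma mat_sqrt_eq: "psd R \<Longrightarrow> R ** R = M \<Longrightarrow> mat_sqrt M = R"
  unfolding mat_sqrt_def by (rule the_equality) (use psd_square_inj in auto)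

section \<open>Closed form of the conjugating factor and its derivative\<close>

lemma matrix_inv_eq:
  fixes A :: "real^'n^'n"
  assumes "A ** B = mat 1" shows "matrix_inv A = B"
proof -
  have "invertible A" using assms invertible_right_inverse by blast
  then show ?thesis
    by (metis assms matrix_inv_left matrix_mul_assoc matrix_mul_lid matrix_mul_rid)
qed

text \<open>Both factors of \<open>A_mat\<close> depend on \<open>y = t *\<^sub>R p\<close> only, and \<open>w_fac\<close> is absorbed into them,
  so that \<open>A_mat t p X = Cm y ** X ** Cm y\<close>.\<close>

definition alpha :: "real \<Rightarrow> real" where "alpha s = inverse (sqrt (sqrt (1 + s)))"
definition beta :: "real \<Rightarrow> real" where "beta s = alpha s / (sqrt (1 + s) + (1 + s))"

text \<open>With \<open>w = sqrt (1 + y \<bullet> y)\<close> this is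
  \<open>(I + y y\<^sup>T)\<^sup>-\<^sup>1\<^sup>/\<^sup>2\<close> divided by \<open>sqrt w\<close>:
  it multiplies vectors orthogonal to \<open>y\<close> by \<open>alpha\<close> and \<open>y\<close>
  itself by \<open>alpha / w\<close>. In this form no division by \<open>y \<bullet> y\<close>
  occurs, so \<open>y = 0\<close> is not exceptional.\<close>

definition Cm :: "real^'n \<Rightarrow> real^'n^'n" where
  "Cm y = alpha (y \<bullet> y) *\<^sub>R mat 1 - beta (y \<bullet> y) *\<^sub>R outer y y"

definition Ci :: "real^'n \<Rightarrow> real^'n^'n" where
  "Ci y = sqrt (sqrt (1 + y \<bullet> y)) *\<^sub>R (mat 1 + (1 / (1 + sqrt (1 + y \<bullet> y))) *\<^sub>R outer y y)"

lemma Cm_sym: "Cm y \<in> sym_mats"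
  unfolding Cm_def using outer_sym[of y] mat_1_sym subspace_sym_mats
  by (intro subspace_diff subspace_scale) auto

text \<open>Substituting \<open>w\<close> turns the matrix identities below into rational identities
  in one variable, apart from a common factor \<open>sqrt w\<close>.\<close>

lemma sqrt_one_plus:
  assumes "0 \<le> s" obtains w where "sqrt (1 + s) = w" "1 \<le> w" "s = w * w - 1"
  using assms by (metis add_diff_cancel_left' add_increasing2 le_add_same_cancel1 real_sqrt_ge_1_iff
      real_sqrt_mult_self abs_of_nonneg zero_le_one)

lemma Cm_Ci: "Cm y ** Ci y = mat 1"
proof -
  obtain w where w: "sqrt (1 + y \<bullet> y) = w" "1 \<le> w" "y \<bullet> y = w * w - 1"
    using sqrt_one_plus[OF inner_ge_zero] .
  have q: "sqrt w * inverse (sqrt w) = 1" using w by simp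
  \<comment> \<open>The coefficient of \<open>outer y y\<close> in the product.\<close>
  have c: "1 / (1 + w) - 1 / (w * (1 + w)) - 1 / (1 + w) * (1 / (w * (1 + w))) * (w * w - 1) = 0"
  proof -
    have "w \<noteq> 0" "1 + w \<noteq> 0" using w by auto
    then have "1 / (1 + w) * (1 / (w * (1 + w))) * (w * w - 1) = (w - 1) / (w * (1 + w))"
      using \<open>1 + w \<noteq> 0\<close> square_diff_one_factored[of w] by (simp add: add.commute)
    moreover have "1 / (1 + w) = w / (w * (1 + w))" using \<open>w \<noteq> 0\<close> by simp
    ultimately show ?thesis by (simp only: diff_divide_distrib[symmetric]) simp
  qed
  have "Cm y = inverse (sqrt w) *\<^sub>R (mat 1 - (1 / (w * (1 + w))) *\<^sub>R outer y y)"
    using w by (simp add: Cm_def alpha_def beta_def scaleR_diff_right algebra_simps divide_inverse)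
  then have "Cm y ** Ci y = (sqrt w * inverse (sqrt w)) *\<^sub>R
      ((mat 1 - (1 / (w * (1 + w))) *\<^sub>R outer y y) ** (mat 1 + (1 / (1 + w)) *\<^sub>R outer y y))"
    unfolding Ci_def w(1) by (simp only: matrix_bilinear_simps(5,6) scaleR_scaleR mult.commute)
  also have "(mat 1 - k *\<^sub>R outer y y) ** (mat 1 + l *\<^sub>R outer y y)
      = mat 1 + (l - k - l * k * (w * w - 1)) *\<^sub>R outer y y" for k l
    by (simp add: matrix_bilinear_simps outer_mult w(3) algebra_simps)
  finally have "Cm y ** Ci y = mat 1" unfolding q c by simp
  then show ?thesis .
qed

lemma Ci_Cm: "Ci y ** Cm y = mat 1"
  using Cm_Ci matrix_left_right_inverse by metis

text \<open>The inverse of a rank-one perturbation of the identity is given by the Sherman-Morrison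
  formula. A root of the form \<open>mat 1 - k *\<^sub>R outer y y\<close> requires
  \<open>2 k - k\<^sup>2 (w\<^sup>2 - 1) = 1 / w\<^sup>2\<close>, and
  \<open>k = 1 / (w (1 + w))\<close> is the solution that keeps it positive semidefinite.\<close>

lemma A_mat_eq: "A_mat t p X = Cm (t *\<^sub>R p) ** X ** Cm (t *\<^sub>R p)"
proof -
  define y where "y = t *\<^sub>R p"
  obtain w where w: "sqrt (1 + y \<bullet> y) = w" "1 \<le> w" "y \<bullet> y = w * w - 1"
    using sqrt_one_plus[OF inner_ge_zero] .
  have wf: "w_fac t p = w"
    unfolding w_fac_def w(1)[symmetric] y_def by (simp add: dot_square_norm power_mult_distrib)
  have tp: "t\<^sup>2 *\<^sub>R outer p p = outer y y"
    by (simp add: y_def outer_bilinear_simps power2_eq_square)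
  have w0: "w \<noteq> 0" "1 + w \<noteq> 0" using w by auto
  have inv: "matrix_inv (mat 1 + outer y y) = mat 1 - (1 / (w * w)) *\<^sub>R outer y y"
  proof (rule matrix_inv_eq)
    have c: "1 - 1 / (w * w) - (1 / (w * w)) * (w * w - 1) = 0" using w0 by (simp add: field_simps)
    have "(mat 1 + outer y y) ** (mat 1 - k *\<^sub>R outer y y)
        = mat 1 + (1 - k - k * (w * w - 1)) *\<^sub>R outer y y" for k
      by (simp add: matrix_bilinear_simps outer_mult w(3) algebra_simps)
    then show "(mat 1 + outer y y) ** (mat 1 - (1 / (w * w)) *\<^sub>R outer y y) = mat 1"
      by (simp only: c) simp
  qed
  let ?B = "mat 1 - (1 / (w * (1 + w))) *\<^sub>R outer y y"
  have "mat_sqrt (mat 1 - (1 / (w * w)) *\<^sub>R outer y y) = ?B"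
  proof (rule mat_sqrt_eq)
    show "psd ?B" unfolding psd_def
    proof (intro conjI allI)
      show "?B \<in> sym_mats" using outer_sym[of y] mat_1_sym subspace_sym_mats
        by (intro subspace_diff subspace_scale) auto
      fix v
      have pos: "0 < w * (1 + w)" using w by (simp add: zero_less_mult_iff)
      have "(y \<bullet> v)\<^sup>2 \<le> (w * w - 1) * (v \<bullet> v)" using Cauchy_Schwarz_ineq[of y v] w by simp
      also have "\<dots> \<le> (w * (1 + w)) * (v \<bullet> v)"
        using w by (intro mult_right_mono) (auto simp: algebra_simps)
      finally have "(y \<bullet> v)\<^sup>2 / (w * (1 + w)) \<le> v \<bullet> v" using pos by (simp add: divide_le_eq mult.commute)
      then show "0 \<le> v \<bullet> (?B *v v)"
        by (simp add: matrix_vector_mult_diff_rdistrib scaleR_matrix_vector_assoc[symmetric] outer_apply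
            inner_diff_right inner_commute power2_eq_square)
    qed
    have c: "2 * (1 / (w * (1 + w))) - 1 / (w * (1 + w)) * (1 / (w * (1 + w))) * (w * w - 1) = 1 / (w * w)"
    proof -
      have "w * w - 1 = (w - 1) * (1 + w)" by (simp add: algebra_simps)
      then have "1 / (w * (1 + w)) * (1 / (w * (1 + w))) * (w * w - 1) = (w - 1) / (w * w * (1 + w))"
        using w0 by simp
      moreover have "2 * (1 / (w * (1 + w))) = 2 * w / (w * w * (1 + w))" "1 / (w * w) = (1 + w) / (w * w * (1 + w))"
        using w0 by simp_all
      ultimately show ?thesis
        by (simp only: diff_divide_distrib[symmetric]) (use w0 in \<open>simp add: add.commute\<close>)
    qed
    have "(mat 1 - k *\<^sub>R outer y y) ** (mat 1 - k *\<^sub>R outer y y)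
        = mat 1 - (2 * k - k * k * (w * w - 1)) *\<^sub>R outer y y" for k
      by (simp add: matrix_bilinear_simps outer_mult w(3)) (simp add: vec_eq_iff algebra_simps)
    from this[of "1 / (w * (1 + w))"]
    show "?B ** ?B = mat 1 - (1 / (w * w)) *\<^sub>R outer y y" unfolding c .
  qed
  then have B: "B_mat t p = ?B" unfolding B_mat_def tp inv .
  have C: "Cm y = inverse (sqrt w) *\<^sub>R ?B"
    using w by (simp add: Cm_def alpha_def beta_def scaleR_diff_right algebra_simps divide_inverse)
  have q: "inverse (sqrt w) * inverse (sqrt w) = 1 / w"
    using w by (simp add: divide_inverse inverse_mult_distrib[symmetric] del: inverse_mult_distrib)
  show ?thesis
    unfolding A_mat_def wf B y_def[symmetric] C q[symmetric] matrix_bilinear_simps(5,6) scaleR_scaleR ..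
qed

lemma frob_conj: "frob R (C ** H ** C) = frob (C ** R ** C) H"
  unfolding frob_def by (metis matrix_mul_assoc trace_mul_sym)

lemma
  assumes "0 \<le> s"
  shows sqrt_deriv: "((\<lambda>s. sqrt (1 + s)) has_real_derivative inverse (sqrt (1 + s)) / 2) (at s)"
    and alpha_deriv: "(alpha has_real_derivative
      - (inverse (sqrt (1 + s)) * (inverse (sqrt (sqrt (1 + s))) / 2 * (inverse (sqrt (1 + s)) / 2)))) (at s)"
proof -
  have p: "0 < sqrt (1 + s)" using assms by simp
  show d1: "((\<lambda>s. sqrt (1 + s)) has_real_derivative inverse (sqrt (1 + s)) / 2) (at s)"
    using assms by (auto intro!: derivative_eq_intros)
  have "((\<lambda>s. sqrt (sqrt (1 + s))) has_real_derivative
      inverse (sqrt (sqrt (1 + s))) / 2 * (inverse (sqrt (1 + s)) / 2)) (at s)"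
    by (rule DERIV_chain2[where f=sqrt and g="\<lambda>s. sqrt (1 + s)", OF DERIV_real_sqrt[OF p] d1])
  from DERIV_inverse_fun[OF this] p show "(alpha has_real_derivative
      - (inverse (sqrt (1 + s)) * (inverse (sqrt (sqrt (1 + s))) / 2 * (inverse (sqrt (1 + s)) / 2)))) (at s)"
    unfolding alpha_def[abs_def] by (simp add: power2_eq_square mult_ac flip: inverse_mult_distrib)
qed

lemma alpha_beta_C1:
  obtains a' b' where "\<And>s. 0 \<le> s \<Longrightarrow> (alpha has_real_derivative a' s) (at s)"
    "\<And>s. 0 \<le> s \<Longrightarrow> (beta has_real_derivative b' s) (at s)"
    "continuous_on {0..} a'" "continuous_on {0..} b'"
proof -
  define a' where "a' s = - (inverse (sqrt (1 + s)) * (inverse (sqrt (sqrt (1 + s))) / 2 * (inverse (sqrt (1 + s)) / 2)))" for s :: real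
  define q where "q s = sqrt (1 + s) + (1 + s)" for s :: real
  define b' where "b' s = (a' s * q s - alpha s * (inverse (sqrt (1 + s)) / 2 + 1)) / (q s * q s)" for s
  have q0: "q s \<noteq> 0" if "0 \<le> s" for s
    using that real_sqrt_ge_zero[of "1 + s"] unfolding q_def by linarith
  have nz: "sqrt (1 + s) \<noteq> 0" "sqrt (sqrt (1 + s)) \<noteq> 0" if "0 \<le> s" for s :: real
    using that by auto
  have ca: "continuous_on {0..} a'" unfolding a'_def
    by (intro continuous_intros) (use nz in auto)
  have "continuous_on {0..} b'" unfolding b'_def
    by (intro continuous_intros ca) (use nz q0 in \<open>auto simp: q_def[abs_def] alpha_def[abs_def] intro!: continuous_intros\<close>)
  moreover have "(beta has_real_derivative b' s) (at s)" if s: "0 \<le> s" for s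
  proof -
    have "(q has_real_derivative inverse (sqrt (1 + s)) / 2 + 1) (at s)"
      unfolding q_def[abs_def] by (rule derivative_eq_intros sqrt_deriv[OF s] refl)+ simp
    from DERIV_divide[OF alpha_deriv[OF s] this q0[OF s]] show ?thesis
      unfolding beta_def[abs_def] q_def[symmetric] b'_def a'_def .
  qed
  moreover have "(alpha has_real_derivative a' s) (at s)" if "0 \<le> s" for s
    unfolding a'_def by (rule alpha_deriv[OF that])
  ultimately show ?thesis using that[of a' b'] ca by blast
qed

text \<open>The bound on balls is what later keeps \<open>b\<close> bounded. It follows from
  continuity of the derivative in each basis direction, compactness of balls, and linearity in
  \<open>h\<close>.\<close>

lemma Cm_C1:
  obtains D :: "real^'n \<Rightarrow> real^'n \<Rightarrow> real^'n^'n"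
  where "\<And>y. (Cm has_derivative D y) (at y)"
    "\<And>y h. D y h \<in> sym_mats"
    "\<And>M. \<exists>K. \<forall>y h. norm y \<le> M \<longrightarrow> norm (D y h) \<le> K * norm h"
proof -
  obtain a' b' where a: "\<And>s. 0 \<le> s \<Longrightarrow> (alpha has_real_derivative a' s) (at s)"
    and b: "\<And>s. 0 \<le> s \<Longrightarrow> (beta has_real_derivative b' s) (at s)"
    and ca: "continuous_on {0..} a'" and cb: "continuous_on {0..} b'"
    using alpha_beta_C1 by metis
  define D :: "real^'n \<Rightarrow> real^'n \<Rightarrow> real^'n^'n" where
    "D y h = (a' (y \<bullet> y) * (2 * (y \<bullet> h))) *\<^sub>R mat 1
      - (beta (y \<bullet> y) *\<^sub>R (outer y h + outer h y) + (b' (y \<bullet> y) * (2 * (y \<bullet> h))) *\<^sub>R outer y y)" for y h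
  have s: "((\<lambda>y. y \<bullet> y) has_derivative (\<lambda>h. 2 * (y \<bullet> h))) (at y)" for y :: "real^'n"
    by (auto intro!: derivative_eq_intros simp: inner_commute)
  have ch: "((\<lambda>y. f (y \<bullet> y)) has_derivative (\<lambda>h. f' (y \<bullet> y) * (2 * (y \<bullet> h)))) (at y)"
    if "\<And>s. 0 \<le> s \<Longrightarrow> (f has_real_derivative f' s) (at s)" for f f' and y :: "real^'n"
    by (rule has_derivative_compose[OF s]) (use that[of "y \<bullet> y"] in \<open>simp add: has_field_derivative_def\<close>)
  have o: "((\<lambda>y. outer y y) has_derivative (\<lambda>h. outer y h + outer h y)) (at y)" for y :: "real^'n"
    by (rule bounded_bilinear.FDERIV[OF bounded_bilinear_outer]) (auto intro: derivative_intros)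
  have der: "(Cm has_derivative D y) (at y)" for y
    unfolding Cm_def[abs_def] D_def
    by (rule derivative_eq_intros ch[OF a] ch[OF b] o refl | assumption | simp)+
  have "D y h \<in> sym_mats" for y h
  proof -
    have "outer y h + outer h y \<in> sym_mats"
      by (simp add: sym_mats_iff matrix_vector_mult_add_rdistrib outer_apply inner_add_left inner_add_right
          inner_commute mult.commute)
    note 1 = subspace_scale[OF subspace_sym_mats this]
    note 2 = subspace_add[OF subspace_sym_mats 1 subspace_scale[OF subspace_sym_mats outer_sym]]
    show ?thesis unfolding D_def
      by (rule subspace_diff[OF subspace_sym_mats subspace_scale[OF subspace_sym_mats mat_1_sym] 2])
  qed
  moreover have "\<exists>K. \<forall>y h. norm y \<le> M \<longrightarrow> norm (D y h) \<le> K * norm h" for M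
  proof -
    have cs: "continuous_on UNIV (\<lambda>y :: real^'n. f (y \<bullet> y))" if "continuous_on {0..} f" for f :: "real \<Rightarrow> real"
      by (rule continuous_on_compose2[OF that]) (auto intro!: continuous_intros)
    have "continuous_on {0..} beta"
      using b by (meson DERIV_isCont atLeast_iff continuous_at_imp_continuous_on)
    then have "continuous_on UNIV (\<lambda>y. D y h)" for h
      unfolding D_def by (intro continuous_intros cs ca cb bounded_bilinear.continuous_on[OF bounded_bilinear_outer])
    then have "bounded ((\<lambda>y. D y (axis k 1)) ` cball 0 M)" for k
      by (intro compact_imp_bounded compact_continuous_image compact_cball) (meson continuous_on_subset subset_UNIV)
    then have "\<forall>k. \<exists>c. \<forall>y. norm y \<le> M \<longrightarrow> norm (D y (axis k 1)) \<le> c"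
      unfolding bounded_iff by (meson imageI mem_cball_0)
    then obtain c where c: "\<And>k y. norm y \<le> M \<Longrightarrow> norm (D y (axis k 1)) \<le> c k" by metis
    have "norm (D y h) \<le> (\<Sum>k\<in>UNIV. c k) * norm h" if y: "norm y \<le> M" for y h
    proof -
      have lin: "linear (D y)" using der has_derivative_linear by blast
      have "D y h = D y (\<Sum>k\<in>UNIV. h $ k *\<^sub>R axis k 1)"
        using basis_expansion[of h] by (simp add: scalar_mult_eq_scaleR)
      also have "norm \<dots> \<le> (\<Sum>k\<in>UNIV. c k * norm h)"
        unfolding linear_sum[OF lin] linear_scale[OF lin]
      proof (rule sum_norm_le)
        fix k
        show "norm (h $ k *\<^sub>R D y (axis k 1)) \<le> c k * norm h"
          using mult_mono[OF component_le_norm_cart[of h k] c[OF y, of k]] by (simp add: mult.commute)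
      qed
      finally show ?thesis by (simp add: sum_distrib_right)
    qed
    then show ?thesis by blast
  qed
  ultimately show ?thesis using that der by blast
qed

lemma A_mat_sym: "X \<in> sym_mats \<Longrightarrow> A_mat t p X \<in> sym_mats"
  unfolding A_mat_eq by (rule sym_conj[OF Cm_sym])

text \<open>This exchanges the unbounded \<open>X\<close> for \<open>A\<close>, which is harmless
  next to \<open>resolv A\<close>.\<close>

lemma Cm_mult_eq: "Cm (t *\<^sub>R p) ** X = A_mat t p X ** Ci (t *\<^sub>R p)"
  unfolding A_mat_eq by (metis Cm_Ci matrix_mul_assoc matrix_mul_rid)

text \<open>All factors are symmetric, so transposition exchanges the two products under the trace
  and they contribute equally.\<close>

lemma frob_resolv_conj:
  assumes X: "X \<in> sym_mats" and D: "D \<in> sym_mats"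
  shows "frob (resolv (A_mat t p X)) (D ** X ** Cm (t *\<^sub>R p) + Cm (t *\<^sub>R p) ** X ** D)
    = 2 * trace (resolv (A_mat t p X) ** A_mat t p X ** Ci (t *\<^sub>R p) ** D)"
proof -
  let ?R = "resolv (A_mat t p X)" and ?C = "Cm (t *\<^sub>R p)"
  have R: "transpose ?R = ?R" using resolv_sym[OF A_mat_sym[OF X]] by (simp add: sym_mats_def)
  have tr: "transpose X = X" "transpose D = D" "transpose ?C = ?C"
    using X D Cm_sym by (auto simp: sym_mats_def)
  have tt: "trace (transpose M) = trace M" for M :: "real^'n^'n"
    by (simp add: trace_def transpose_def)
  have "trace (?R ** (D ** X ** ?C)) = trace (transpose (?R ** (D ** X ** ?C)))"
    by (simp only: tt)
  also have "\<dots> = trace (?C ** X ** D ** ?R)"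
    by (simp only: matrix_transpose_mul tr R matrix_mul_assoc)
  also have "\<dots> = trace (?R ** (?C ** X ** D))" by (rule trace_mul_sym)
  finally have 1: "trace (?R ** (D ** X ** ?C)) = trace (?R ** (?C ** X ** D))" .
  have "frob ?R (D ** X ** ?C + ?C ** X ** D) = 2 * trace (?R ** (?C ** X ** D))"
    unfolding frob_def by (simp add: matrix_bilinear_simps trace_add 1)
  then show ?thesis by (simp only: Cm_mult_eq matrix_mul_assoc)
qed

section \<open>The coefficients \<open>a\<close> and \<open>b\<close>\<close>

text \<open>\<open>sym_mats\<close> need not be open, so a derivative within it is determined only
  along symmetric directions. The line through \<open>X\<close> in direction \<open>a - a'\<close>
  stays inside and yields that the difference has norm 0.\<close>

lemma sym_derivative_unique:
  fixes X :: "real^'n^'n"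
  assumes "(f has_derivative frob a) (at X within sym_mats)"
    and "(f has_derivative frob a') (at X within sym_mats)"
    and X: "X \<in> sym_mats" and a: "a \<in> sym_mats" "a' \<in> sym_mats"
  shows "a = a'"
proof -
  define H where "H = a - a'"
  have H: "H \<in> sym_mats" unfolding H_def using a by (rule subspace_diff[OF subspace_sym_mats])
  have sub: "(\<lambda>s. X + s *\<^sub>R H) ` UNIV \<subseteq> sym_mats"
    using X H by (auto intro: subspace_add[OF subspace_sym_mats] subspace_scale[OF subspace_sym_mats])
  have p: "((\<lambda>s::real. X + s *\<^sub>R H) has_derivative (\<lambda>s. s *\<^sub>R H)) (at 0)"
    by (auto intro!: derivative_eq_intros)
  have "((f \<circ> (\<lambda>s. X + s *\<^sub>R H)) has_derivative (frob b \<circ> (\<lambda>s. s *\<^sub>R H))) (at 0)"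
    if "(f has_derivative frob b) (at X within sym_mats)" for b
    by (rule diff_chain_within[OF p])
      (use has_derivative_subset[OF that sub] in simp)
  from has_derivative_unique[OF this[OF assms(1)] this[OF assms(2)]]
  have "frob a H = frob a' H" by (metis (mono_tags) comp_apply scaleR_one)
  then have "H \<bullet> H = 0" using frob_sym[OF H] by (simp add: H_def inner_diff_left inner_diff_right)
  then show ?thesis by (simp add: H_def)
qed

definition dCm :: "real^'n \<Rightarrow> real^'n \<Rightarrow> real^'n^'n" where
  "dCm y = frechet_derivative Cm (at y)"

lemma
  fixes y h :: "real^'n"
  shows Cm_has_derivative: "(Cm has_derivative dCm y) (at y)"
    and dCm_sym: "dCm y h \<in> sym_mats"
    and dCm_bounded: "\<exists>K. \<forall>(y :: real^'n) h. norm y \<le> M \<longrightarrow> norm (dCm y h) \<le> K * norm h"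
proof -
  obtain D :: "real^'n \<Rightarrow> real^'n \<Rightarrow> real^'n^'n" where D: "\<And>y. (Cm has_derivative D y) (at y)"
    "\<And>y h. D y h \<in> sym_mats"
    "\<And>M. \<exists>K. \<forall>y h. norm y \<le> M \<longrightarrow> norm (D y h) \<le> K * norm h" using Cm_C1 by metis
  have "dCm = D" unfolding dCm_def using frechet_derivative_at[OF D(1)] by auto
  with D show "(Cm has_derivative dCm y) (at y)" "dCm y h \<in> sym_mats"
    "\<exists>K. \<forall>(y :: real^'n) h. norm y \<le> M \<longrightarrow> norm (dCm y h) \<le> K * norm h" by auto
qed

text \<open>One chain rule serves three purposes: constant \<open>q\<close> gives \<open>a\<close>,
  constant \<open>Y\<close> gives \<open>b\<close>, and \<open>q = Du\<close>,
  \<open>Y = D\<^sup>2u\<close> give the differentiated equation. The set \<open>S\<close> keeps the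
  second argument symmetric, since \<open>F_op\<close> is differentiated only within
  \<open>sym_mats\<close>.\<close>

lemma G_op_path_derivative:
  fixes q :: "'a::real_normed_vector \<Rightarrow> real^'n"
  assumes q: "(q has_derivative q') (at z within S)" and Y: "(Y has_derivative Y') (at z within S)"
    and sym: "\<And>x. x \<in> S \<Longrightarrow> Y x \<in> sym_mats" and z: "Y z \<in> sym_mats"
  shows "((\<lambda>x. G_op t (q x) (Y x)) has_derivative
     (\<lambda>h. frob (Cm (t *\<^sub>R q z) ** resolv (A_mat t (q z) (Y z)) ** Cm (t *\<^sub>R q z)) (Y' h)
       + 2 * trace (resolv (A_mat t (q z) (Y z)) ** A_mat t (q z) (Y z) ** Ci (t *\<^sub>R q z)
            ** dCm (t *\<^sub>R q z) (t *\<^sub>R q' h)))) (at z within S)"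
proof -
  let ?C = "\<lambda>x. Cm (t *\<^sub>R q x)"
  let ?R = "resolv (A_mat t (q z) (Y z))"
  have tq: "((\<lambda>x. t *\<^sub>R q x) has_derivative (\<lambda>h. t *\<^sub>R q' h)) (at z within S)"
    using q by (auto intro!: derivative_eq_intros)
  have C: "(?C has_derivative (\<lambda>h. dCm (t *\<^sub>R q z) (t *\<^sub>R q' h))) (at z within S)"
    by (rule has_derivative_compose[OF tq Cm_has_derivative])
  let ?d = "\<lambda>h. dCm (t *\<^sub>R q z) (t *\<^sub>R q' h)"
  note mm = bounded_bilinear.FDERIV[OF bounded_bilinear_matrix_mult]
  have A: "((\<lambda>x. A_mat t (q x) (Y x)) has_derivative
      (\<lambda>h. ?C z ** Y z ** ?d h + (?C z ** Y' h + ?d h ** Y z) ** ?C z)) (at z within S)"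
    unfolding A_mat_eq by (rule mm[OF mm[OF C Y] C])
  have "((F_op \<circ> (\<lambda>x. A_mat t (q x) (Y x))) has_derivative
      (frob ?R \<circ> (\<lambda>h. ?C z ** Y z ** ?d h + (?C z ** Y' h + ?d h ** Y z) ** ?C z))) (at z within S)"
    by (rule diff_chain_within[OF A has_derivative_subset[OF F_op_has_derivative[OF A_mat_sym[OF z]]]])
      (use A_mat_sym sym in auto)
  moreover have "frob ?R (?C z ** Y z ** ?d h + (?C z ** Y' h + ?d h ** Y z) ** ?C z)
      = frob (?C z ** ?R ** ?C z) (Y' h) + 2 * trace (?R ** A_mat t (q z) (Y z) ** Ci (t *\<^sub>R q z) ** ?d h)" for h
  proof -
    have "?C z ** Y z ** ?d h + (?C z ** Y' h + ?d h ** Y z) ** ?C z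
        = ?C z ** Y' h ** ?C z + (?d h ** Y z ** ?C z + ?C z ** Y z ** ?d h)"
      by (simp add: matrix_bilinear_simps)
    then show ?thesis
      by (simp only: linear_add[OF bounded_linear.linear[OF bounded_linear_frob]] frob_conj[of ?R "?C z" "Y' h"]
          flip: frob_resolv_conj[OF z dCm_sym])
  qed
  ultimately show ?thesis by (simp add: comp_def G_op_def)
qed

lemma a_mat_eq:
  fixes X :: "real^'n^'n"
  assumes X: "X \<in> sym_mats"
  shows "a_mat t p X = Cm (t *\<^sub>R p) ** resolv (A_mat t p X) ** Cm (t *\<^sub>R p)" (is "_ = ?a")
proof -
  have a: "?a \<in> sym_mats" by (rule sym_conj[OF Cm_sym resolv_sym[OF A_mat_sym[OF X]]])
  have lin: "linear (dCm y)" for y using Cm_has_derivative has_derivative_linear by blast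
  have "((\<lambda>Y. G_op t p Y) has_derivative frob ?a) (at X within sym_mats)"
    using G_op_path_derivative[where z = X and S = sym_mats and t = t, OF has_derivative_const[of p] has_derivative_ident] X
    by (simp add: linear_0[OF lin] trace_def)
  then show ?thesis unfolding a_mat_def
    by (intro the_equality) (use a X sym_derivative_unique in blast)+
qed

text \<open>The pairing with an arbitrary \<open>h\<close> is the convenient form: choosing
  \<open>h\<close> to be the vector itself bounds its norm.\<close>

lemma b_vec_inner:
  fixes X :: "real^'n^'n"
  assumes X: "X \<in> sym_mats"
  shows "b_vec t p X \<bullet> h = 2 * trace (resolv (A_mat t p X) ** A_mat t p X ** Ci (t *\<^sub>R p)
            ** dCm (t *\<^sub>R p) (t *\<^sub>R h))" (is "_ = ?f h")
proof -
  have "((\<lambda>q. G_op t q X) has_derivative (\<lambda>h. frob (a_mat t p X) 0 + ?f h)) (at p)"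
    using G_op_path_derivative[where z = p and S = UNIV and t = t, OF has_derivative_ident has_derivative_const[of X]] X
    by (simp add: a_mat_eq)
  then have der: "((\<lambda>q. G_op t q X) has_derivative ?f) (at p)"
    by (simp add: linear_0[OF bounded_linear.linear[OF bounded_linear_frob]])
  have lin: "linear ?f" using der has_derivative_linear by blast
  have "b_vec t p X \<bullet> h = (\<Sum>k\<in>UNIV. h $ k *\<^sub>R ?f (axis k 1))"
    unfolding b_vec_def frechet_derivative_at[OF der, symmetric] by (simp add: inner_vec_def mult.commute)
  also have "\<dots> = ?f (\<Sum>k\<in>UNIV. h $ k *\<^sub>R axis k 1)"
    by (simp only: linear_sum[OF lin] linear_scale[OF lin])
  also have "(\<Sum>k\<in>UNIV. h $ k *\<^sub>R axis k 1) = h"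
    using basis_expansion[of h] by (simp add: scalar_mult_eq_scaleR)
  finally show ?thesis .
qed

lemma G_op_chain:
  fixes q :: "'a::real_normed_vector \<Rightarrow> real^'n"
  assumes q: "(q has_derivative q') (at z within S)" and Y: "(Y has_derivative Y') (at z within S)"
    and sym: "\<And>x. x \<in> S \<Longrightarrow> Y x \<in> sym_mats" and z: "Y z \<in> sym_mats"
  shows "((\<lambda>x. G_op t (q x) (Y x)) has_derivative
     (\<lambda>h. frob (a_mat t (q z) (Y z)) (Y' h) + b_vec t (q z) (Y z) \<bullet> q' h)) (at z within S)"
  using G_op_path_derivative[OF assms] by (simp add: a_mat_eq[OF z] b_vec_inner[OF z])

lemma a_mat_symmetric: "(X :: real^'n^'n) \<in> sym_mats \<Longrightarrow> a_mat t p X \<in> sym_mats"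
  by (simp add: a_mat_eq sym_conj[OF Cm_sym resolv_sym] A_mat_sym)

lemma bilin_a_mat:
  fixes X :: "real^'n^'n"
  assumes X: "X \<in> sym_mats"
  shows "bilin (a_mat t p X) x x
    = (Cm (t *\<^sub>R p) *v x) \<bullet> (resolv (A_mat t p X) *v (Cm (t *\<^sub>R p) *v x))"
  unfolding bilin_def a_mat_eq[OF X] by (simp add: matrix_vector_mul_assoc[symmetric] sym_matsD[OF Cm_sym])

lemma bilin_a_mat_nonneg:
  fixes X :: "real^'n^'n"
  assumes X: "X \<in> sym_mats" shows "0 \<le> bilin (a_mat t p X) x x"
proof -
  let ?z = "Cm (t *\<^sub>R p) *v x"
  have "0 \<le> (norm ?z)\<^sup>2 / (1 + (norm (A_mat t p X))\<^sup>2)" by (simp add: add_nonneg_nonneg)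
  also have "\<dots> \<le> bilin (a_mat t p X) x x"
    unfolding bilin_a_mat[OF X] by (rule resolv_lower[OF A_mat_sym[OF X] norm_matrix_vector_le])
  finally show ?thesis .
qed

section \<open>Bounds and ellipticity for jets\<close>

lemma Cm_Ci_bounded:
  obtains c where "0 < c" "\<And>y :: real^'n. norm y \<le> M \<Longrightarrow> norm (Cm y) \<le> c \<and> norm (Ci y) \<le> c"
proof -
  have "continuous_on (cball 0 M) (Cm :: real^'n \<Rightarrow> _)"
    using Cm_has_derivative by (meson continuous_at_imp_continuous_on has_derivative_continuous)
  then have "bounded (Cm ` cball (0 :: real^'n) M)"
    by (intro compact_imp_bounded compact_continuous_image compact_cball)
  then obtain c1 where c1: "\<And>y :: real^'n. norm y \<le> M \<Longrightarrow> norm (Cm y) \<le> c1"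
    unfolding bounded_iff by (meson imageI mem_cball_0)
  have nz: "1 + sqrt (1 + y \<bullet> y) \<noteq> 0" for y :: "real^'n"
    using real_sqrt_ge_zero[of "1 + y \<bullet> y"] inner_ge_zero[of y] by linarith
  have "continuous_on (cball 0 M) (Ci :: real^'n \<Rightarrow> _)"
    unfolding Ci_def by (intro continuous_intros bounded_bilinear.continuous_on[OF bounded_bilinear_outer]) (use nz in auto)
  then have "bounded (Ci ` cball (0 :: real^'n) M)"
    by (intro compact_imp_bounded compact_continuous_image compact_cball)
  then obtain c2 where c2: "\<And>y :: real^'n. norm y \<le> M \<Longrightarrow> norm (Ci y) \<le> c2"
    unfolding bounded_iff by (meson imageI mem_cball_0)
  show ?thesis
    by (rule that[of "1 + \<bar>c1\<bar> + \<bar>c2\<bar>"]) (use c1 c2 in \<open>fastforce+\<close>)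
qed

lemma norm_t_scale: "t \<in> {0..1} \<Longrightarrow> norm p \<le> M \<Longrightarrow> norm (t *\<^sub>R (p :: 'a::real_normed_vector)) \<le> M"
  by (simp add: order_trans[OF mult_left_le_one_le])

text \<open>\<open>X\<close> is unrestricted in size. It occurs only inside \<open>resolv A\<close>
  and \<open>resolv A ** A\<close>, placed between factors that depend on
  \<open>t *\<^sub>R p\<close>, which stays in the ball of radius \<open>M\<close>. In particular
  \<open>a ** X = C ** (resolv A ** A) ** C\<^sup>-\<^sup>1\<close>.\<close>

lemma jet_bounds:
  fixes M :: real
  obtains C0 where "0 < C0"
    "\<And>t p (X :: real^'n^'n). t \<in> {0..1} \<Longrightarrow> norm p \<le> M \<Longrightarrow> X \<in> sym_mats \<Longrightarrow>
       norm (a_mat t p X) \<le> C0 \<and> norm (b_vec t p X) \<le> C0 \<and> norm (a_mat t p X ** X) \<le> C0"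
proof -
  obtain K where K: "\<And>(y :: real^'n) h. norm y \<le> M \<Longrightarrow> norm (dCm y h) \<le> K * norm h"
    using dCm_bounded by blast
  obtain c where c: "0 < c" "\<And>y :: real^'n. norm y \<le> M \<Longrightarrow> norm (Cm y) \<le> c \<and> norm (Ci y) \<le> c"
    using Cm_Ci_bounded by metis
  define n where "n = real CARD('n)"
  \<comment> \<open>The first summand bounds \<open>a\<close> and \<open>a ** X\<close>, the second
    bounds \<open>b\<close>.\<close>
  define C0 where "C0 = c * n * c + 2 * (norm (mat 1 :: real^'n^'n) * (n * c * \<bar>K\<bar>))"
  have n: "0 < n" by (simp add: n_def)
  have C0: "0 < C0" unfolding C0_def using c n by (simp add: add_pos_nonneg)
  have "norm (a_mat t p X) \<le> C0 \<and> norm (b_vec t p X) \<le> C0 \<and> norm (a_mat t p X ** X) \<le> C0"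
    if t: "t \<in> {0..1}" and p: "norm p \<le> M" and X: "X \<in> sym_mats" for t p and X :: "real^'n^'n"
  proof -
    let ?A = "A_mat t p X" and ?y = "t *\<^sub>R p"
    note S = A_mat_sym[OF X, of t p]
    have y: "norm ?y \<le> M" by (rule norm_t_scale[OF t p])
    note C = c(2)[OF y]
    have R: "norm (resolv ?A) \<le> n" and RA: "norm (resolv ?A ** ?A) \<le> n"
      using norm_matrix_le_op[of "resolv ?A" 1] norm_matrix_le_op[of "resolv ?A ** ?A" 1]
        norm_resolv_apply[OF S] norm_resolv_mult_apply[OF S]
      by (simp_all add: n_def matrix_vector_mul_assoc)
    have prod3: "norm (P ** Q ** T) \<le> c * n * c" if "norm P \<le> c" "norm Q \<le> n" "norm T \<le> c"
      for P Q T :: "real^'n^'n"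
    proof -
      have "norm (P ** Q ** T) \<le> norm P * norm Q * norm T"
        by (meson norm_matrix_mult_le order_trans mult_right_mono norm_ge_zero)
      also have "\<dots> \<le> c * n * c" using that c n by (intro mult_mono) auto
      finally show ?thesis .
    qed
    have le: "c * n * c \<le> C0" unfolding C0_def using c n by simp
    have a: "norm (a_mat t p X) \<le> C0"
      unfolding a_mat_eq[OF X] using prod3 C R le order_trans by blast
    have "a_mat t p X ** X = Cm ?y ** (resolv ?A ** ?A) ** Ci ?y"
      unfolding a_mat_eq[OF X] by (metis Cm_mult_eq matrix_mul_assoc)
    then have aX: "norm (a_mat t p X ** X) \<le> C0" using prod3 C RA le order_trans by metis
    let ?b = "b_vec t p X"
    \<comment> \<open>Pairing \<open>b\<close> with itself gives
      \<open>|b|\<^sup>2 \<le> C0 |b|\<close>.\<close>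
    let ?T = "resolv ?A ** ?A ** Ci ?y ** dCm ?y (t *\<^sub>R ?b)"
    have "(norm ?b)\<^sup>2 = 2 * trace ?T"
      using b_vec_inner[OF X, of t p ?b] by (simp add: power2_norm_eq_inner)
    also have "trace ?T = frob (mat 1) ?T" by (simp add: frob_def)
    also have "2 * \<dots> \<le> 2 * (norm (mat 1 :: real^'n^'n) * norm ?T)"
      using norm_frob_le[of "mat 1" ?T] by linarith
    also have "norm ?T \<le> n * c * (\<bar>K\<bar> * norm ?b)"
    proof -
      have "norm ?T \<le> norm (resolv ?A ** ?A) * norm (Ci ?y) * norm (dCm ?y (t *\<^sub>R ?b))"
        by (meson norm_matrix_mult_le order_trans mult_right_mono norm_ge_zero)
      also have "\<dots> \<le> n * c * (\<bar>K\<bar> * norm ?b)"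
      proof (intro mult_mono RA)
        have "norm (dCm ?y (t *\<^sub>R ?b)) \<le> K * norm (t *\<^sub>R ?b)" by (rule K[OF y])
        also have "\<dots> \<le> \<bar>K\<bar> * norm ?b" using norm_t_scale[OF t order_refl, of ?b]
          by (intro mult_mono) auto
        finally show "norm (dCm ?y (t *\<^sub>R ?b)) \<le> \<bar>K\<bar> * norm ?b" .
      qed (use C c n in auto)
      finally show ?thesis .
    qed
    finally have "(norm ?b)\<^sup>2 \<le> 2 * (norm (mat 1 :: real^'n^'n) * (n * c * (\<bar>K\<bar> * norm ?b)))"
      by (simp add: mult_left_mono)
    also have "\<dots> \<le> C0 * norm ?b"
      unfolding C0_def using c n by (simp add: algebra_simps)
    finally have "norm ?b \<le> C0" using C0 by (cases "norm ?b = 0") (simp_all add: power2_eq_square)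
    with a aX show ?thesis by blast
  qed
  with C0 show ?thesis using that by blast
qed

text \<open>Bounded Hessians are uniformly elliptic. Contrapositively, if \<open>a\<close>
  degenerates in a direction of length at least 1, then \<open>X\<close> must be large; this
  produces the condition \<open>|X| \<rightarrow> \<infinity>\<close> of a recession
  sequence.\<close>

lemma jet_elliptic:
  fixes M m :: real
  obtains c where "0 < c"
    "\<And>t p (X :: real^'n^'n) x. t \<in> {0..1} \<Longrightarrow> norm p \<le> M \<Longrightarrow> X \<in> sym_mats \<Longrightarrow> mat_norm X \<le> m \<Longrightarrow>
       c * (norm x)\<^sup>2 \<le> bilin (a_mat t p X) x x"
proof -
  obtain c where c: "0 < c" "\<And>y :: real^'n. norm y \<le> M \<Longrightarrow> norm (Cm y) \<le> c \<and> norm (Ci y) \<le> c"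
    using Cm_Ci_bounded by metis
  \<comment> \<open>\<open>1 / c\<^sup>2\<close> comes from
    \<open>|x| = |Ci (Cm x)| \<le> c |Cm x|\<close>, and \<open>c * (\<bar>m\<bar> * c)\<close>
    bounds the operator norm of \<open>A_mat t p X\<close>.\<close>
  define k where "k = (1 / c\<^sup>2) / (1 + (c * (\<bar>m\<bar> * c))\<^sup>2)"
  have k: "0 < k" unfolding k_def using c by (intro divide_pos_pos one_plus_square_ge(3)) auto
  have "k * (norm x)\<^sup>2 \<le> bilin (a_mat t p X) x x"
    if t: "t \<in> {0..1}" and p: "norm p \<le> M" and X: "X \<in> sym_mats" and m: "mat_norm X \<le> m"
    for t p x and X :: "real^'n^'n"
  proof -
    let ?y = "t *\<^sub>R p"
    note C = c(2)[OF norm_t_scale[OF t p]]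
    have Cv: "norm (Cm ?y *v z) \<le> c * norm z" for z
      by (rule order_trans[OF norm_matrix_vector_le]) (use C in \<open>auto intro: mult_right_mono\<close>)
    have Xv: "norm (X *v z) \<le> \<bar>m\<bar> * norm z" for z
    proof -
      have "norm (X *v z) \<le> mat_norm X * norm z"
        unfolding mat_norm_def by (rule onorm[OF matrix_vector_mul_bounded_linear])
      also have "\<dots> \<le> \<bar>m\<bar> * norm z" using m by (intro mult_right_mono) auto
      finally show ?thesis .
    qed
    have Av: "norm (A_mat t p X *v z) \<le> (c * (\<bar>m\<bar> * c)) * norm z" for z
    proof -
      have "norm (A_mat t p X *v z) = norm (Cm ?y *v (X *v (Cm ?y *v z)))"
        by (simp add: A_mat_eq matrix_vector_mul_assoc matrix_mul_assoc)
      also have "\<dots> \<le> c * (\<bar>m\<bar> * (c * norm z))"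
        using c by (intro order_trans[OF Cv] mult_left_mono order_trans[OF Xv] Cv) auto
      finally show ?thesis by (simp add: mult.assoc)
    qed
    have "norm x = norm (Ci ?y *v (Cm ?y *v x))" by (simp add: matrix_vector_mul_assoc Ci_Cm)
    also have "\<dots> \<le> c * norm (Cm ?y *v x)"
      by (rule order_trans[OF norm_matrix_vector_le]) (use C in \<open>auto intro: mult_right_mono\<close>)
    finally have "(norm x)\<^sup>2 \<le> c\<^sup>2 * (norm (Cm ?y *v x))\<^sup>2"
      by (metis norm_ge_zero power_mono power_mult_distrib)
    then have "(1 / c\<^sup>2) * (norm x)\<^sup>2 \<le> (norm (Cm ?y *v x))\<^sup>2"
      using c by (simp add: field_simps)
    then have "k * (norm x)\<^sup>2 \<le> (norm (Cm ?y *v x))\<^sup>2 / (1 + (c * (\<bar>m\<bar> * c))\<^sup>2)"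
      unfolding k_def using divide_right_mono[OF _ less_imp_le[OF one_plus_square_ge(3)]] by fastforce
    also have "\<dots> \<le> bilin (a_mat t p X) x x"
      unfolding bilin_a_mat[OF X] by (rule resolv_lower[OF A_mat_sym[OF X] Av])
    finally show ?thesis .
  qed
  with k show ?thesis using that by blast
qed

section \<open>Second-order calculus\<close>

lemma Ck_on_SucD: "Ck_on (Suc k) U S f \<Longrightarrow> Ck_on k U S f"
  by (induction k arbitrary: f) auto

lemma Ck_on_le: "Ck_on k U S f \<Longrightarrow> j \<le> k \<Longrightarrow> Ck_on j U S f"
proof (induction k arbitrary: f)
  case (Suc k)
  then show ?case using Ck_on_SucD le_Suc_eq by metis
qed simp

lemma Ck_on_continuous: "Ck_on k U S f \<Longrightarrow> continuous_on S f"
  by (cases k) auto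

lemma Ck_on_differentiable: "Ck_on k U S f \<Longrightarrow> 1 \<le> k \<Longrightarrow> x \<in> S \<Longrightarrow> x \<in> U \<Longrightarrow> f differentiable (at x)"
  by (cases k) auto

lemma Ck_on_grad_continuous:
  assumes "Ck_on k U S f" "1 \<le> k" shows "continuous_on S (grad U f)"
proof -
  obtain j where "k = Suc j" using assms by (cases k) auto
  then have "continuous_on S (pd U i f)" for i
    using assms Ck_on_continuous[of j U S "pd U i f"] by auto
  then show ?thesis unfolding grad_def by (intro continuous_on_vec_lambda)
qed

lemma Ck_on_hess_continuous:
  assumes "Ck_on k U S f" "2 \<le> k" shows "continuous_on S (hess U f)"
proof -
  obtain j where "k = Suc (Suc j)" using assms by (metis add_2_eq_Suc le_Suc_ex)
  then have "continuous_on S (pd U i (pd U j' f))" for i j'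
    using assms Ck_on_continuous[of j U S "pd U i (pd U j' f)"] by auto
  then show ?thesis unfolding hess_def by (intro continuous_on_vec_lambda)
qed

lemma grad_has_derivative:
  assumes "x \<in> U" "f differentiable (at x)"
  shows "(f has_derivative (\<lambda>h. grad U f x \<bullet> h)) (at x)"
proof -
  have D: "(f has_derivative frechet_derivative f (at x)) (at x)"
    using assms(2) by (simp add: frechet_derivative_works)
  then have lin: "linear (frechet_derivative f (at x))" by (rule has_derivative_linear)
  have "frechet_derivative f (at x) h = grad U f x \<bullet> h" for h
  proof -
    have "frechet_derivative f (at x) h = frechet_derivative f (at x) (\<Sum>k\<in>UNIV. h $ k *\<^sub>R axis k 1)"
      using basis_expansion[of h] by (simp add: scalar_mult_eq_scaleR)
    also have "\<dots> = grad U f x \<bullet> h"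
      using assms(1) by (simp only: linear_sum[OF lin] linear_scale[OF lin])
        (simp add: grad_def pd_def inner_vec_def mult.commute)
    finally show ?thesis .
  qed
  then have "frechet_derivative f (at x) = (\<lambda>h. grad U f x \<bullet> h)" by auto
  then show ?thesis using D by simp
qed

lemma pd_eqI:
  assumes "x \<in> U" "(f has_derivative f') (at x)"
  shows "pd U i f x = f' (axis i 1)"
  using assms frechet_derivative_at[OF assms(2)] by (simp add: pd_def)

lemma pd_cong:
  assumes "open V" "V \<subseteq> U" "x \<in> V" "\<And>y. y \<in> V \<Longrightarrow> f y = g y" "f differentiable (at x)"
  shows "pd U i f x = pd U i g x"
proof -
  have f: "(f has_derivative (\<lambda>h. grad U f x \<bullet> h)) (at x)"
    using assms by (intro grad_has_derivative) auto
  have "(g has_derivative (\<lambda>h. grad U f x \<bullet> h)) (at x)"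
    by (rule has_derivative_transform_within_open[OF f]) (use assms in auto)
  then show ?thesis using f assms pd_eqI by (metis subsetD)
qed

lemma line_derivative:
  fixes f :: "'a::real_normed_vector \<Rightarrow> real"
  assumes "(f has_derivative f') (at (x + s *\<^sub>R v))"
  shows "((\<lambda>s. f (x + s *\<^sub>R v)) has_real_derivative f' v) (at s)"
proof -
  have "((\<lambda>s. x + s *\<^sub>R v) has_derivative (\<lambda>h. h *\<^sub>R v)) (at s)"
    by (auto intro!: derivative_eq_intros)
  from has_derivative_compose[OF this assms] show ?thesis
    unfolding has_field_derivative_def
    by (rule has_derivative_eq_rhs)
      (simp add: fun_eq_iff linear_scale[OF has_derivative_linear[OF assms]])
qed

text \<open>The mean value theorem is applied first in direction \<open>u\<close> to a difference in
  direction \<open>v\<close>, then in direction \<open>v\<close>. The left-hand side is symmetric in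
  \<open>u\<close> and \<open>v\<close>, which is the source of equality of mixed
  derivatives.\<close>

lemma second_difference:
  fixes f :: "'a::real_normed_vector \<Rightarrow> real"
  assumes f: "\<And>y. y \<in> V \<Longrightarrow> (f has_derivative f' y) (at y)"
    and f2: "\<And>y. y \<in> V \<Longrightarrow> ((\<lambda>y. f' y u) has_derivative f'' y) (at y)"
    and box: "\<And>a b. 0 \<le> a \<Longrightarrow> a \<le> s \<Longrightarrow> 0 \<le> b \<Longrightarrow> b \<le> s \<Longrightarrow> x + a *\<^sub>R u + b *\<^sub>R v \<in> V"
    and s: "0 < s"
  shows "\<exists>a b. 0 < a \<and> a < s \<and> 0 < b \<and> b < s \<and>
    f (x + s *\<^sub>R u + s *\<^sub>R v) - f (x + s *\<^sub>R u) - f (x + s *\<^sub>R v) + f x = s\<^sup>2 * f'' (x + a *\<^sub>R u + b *\<^sub>R v) v"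
proof -
  define \<phi> where "\<phi> a = f (x + a *\<^sub>R u + s *\<^sub>R v) - f (x + a *\<^sub>R u)" for a
  have d1: "((\<lambda>a. f (x + a *\<^sub>R u + b *\<^sub>R v)) has_real_derivative f' (x + a *\<^sub>R u + b *\<^sub>R v) u) (at a)"
    if "0 \<le> a" "a \<le> s" "0 \<le> b" "b \<le> s" for a b
    using line_derivative[of f "f' (x + a *\<^sub>R u + b *\<^sub>R v)" "x + b *\<^sub>R v" a u] f[OF box[OF that]]
    by (simp add: add_ac)
  have "(\<phi> has_real_derivative f' (x + a *\<^sub>R u + s *\<^sub>R v) u - f' (x + a *\<^sub>R u) u) (at a)"
    if "0 \<le> a" "a \<le> s" for a
    unfolding \<phi>_def using d1[OF that, of s] d1[OF that, of 0] s
    by (auto intro!: derivative_intros)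
  then obtain a where a: "0 < a" "a < s"
    "\<phi> s - \<phi> 0 = (s - 0) * (f' (x + a *\<^sub>R u + s *\<^sub>R v) u - f' (x + a *\<^sub>R u) u)"
    using MVT2[OF s, of \<phi> "\<lambda>a. f' (x + a *\<^sub>R u + s *\<^sub>R v) u - f' (x + a *\<^sub>R u) u"] by blast
  have d2: "((\<lambda>b. f' (x + a *\<^sub>R u + b *\<^sub>R v) u) has_real_derivative f'' (x + a *\<^sub>R u + b *\<^sub>R v) v) (at b)"
    if "0 \<le> b" "b \<le> s" for b
    by (rule line_derivative[OF f2[OF box]]) (use a that in auto)
  obtain b where b: "0 < b" "b < s"
    "f' (x + a *\<^sub>R u + s *\<^sub>R v) u - f' (x + a *\<^sub>R u + 0 *\<^sub>R v) u = (s - 0) * f'' (x + a *\<^sub>R u + b *\<^sub>R v) v"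
    using MVT2[OF s d2] by blast
  have "f (x + s *\<^sub>R u + s *\<^sub>R v) - f (x + s *\<^sub>R u) - f (x + s *\<^sub>R v) + f x = \<phi> s - \<phi> 0"
    by (simp add: \<phi>_def)
  also have "\<dots> = s\<^sup>2 * f'' (x + a *\<^sub>R u + b *\<^sub>R v) v"
    using a(3) b(3) by (simp add: power2_eq_square)
  finally show ?thesis using a b by blast
qed

text \<open>Schwarz's theorem: the same second difference, expanded in both orders, equals
  \<open>s\<^sup>2\<close> times either mixed derivative at points near \<open>x\<close>. If the two
  derivatives differed at \<open>x\<close>, continuity would separate them by half of the gap on
  each side.\<close>

lemma hess_symmetric:
  fixes V :: "(real^'n) set"
  assumes V: "open V" "V \<subseteq> U" "V \<subseteq> S" and f: "Ck_on 2 U S f" and x: "x \<in> V"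
  shows "hess U f x \<in> sym_mats"
proof -
  have f1: "(f has_derivative (\<lambda>h. grad U f y \<bullet> h)) (at y)" if "y \<in> V" for y
    using that V Ck_on_differentiable[OF f] by (intro grad_has_derivative) auto
  have f2: "((\<lambda>y. grad U f y \<bullet> axis j 1) has_derivative (\<lambda>h. grad U (pd U j f) y \<bullet> h)) (at y)"
    if "y \<in> V" for y j
  proof -
    have "Ck_on 1 U S (pd U j f)" using f by (simp add: numeral_2_eq_2)
    then have "(pd U j f has_derivative (\<lambda>h. grad U (pd U j f) y \<bullet> h)) (at y)"
      using that V Ck_on_differentiable by (intro grad_has_derivative) auto
    then show ?thesis by (simp add: grad_def inner_axis)
  qed
  have c: "continuous_on V (pd U i (pd U j f))" for i j
  proof -
    have "continuous_on S (pd U i (pd U j f))" using f by (simp add: numeral_2_eq_2)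
    then show ?thesis by (rule continuous_on_subset[OF _ V(3)])
  qed
  have "pd U i (pd U j f) x = pd U j (pd U i f) x" for i j
  proof (rule ccontr)
    assume ne: "pd U i (pd U j f) x \<noteq> pd U j (pd U i f) x"
    define e where "e = \<bar>pd U i (pd U j f) x - pd U j (pd U i f) x\<bar> / 2"
    have e: "0 < e" using ne by (simp add: e_def)
    have ev: "\<forall>\<^sub>F y in nhds x. y \<in> V \<and> \<bar>pd U i (pd U j f) y - pd U i (pd U j f) x\<bar> < e
        \<and> \<bar>pd U j (pd U i f) y - pd U j (pd U i f) x\<bar> < e"
    proof (intro eventually_conj)
      show "\<forall>\<^sub>F y in nhds x. y \<in> V" using V x by (simp add: eventually_nhds_in_open)
      have "\<forall>\<^sub>F y in nhds x. \<bar>g y - g x\<bar> < e" if "continuous_on V g" for g :: "real^'n \<Rightarrow> real"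
      proof -
        have "isCont g x" using that V x continuous_on_eq_continuous_at by blast
        then have "(g \<longlongrightarrow> g x) (nhds x)" by (simp add: continuous_at tendsto_nhds_iff)
        then show ?thesis using e by (simp add: tendsto_iff dist_real_def)
      qed
      then show "\<forall>\<^sub>F y in nhds x. \<bar>pd U i (pd U j f) y - pd U i (pd U j f) x\<bar> < e"
        "\<forall>\<^sub>F y in nhds x. \<bar>pd U j (pd U i f) y - pd U j (pd U i f) x\<bar> < e"
        using c by blast+
    qed
    then obtain r where r: "0 < r" and near: "\<And>y. dist y x < r \<Longrightarrow> y \<in> V
        \<and> \<bar>pd U i (pd U j f) y - pd U i (pd U j f) x\<bar> < e \<and> \<bar>pd U j (pd U i f) y - pd U j (pd U i f) x\<bar> < e"
      unfolding eventually_nhds_metric by blast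
    define s where "s = r / 3"
    have s: "0 < s" using r by (simp add: s_def)
    have d: "dist (x + a *\<^sub>R axis k 1 + b *\<^sub>R axis l 1) x < r"
      if "0 \<le> a" "a \<le> s" "0 \<le> b" "b \<le> s" for a b and k l :: 'n
    proof -
      have "dist (x + a *\<^sub>R axis k 1 + b *\<^sub>R axis l 1) x = norm (a *\<^sub>R axis k (1::real) + b *\<^sub>R axis l 1)"
        by (simp add: dist_norm)
      also have "\<dots> \<le> norm (a *\<^sub>R axis k (1::real)) + norm (b *\<^sub>R axis l (1::real))"
        by (rule norm_triangle_ineq)
      also have "\<dots> \<le> s + s" using that by (simp add: norm_axis_1)
      also have "\<dots> < r" using r by (simp add: s_def)
      finally show ?thesis .
    qed
    obtain a b where 1: "0 < a" "a < s" "0 < b" "b < s"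
      "f (x + s *\<^sub>R axis j 1 + s *\<^sub>R axis i 1) - f (x + s *\<^sub>R axis j 1) - f (x + s *\<^sub>R axis i 1) + f x
        = s\<^sup>2 * (grad U (pd U j f) (x + a *\<^sub>R axis j 1 + b *\<^sub>R axis i 1) \<bullet> axis i 1)"
      using second_difference[OF f1 f2[where j = j], where v="axis i 1" and s=s and x=x] d near s by metis
    obtain a' b' where 2: "0 < a'" "a' < s" "0 < b'" "b' < s"
      "f (x + s *\<^sub>R axis i 1 + s *\<^sub>R axis j 1) - f (x + s *\<^sub>R axis i 1) - f (x + s *\<^sub>R axis j 1) + f x
        = s\<^sup>2 * (grad U (pd U i f) (x + a' *\<^sub>R axis i 1 + b' *\<^sub>R axis j 1) \<bullet> axis j 1)"
      using second_difference[OF f1 f2[where j = i], where v="axis j 1" and s=s and x=x] d near s by metis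
    let ?y = "x + a *\<^sub>R axis j 1 + b *\<^sub>R axis i 1" and ?z = "x + a' *\<^sub>R axis i 1 + b' *\<^sub>R axis j 1"
    have "s\<^sup>2 * pd U i (pd U j f) ?y = s\<^sup>2 * pd U j (pd U i f) ?z"
      using 1(5) 2(5) by (simp add: grad_def inner_axis algebra_simps)
    then have "pd U i (pd U j f) ?y = pd U j (pd U i f) ?z" using s by simp
    moreover have "\<bar>pd U i (pd U j f) ?y - pd U i (pd U j f) x\<bar> < e"
      using near[OF d] 1 by auto
    moreover have "\<bar>pd U j (pd U i f) ?z - pd U j (pd U i f) x\<bar> < e"
      using near[OF d] 2 by auto
    ultimately show False unfolding e_def by argo
  qed
  then show ?thesis by (simp add: sym_mats_def hess_def transpose_def vec_eq_iff)
qed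

lemma small_sequence:
  fixes \<epsilon> :: real
  assumes "0 < \<epsilon>"
  obtains q :: "nat \<Rightarrow> real" where "\<And>m. 0 < q m" "\<And>m. q m < \<epsilon>" "q \<longlonglongrightarrow> 0"
proof
  let ?q = "\<lambda>m. (\<epsilon> / 2) * inverse (real (Suc m))"
  show "?q \<longlonglongrightarrow> 0" by (intro tendsto_mult_right_zero LIMSEQ_inverse_real_of_nat)
  show "0 < ?q m" for m using assms by simp
  have "?q m \<le> (\<epsilon> / 2) * 1" for m
    using assms by (intro mult_left_mono) (auto simp: inverse_le_1_iff)
  then show "?q m < \<epsilon>" for m using assms by (smt (verit) field_sum_of_halves)
qed

section \<open>Calculus with explicit gradients and Hessians\<close>

text \<open>Carrying the gradient and Hessian as explicit fields lets the barriers be differentiated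
  by composing algebraic rules, without computing \<open>pd\<close> of a composite
  expression.\<close>

definition D2 :: "(real^'n) set \<Rightarrow> (real^'n \<Rightarrow> real) \<Rightarrow> (real^'n \<Rightarrow> real^'n) \<Rightarrow> (real^'n \<Rightarrow> real^'n^'n) \<Rightarrow> bool" where
  "D2 U f g H \<longleftrightarrow> (\<forall>x\<in>U. (f has_derivative (\<lambda>h. g x \<bullet> h)) (at x) \<and> (g has_derivative (\<lambda>h. H x *v h)) (at x))"

lemma D2_subset: "D2 U f g H \<Longrightarrow> V \<subseteq> U \<Longrightarrow> D2 V f g H"
  by (auto simp: D2_def)

lemma has_derivative_vec:
  fixes g :: "'a::real_normed_vector \<Rightarrow> 'b::real_normed_vector^'n"
  assumes "\<And>i. ((\<lambda>x. g x $ i) has_derivative (\<lambda>h. g' h $ i)) F"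
  shows "(g has_derivative g') F"
proof -
  have bl: "bounded_linear g'"
  proof -
    have "bounded_linear (\<lambda>h. g' h $ i)" for i using assms has_derivative_bounded_linear by blast
    then obtain K where K: "\<And>i h. norm (g' h $ i) \<le> norm h * K i"
      and add: "\<And>i x y. g' (x + y) $ i = g' x $ i + g' y $ i"
      and scale: "\<And>i c x. g' (c *\<^sub>R x) $ i = c *\<^sub>R (g' x $ i)"
      unfolding bounded_linear_def bounded_linear_axioms_def linear_iff by metis
    show ?thesis
    proof (rule bounded_linear_intro)
      show "norm (g' h) \<le> norm h * (\<Sum>i\<in>UNIV. K i)" for h
        unfolding norm_vec_def sum_distrib_left
        by (rule order_trans[OF L2_set_le_sum]) (auto intro: sum_mono K)
    qed (simp_all add: vec_eq_iff add scale)
  qed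
  show ?thesis using assms unfolding has_derivative_def
    by (auto intro!: vec_tendstoI bl)
qed

lemma Ck_on_D2:
  assumes V: "open V" "V \<subseteq> U" "V \<subseteq> S" and f: "Ck_on k U S f" "2 \<le> k"
  shows "D2 V f (grad U f) (hess U f)"
  unfolding D2_def
proof (intro ballI conjI)
  fix x assume x: "x \<in> V"
  have f2: "Ck_on 2 U S f" by (rule Ck_on_le[OF f])
  show "(f has_derivative (\<lambda>h. grad U f x \<bullet> h)) (at x)"
    using x V Ck_on_differentiable[OF f2] by (intro grad_has_derivative) auto
  \<comment> \<open>The derivative of component \<open>j\<close> of the gradient is column
    \<open>j\<close> of \<open>hess\<close>, whereas \<open>*v\<close> reads row
    \<open>j\<close>.\<close>
  have sym: "hess U f x $ i $ j = hess U f x $ j $ i" for i j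
    using hess_symmetric[OF V f2 x] by (simp add: sym_mats_def transpose_def vec_eq_iff)
  show "(grad U f has_derivative (\<lambda>h. hess U f x *v h)) (at x)"
  proof (rule has_derivative_vec)
    fix j
    have "Ck_on 1 U S (pd U j f)" using f2 by (simp add: numeral_2_eq_2)
    then have "(pd U j f has_derivative (\<lambda>h. grad U (pd U j f) x \<bullet> h)) (at x)"
      using x V Ck_on_differentiable by (intro grad_has_derivative) auto
    moreover have "grad U (pd U j f) x \<bullet> h = (hess U f x *v h) $ j" for h
      by (simp add: matrix_vector_mult_def sym[of j] inner_vec_def) (simp add: grad_def hess_def)
    ultimately show "((\<lambda>x. grad U f x $ j) has_derivative (\<lambda>h. (hess U f x *v h) $ j)) (at x)"
      by (simp add: grad_def)
  qed
qed

lemma D2_add: "D2 U f1 g1 H1 \<Longrightarrow> D2 U f2 g2 H2 \<Longrightarrow>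
    D2 U (\<lambda>x. f1 x + f2 x) (\<lambda>x. g1 x + g2 x) (\<lambda>x. H1 x + H2 x)"
  unfolding D2_def inner_add_left matrix_vector_mult_add_rdistrib by (auto intro: has_derivative_add)

lemma D2_diff: "D2 U f1 g1 H1 \<Longrightarrow> D2 U f2 g2 H2 \<Longrightarrow>
    D2 U (\<lambda>x. f1 x - f2 x) (\<lambda>x. g1 x - g2 x) (\<lambda>x. H1 x - H2 x)"
  unfolding D2_def inner_diff_left matrix_vector_mult_diff_rdistrib by (auto intro: has_derivative_diff)

lemma D2_scale:
  assumes "D2 U f g H"
  shows "D2 U (\<lambda>x. c * f x) (\<lambda>x. c *\<^sub>R g x) (\<lambda>x. c *\<^sub>R H x)"
  unfolding D2_def
proof (intro ballI conjI)
  fix x assume x: "x \<in> U"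
  show "((\<lambda>x. c * f x) has_derivative (\<lambda>h. c *\<^sub>R g x \<bullet> h)) (at x)"
    using has_derivative_mult_right[of f "\<lambda>h. g x \<bullet> h" "at x" c] assms x by (simp add: D2_def)
  show "((\<lambda>x. c *\<^sub>R g x) has_derivative (\<lambda>h. (c *\<^sub>R H x) *v h)) (at x)"
    using has_derivative_scaleR_right[of g "\<lambda>h. H x *v h" "at x" c] assms x
    by (simp add: D2_def scaleR_matrix_vector_assoc)
qed

lemma D2_sum:
  assumes "\<And>k. k \<in> A \<Longrightarrow> D2 U (f k) (g k) (H k)"
  shows "D2 U (\<lambda>x. \<Sum>k\<in>A. f k x) (\<lambda>x. \<Sum>k\<in>A. g k x) (\<lambda>x. \<Sum>k\<in>A. H k x)"
proof (cases "finite A")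
  case True
  then show ?thesis using assms
  proof (induction A)
    case empty
    then show ?case by (simp add: D2_def)
  next
    case (insert k A)
    then show ?case using D2_add[of U "f k" "g k" "H k"] by simp
  qed
qed (simp add: D2_def)

lemma D2_mult:
  assumes "D2 U f1 g1 H1" "D2 U f2 g2 H2"
  shows "D2 U (\<lambda>x. f1 x * f2 x) (\<lambda>x. f1 x *\<^sub>R g2 x + f2 x *\<^sub>R g1 x)
    (\<lambda>x. f1 x *\<^sub>R H2 x + f2 x *\<^sub>R H1 x + (outer (g2 x) (g1 x) + outer (g1 x) (g2 x)))"
  unfolding D2_def
proof (intro ballI conjI)
  fix x assume x: "x \<in> U"
  have d: "(f1 has_derivative (\<lambda>h. g1 x \<bullet> h)) (at x)" "(g1 has_derivative (\<lambda>h. H1 x *v h)) (at x)"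
    "(f2 has_derivative (\<lambda>h. g2 x \<bullet> h)) (at x)" "(g2 has_derivative (\<lambda>h. H2 x *v h)) (at x)"
    using assms x by (auto simp: D2_def)
  show "((\<lambda>x. f1 x * f2 x) has_derivative (\<lambda>h. (f1 x *\<^sub>R g2 x + f2 x *\<^sub>R g1 x) \<bullet> h)) (at x)"
    using has_derivative_mult[OF d(1) d(3)] by (simp add: inner_add_left mult.commute)
  show "((\<lambda>x. f1 x *\<^sub>R g2 x + f2 x *\<^sub>R g1 x) has_derivative
      (\<lambda>h. (f1 x *\<^sub>R H2 x + f2 x *\<^sub>R H1 x + (outer (g2 x) (g1 x) + outer (g1 x) (g2 x))) *v h)) (at x)"
    using has_derivative_add[OF has_derivative_scaleR[OF d(1) d(4)] has_derivative_scaleR[OF d(3) d(2)]]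
    by (simp add: matrix_vector_mult_add_rdistrib outer_apply scaleR_matrix_vector_assoc[symmetric] algebra_simps)
qed

lemma D2_sq_dist: "D2 U (\<lambda>x. (x - z) \<bullet> (x - z)) (\<lambda>x. 2 *\<^sub>R (x - z)) (\<lambda>x. 2 *\<^sub>R mat 1)"
  unfolding D2_def
  by (auto intro!: derivative_eq_intros simp: inner_commute scaleR_matrix_vector_assoc[symmetric])

text \<open>The Hessian is written through those of the partial derivatives because the
  differentiated equation is available for each \<open>pd U k f\<close>.\<close>

lemma D2_directional:
  assumes V: "open V" "V \<subseteq> U" "V \<subseteq> S" and f: "Ck_on 3 U S f"
  shows "D2 V (\<lambda>x. grad U f x \<bullet> \<eta>) (\<lambda>x. hess U f x *v \<eta>) (\<lambda>x. \<Sum>k\<in>UNIV. \<eta> $ k *\<^sub>R hess U (pd U k f) x)"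
proof -
  have "D2 V (pd U k f) (grad U (pd U k f)) (hess U (pd U k f))" for k
    by (rule Ck_on_D2[OF V, of 2]) (use f in \<open>simp_all add: numeral_3_eq_3 numeral_2_eq_2\<close>)
  note 1 = D2_sum[where A=UNIV, OF D2_scale[OF this]]
  have "(\<Sum>k\<in>UNIV. \<eta> $ k *\<^sub>R grad U (pd U k f) x) = hess U f x *v \<eta>" for x
    by (simp add: vec_eq_iff matrix_vector_mult_def hess_def grad_def mult.commute)
  moreover have "(\<Sum>k\<in>UNIV. \<eta> $ k * pd U k f x) = grad U f x \<bullet> \<eta>" for x
    by (simp add: inner_vec_def grad_def mult.commute)
  ultimately show ?thesis using 1[of "\<lambda>k. \<eta> $ k" "\<lambda>k. k"] by simp
qed

text \<open>If \<open>v \<bullet> (H x *v v)\<close> were negative, then, the gradient at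
  \<open>x\<close> being zero, the slope in direction \<open>v\<close> would be negative just beyond
  \<open>x\<close>, and the mean value theorem would give a value below \<open>f x\<close>.\<close>

lemma D2_local_min:
  assumes D: "D2 V f g H" and V: "open V" and x: "x \<in> V" and min: "\<And>y. y \<in> V \<Longrightarrow> f x \<le> f y"
  shows "g x = 0" "0 \<le> v \<bullet> (H x *v v)"
proof -
  have f: "(f has_derivative (\<lambda>h. g y \<bullet> h)) (at y)" if "y \<in> V" for y using D that by (simp add: D2_def)
  have "(\<lambda>h. g x \<bullet> h) = (\<lambda>h. 0)"
    by (rule has_derivative_local_min[OF f[OF x]])
      (use V x min in \<open>auto simp: eventually_at_topological\<close>)
  then have "g x \<bullet> g x = 0" by meson
  then show g0: "g x = 0" by simp
  show "0 \<le> v \<bullet> (H x *v v)"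
  proof (rule ccontr)
    assume "\<not> 0 \<le> v \<bullet> (H x *v v)"
    then have neg: "v \<bullet> (H x *v v) < 0" by simp
    obtain r where r: "0 < r" "ball x r \<subseteq> V" using V x open_contains_ball by blast
    have vr: "x + s *\<^sub>R v \<in> V" if "\<bar>s\<bar> < r / (norm v + 1)" for s
    proof -
      have "\<bar>s\<bar> * norm v \<le> \<bar>s\<bar> * (norm v + 1)" by (intro mult_left_mono) auto
      also have "\<dots> < r" using that norm_ge_zero[of v]
        by (simp add: pos_less_divide_eq add_nonneg_pos)
      finally show ?thesis using r(2) by (auto simp: dist_norm)
    qed
    have r1: "0 < r / (norm v + 1)" using r by (simp add: add_nonneg_pos)
    have "((\<lambda>y. v \<bullet> g y) has_derivative (\<lambda>h. v \<bullet> (H x *v h))) (at (x + 0 *\<^sub>R v))"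
      using D x by (auto simp: D2_def intro: has_derivative_inner_right)
    note DERIV = line_derivative[OF this]
    from DERIV_neg_dec_right[OF DERIV neg] g0
    obtain q where q: "0 < q" "\<And>h. 0 < h \<Longrightarrow> h < q \<Longrightarrow> v \<bullet> g (x + h *\<^sub>R v) < 0"
      by auto
    obtain s where s: "0 < s" "s < q" "s < r / (norm v + 1)"
      using field_lbound_gt_zero[OF q(1) r1] by blast
    have "((\<lambda>s. f (x + s *\<^sub>R v)) has_real_derivative v \<bullet> g (x + h *\<^sub>R v)) (at h)"
      if "0 \<le> h" "h \<le> s" for h
      using line_derivative[OF f[OF vr]] that s by (auto simp: inner_commute)
    from MVT2[OF s(1) this] obtain h where "0 < h" "h < s"
      "f (x + s *\<^sub>R v) - f (x + 0 *\<^sub>R v) = (s - 0) * (v \<bullet> g (x + h *\<^sub>R v))" by blast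
    moreover from this have "(s - 0) * (v \<bullet> g (x + h *\<^sub>R v)) < 0"
      using q(2)[of h] s by (simp add: mult_pos_neg)
    moreover have "f x \<le> f (x + s *\<^sub>R v)" using vr s by (intro min) auto
    ultimately show False by simp
  qed
qed

text \<open>In an eigenbasis of \<open>a\<close> the trace is a combination of the values
  \<open>v i \<bullet> (H *v v i)\<close> with nonnegative weights.\<close>

lemma frob_nonneg:
  assumes a: "a \<in> sym_mats" "\<And>v. 0 \<le> bilin a v v" and H: "\<And>v. 0 \<le> v \<bullet> (H *v v)"
  shows "0 \<le> frob a H"
proof -
  obtain v d where eb: "eigenbasis a v d" using eigenbasis_exists[OF a(1)] .
  have av: "a *v v i = d i *\<^sub>R v i" for i using eb by (simp add: eigenbasis_def)
  have d: "0 \<le> d i" for i using a(2)[of "v i"] eb by (simp add: bilin_def eigenbasis_def)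
  have "frob a H = (\<Sum>i\<in>UNIV. d i * (v i \<bullet> (H *v v i)))"
    unfolding frob_def eigenbasis_trace[OF eb]
    by (simp add: matrix_vector_mul_assoc[symmetric] sym_matsD[OF a(1), symmetric] av)
  then show ?thesis using d H by (simp add: sum_nonneg)
qed

lemma frob_outer: "frob a (outer p q) = q \<bullet> (a *v p)"
  by (simp add: frob_def trace_def matrix_matrix_mult_def outer_def inner_vec_def matrix_vector_mult_def
      sum_distrib_left mult_ac)

text \<open>This is the equation differentiated in the direction of the \<open>k\<close>-th axis. It
  makes the third derivatives of \<open>u\<close> disappear from \<open>L\<close> applied to first
  derivatives.\<close>

lemma linearized_equation:
  assumes U: "open U" and u: "Ck_on 3 U S u" and S: "U \<subseteq> S"
    and eq: "\<And>x. x \<in> U \<Longrightarrow> G_op t (grad U u x) (hess U u x) = \<theta>" and x: "x \<in> U"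
  shows "frob (a_mat t (grad U u x) (hess U u x)) (hess U (pd U k u) x)
      + b_vec t (grad U u x) (hess U u x) \<bullet> grad U (pd U k u) x = 0"
proof -
  have u2: "Ck_on 2 U S u" using Ck_on_le[OF u] by simp
  have p2: "Ck_on 2 U S (pd U i u)" for i using u by (simp add: numeral_3_eq_3 numeral_2_eq_2)
  have p1: "Ck_on 1 U S (pd U i (pd U j u))" for i j using u by (simp add: numeral_3_eq_3)
  have sym: "hess U u y \<in> sym_mats" if "y \<in> U" for y
    by (rule hess_symmetric[OF U order_refl S u2 that])
  have swap: "pd U i (pd U j f) y = pd U j (pd U i f) y" if "Ck_on 2 U S f" "y \<in> U" for i j f y
    using hess_symmetric[OF U order_refl S that] by (simp add: sym_mats_def hess_def transpose_def vec_eq_iff)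
  \<comment> \<open>The derivative is taken within \<open>U\<close> because the chain rule asks for
    symmetric Hessians on the whole set; \<open>U\<close> is open, so nothing is lost.\<close>
  have dH: "(hess U u has_derivative (\<lambda>h. \<chi> i j. grad U (pd U i (pd U j u)) x \<bullet> h)) (at x within U)"
  proof (rule has_derivative_vec, rule has_derivative_vec)
    fix i j
    have "(pd U i (pd U j u) has_derivative (\<lambda>h. grad U (pd U i (pd U j u)) x \<bullet> h)) (at x)"
      using x S Ck_on_differentiable[OF p1] by (intro grad_has_derivative) auto
    then show "((\<lambda>y. hess U u y $ i $ j) has_derivative
        (\<lambda>h. (\<chi> i j. grad U (pd U i (pd U j u)) x \<bullet> h) $ i $ j)) (at x within U)"
      by (simp add: hess_def has_derivative_at_withinI)
  qed
  have "D2 U u (grad U u) (hess U u)" using Ck_on_D2[OF U order_refl S u2] by simp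
  then have dg: "(grad U u has_derivative (\<lambda>h. hess U u x *v h)) (at x within U)"
    using x by (simp add: D2_def has_derivative_at_withinI)
  have "((\<lambda>y. G_op t (grad U u y) (hess U u y)) has_derivative
      (\<lambda>h. frob (a_mat t (grad U u x) (hess U u x)) (\<chi> i j. grad U (pd U i (pd U j u)) x \<bullet> h)
         + b_vec t (grad U u x) (hess U u x) \<bullet> (hess U u x *v h))) (at x within U)"
    by (rule G_op_chain[OF dg dH sym sym[OF x]])
  moreover have "((\<lambda>y. G_op t (grad U u y) (hess U u y)) has_derivative (\<lambda>h. 0)) (at x within U)"
    by (rule has_derivative_transform[OF x _ has_derivative_const[of \<theta>]]) (use eq in auto)
  note this' = this
  have nb: "at x within U = at x" by (rule at_within_open[OF x U])
  from calculation this' have 0: "(\<lambda>h. frob (a_mat t (grad U u x) (hess U u x)) (\<chi> i j. grad U (pd U i (pd U j u)) x \<bullet> h)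
         + b_vec t (grad U u x) (hess U u x) \<bullet> (hess U u x *v h)) = (\<lambda>h. 0)"
    unfolding nb by (rule has_derivative_unique)
  have 1: "(\<chi> i j. grad U (pd U i (pd U j u)) x \<bullet> axis k 1) = hess U (pd U k u) x"
  proof -
    \<comment> \<open>The outer two derivatives are exchanged for the function
      \<open>pd U j u\<close>, then the inner two under the derivative in direction
      \<open>i\<close>; the latter is legitimate because the identity holds on all of
      \<open>U\<close>.\<close>
    have "pd U k (pd U i (pd U j u)) x = pd U i (pd U j (pd U k u)) x" for i j
    proof -
      have "pd U k (pd U i (pd U j u)) x = pd U i (pd U k (pd U j u)) x"
        by (rule swap[OF p2 x])
      also have "\<dots> = pd U i (pd U j (pd U k u)) x"
        by (rule pd_cong[OF U order_refl x swap[OF u2]])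
          (use x S Ck_on_differentiable[OF p1] in auto)
      finally show ?thesis .
    qed
    then show ?thesis by (simp add: vec_eq_iff hess_def grad_def inner_axis)
  qed
  have 2: "hess U u x *v axis k 1 = grad U (pd U k u) x"
    by (simp add: vec_eq_iff matrix_vector_mult_basis column_def hess_def grad_def)
  show ?thesis using fun_cong[OF 0, of "axis k 1"] by (simp add: 1 2)
qed

section \<open>Geometry of the boundary\<close>

lemma D2_compose_matrix:
  assumes D: "D2 UNIV f g H" and P: "P \<in> sym_mats"
  shows "D2 UNIV (\<lambda>x. f (P *v x)) (\<lambda>x. P *v g (P *v x)) (\<lambda>x. P ** H (P *v x) ** P)"
  unfolding D2_def
proof (intro ballI conjI)
  fix x
  have l: "((\<lambda>x. P *v x) has_derivative (\<lambda>h. P *v h)) F" for F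
    by (intro bounded_linear_imp_has_derivative matrix_vector_mul_bounded_linear)
  have f: "(f has_derivative (\<lambda>h. g y \<bullet> h)) (at y)" and g: "(g has_derivative (\<lambda>h. H y *v h)) (at y)" for y
    using D by (auto simp: D2_def)
  show "((\<lambda>x. f (P *v x)) has_derivative (\<lambda>h. (P *v g (P *v x)) \<bullet> h)) (at x)"
    by (rule has_derivative_eq_rhs[OF has_derivative_compose[OF l f]]) (simp add: sym_matsD[OF P])
  show "((\<lambda>x. P *v g (P *v x)) has_derivative (\<lambda>h. (P ** H (P *v x) ** P) *v h)) (at x)"
    by (rule has_derivative_eq_rhs[OF has_derivative_compose[OF has_derivative_compose[OF l g] l]])
      (simp add: matrix_vector_mul_assoc matrix_mul_assoc)
qed

text \<open>In the graph representation of \<open>Ck_domain\<close>, \<open>\<rho> x = x \<bullet> e - \<gamma> (x - (x \<bullet> e) *\<^sub>R e)\<close>.\<close>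

definition chart :: "(real^'n) set \<Rightarrow> (real^'n) set \<Rightarrow> real^'n \<Rightarrow> (real^'n \<Rightarrow> real) \<Rightarrow> (real^'n \<Rightarrow> real^'n) \<Rightarrow> bool" where
  "chart \<Omega> B e \<rho> n \<longleftrightarrow> open B \<and> open \<Omega> \<and> norm e = 1 \<and> \<Omega> \<inter> B = {x \<in> B. 0 < \<rho> x} \<and>
     (\<forall>x. (\<rho> has_derivative (\<lambda>h. n x \<bullet> h)) (at x)) \<and> continuous_on UNIV n \<and>
     (\<forall>x s. \<rho> (x + s *\<^sub>R e) = \<rho> x + s)"

text \<open>\<open>n\<close> is the gradient of \<open>\<rho>\<close>, namely
  \<open>e - P grad \<gamma> (P x)\<close> with \<open>P\<close> the projection orthogonal to
  \<open>e\<close>. It must be twice differentiable because it is a coefficient of the field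
  \<open>T\<close>, and \<open>L\<close> is applied to \<open>T \<phi>\<close>; this uses three
  derivatives of \<open>\<gamma>\<close>.\<close>

lemma chart_exists:
  fixes \<Omega> :: "(real^'n) set"
  assumes dom: "Ck_domain k \<Omega>" "3 \<le> k" and x0: "x0 \<in> frontier \<Omega>"
  obtains r e \<rho> n G H where "0 < r" "chart \<Omega> (ball x0 r) e \<rho> n"
    "\<And>k. D2 UNIV (\<lambda>x. n x $ k) (G k) (H k)" "\<And>k. continuous_on UNIV (G k)" "\<And>k. continuous_on UNIV (H k)"
proof -
  obtain r e \<gamma> where r: "0 < r" and e: "norm e = 1" and \<gamma>k: "Ck_on k UNIV UNIV \<gamma>"
    and \<Omega>: "\<Omega> \<inter> ball x0 r = {x \<in> ball x0 r. \<gamma> (x - (x \<bullet> e) *\<^sub>R e) < x \<bullet> e}"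
  proof -
    have "\<forall>x0\<in>frontier \<Omega>. \<exists>r e \<gamma>. 0 < r \<and> norm e = 1 \<and> Ck_on k UNIV UNIV \<gamma> \<and>
        \<Omega> \<inter> ball x0 r = {x \<in> ball x0 r. \<gamma> (x - (x \<bullet> e) *\<^sub>R e) < x \<bullet> e}"
      using dom(1) by (simp add: Ck_domain_def)
    from bspec[OF this x0] show ?thesis using that by blast
  qed
  note \<gamma> = Ck_on_le[OF \<gamma>k dom(2)]
  define P where "P = mat 1 - outer e e"
  have P: "P \<in> sym_mats" unfolding P_def by (intro subspace_diff subspace_sym_mats mat_1_sym outer_sym)
  have Pv: "P *v x = x - (x \<bullet> e) *\<^sub>R e" for x
    by (simp add: P_def matrix_vector_mult_diff_rdistrib outer_apply inner_commute)
  have Pe: "P *v e = 0" using e by (simp add: Pv norm_eq_1)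
  define \<rho> where "\<rho> x = x \<bullet> e - \<gamma> (P *v x)" for x
  define n where "n x = e - P *v grad UNIV \<gamma> (P *v x)" for x
  have D\<gamma>: "D2 UNIV \<gamma> (grad UNIV \<gamma>) (hess UNIV \<gamma>)"
    by (rule Ck_on_D2[OF _ _ _ \<gamma>]) auto
  have D1: "D2 UNIV (\<lambda>x. \<gamma> (P *v x)) (\<lambda>x. P *v grad UNIV \<gamma> (P *v x)) (\<lambda>x. P ** hess UNIV \<gamma> (P *v x) ** P)"
    by (rule D2_compose_matrix[OF D\<gamma> P])
  have \<rho>d: "(\<rho> has_derivative (\<lambda>h. n x \<bullet> h)) (at x)" for x
  proof -
    have "((\<lambda>x. \<gamma> (P *v x)) has_derivative (\<lambda>h. (P *v grad UNIV \<gamma> (P *v x)) \<bullet> h)) (at x)"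
      using D1 by (simp add: D2_def)
    then show ?thesis unfolding \<rho>_def n_def
      by (auto intro!: derivative_eq_intros simp: inner_diff_left inner_diff_right inner_commute)
  qed
  have cP: "continuous_on UNIV (\<lambda>x. P *v x)"
    by (intro linear_continuous_on matrix_vector_mul_bounded_linear)
  have comp: "continuous_on UNIV (\<lambda>x. f (P *v x))" if "continuous_on UNIV f" for f :: "real^'n \<Rightarrow> 'b::topological_space"
    by (rule continuous_on_compose2[OF that cP]) simp
  have cont_n: "continuous_on UNIV n"
    unfolding n_def
    by (intro continuous_intros continuous_on_compose2[OF cP comp[OF Ck_on_grad_continuous[OF \<gamma>]]]) auto
  have "D2 UNIV (\<lambda>x. n x $ k) (\<lambda>x. - (P *v (hess UNIV \<gamma> (P *v x) *v (P *v axis k 1))))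
      (\<lambda>x. - (P ** (\<Sum>j\<in>UNIV. (P *v axis k 1) $ j *\<^sub>R hess UNIV (pd UNIV j \<gamma>) (P *v x)) ** P))" for k
  proof -
    have "D2 UNIV (\<lambda>x. grad UNIV \<gamma> x \<bullet> (P *v axis k 1)) (\<lambda>x. hess UNIV \<gamma> x *v (P *v axis k 1))
        (\<lambda>x. \<Sum>j\<in>UNIV. (P *v axis k 1) $ j *\<^sub>R hess UNIV (pd UNIV j \<gamma>) x)"
      by (rule D2_directional[OF _ _ _ \<gamma>]) auto
    note a = D2_compose_matrix[OF this P]
    have c: "D2 UNIV (\<lambda>x. e $ k) (\<lambda>x. 0) (\<lambda>x. 0)" by (simp add: D2_def)
    have "(\<lambda>x. n x $ k) = (\<lambda>x. e $ k - grad UNIV \<gamma> (P *v x) \<bullet> (P *v axis k 1))"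
    proof
      fix x
      have "grad UNIV \<gamma> (P *v x) \<bullet> (P *v axis k 1) = (P *v grad UNIV \<gamma> (P *v x)) \<bullet> axis k 1"
        by (simp add: sym_matsD[OF P])
      then show "n x $ k = e $ k - grad UNIV \<gamma> (P *v x) \<bullet> (P *v axis k 1)"
        by (simp add: n_def inner_axis)
    qed
    then show ?thesis using D2_diff[OF c a] by simp
  qed
  moreover have "continuous_on UNIV (\<lambda>x. - (P *v (hess UNIV \<gamma> (P *v x) *v (P *v axis k 1))))" for k
  proof -
    have "continuous_on UNIV (\<lambda>x. hess UNIV \<gamma> x *v (P *v axis k 1))"
      unfolding matrix_vector_mult_def
      by (intro continuous_on_vec_lambda continuous_intros Ck_on_hess_continuous[OF \<gamma>]) auto
    from continuous_on_compose2[OF cP comp[OF this]] show ?thesis by (intro continuous_intros) auto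
  qed
  moreover have "continuous_on UNIV (\<lambda>x. - (P ** (\<Sum>j\<in>UNIV. (P *v axis k 1) $ j *\<^sub>R hess UNIV (pd UNIV j \<gamma>) (P *v x)) ** P))" for k
  proof -
    have "continuous_on UNIV (hess UNIV (pd UNIV j \<gamma>))" for j
      by (rule Ck_on_hess_continuous[of 2]) (use \<gamma> in \<open>simp_all add: numeral_3_eq_3 numeral_2_eq_2\<close>)
    note comp[OF this]
    then show ?thesis
      by (intro continuous_intros bounded_bilinear.continuous_on[OF bounded_bilinear_matrix_mult]) auto
  qed
  moreover have "chart \<Omega> (ball x0 r) e \<rho> n"
    unfolding chart_def
  proof (intro conjI allI \<rho>d e cont_n)
    show "open \<Omega>" using dom by (simp add: Ck_domain_def)
    show "\<Omega> \<inter> ball x0 r = {x \<in> ball x0 r. 0 < \<rho> x}" unfolding \<Omega> by (auto simp: \<rho>_def Pv)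
    show "\<rho> (x + s *\<^sub>R e) = \<rho> x + s" for x s
      using e by (simp add: \<rho>_def matrix_vector_right_distrib matrix_vector_mult_scaleR Pe inner_add_left norm_eq_1)
  qed simp
  ultimately show ?thesis
    by (intro that[OF r, where e = e and \<rho> = \<rho> and n = n
        and G = "\<lambda>k x. - (P *v (hess UNIV \<gamma> (P *v x) *v (P *v axis k 1)))"
        and H = "\<lambda>k x. - (P ** (\<Sum>j\<in>UNIV. (P *v axis k 1) $ j *\<^sub>R hess UNIV (pd UNIV j \<gamma>) (P *v x)) ** P)"])
qed

section \<open>Tangent space, normal and tangential derivatives in a chart\<close>

context
  fixes \<Omega> B :: "(real^'n) set" and e \<rho> n
  assumes ch: "chart \<Omega> B e \<rho> n"
begin

lemma chart_rho: "(\<rho> has_derivative (\<lambda>h. n x \<bullet> h)) (at x)"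
  and chart_shift: "\<rho> (x + s *\<^sub>R e) = \<rho> x + s"
  and chart_open: "open B" "open \<Omega>"
  and chart_iff: "x \<in> B \<Longrightarrow> x \<in> \<Omega> \<longleftrightarrow> 0 < \<rho> x"
  and chart_cont: "continuous_on UNIV n"
  and chart_unit: "norm e = 1"
  using ch by (auto simp: chart_def)

lemma chart_rho_cont: "continuous_on S \<rho>"
  by (rule has_derivative_continuous_on[where f' = "\<lambda>x h. n x \<bullet> h"])
    (rule has_derivative_at_withinI[OF chart_rho])

text \<open>Sliding along \<open>e\<close> raises \<open>\<rho>\<close> at unit speed. Because of
  this normalization, subtracting \<open>(n x \<bullet> \<xi>) *\<^sub>R e\<close> from
  \<open>\<xi>\<close> makes it tangent to the level sets.\<close>

lemma chart_n_e: "n x \<bullet> e = 1"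
proof -
  have 1: "((\<lambda>s. \<rho> (x + s *\<^sub>R e)) has_real_derivative n x \<bullet> e) (at 0)"
    by (rule line_derivative) (simp add: chart_rho)
  have "((\<lambda>s. \<rho> (x + s *\<^sub>R e)) has_real_derivative 1) (at 0)"
    unfolding chart_shift by (auto intro!: derivative_eq_intros)
  from DERIV_unique[OF 1 this] show ?thesis .
qed

lemma chart_n_nz: "n x \<noteq> 0" using chart_n_e[of x] by auto

lemma frontier_chart:
  assumes x: "x \<in> B" shows "x \<in> frontier \<Omega> \<longleftrightarrow> \<rho> x = 0"
proof
  assume f: "x \<in> frontier \<Omega>"
  then have "x \<notin> \<Omega>" "x \<in> closure \<Omega>"
    using chart_open by (auto simp: frontier_def interior_open)
  then have "\<rho> x \<le> 0" using chart_iff[OF x] by simp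
  moreover have "0 \<le> \<rho> x"
  proof (rule ccontr)
    assume "\<not> 0 \<le> \<rho> x"
    moreover have "open {y. \<rho> y < 0}"
      using open_Collect_less[OF chart_rho_cont continuous_on_const] by simp
    ultimately have "open (B \<inter> {y. \<rho> y < 0})" "x \<in> B \<inter> {y. \<rho> y < 0}"
      using x chart_open by auto
    then obtain y where "y \<in> \<Omega>" "y \<in> B" "\<rho> y < 0"
      using \<open>x \<in> closure \<Omega>\<close> by (metis (no_types, lifting) IntD1 IntD2 closure_iff_nhds_not_empty disjoint_iff
          mem_Collect_eq order_refl)
    then show False using chart_iff by fastforce
  qed
  ultimately show "\<rho> x = 0" by simp
next
  assume 0: "\<rho> x = 0"
  then have "x \<notin> \<Omega>" using chart_iff[OF x] by simp
  moreover have "x \<in> closure \<Omega>"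
    unfolding closure_approachable
  proof (intro allI impI)
    fix \<epsilon> :: real assume \<epsilon>: "0 < \<epsilon>"
    obtain r where r: "0 < r" "ball x r \<subseteq> B" using x chart_open open_contains_ball by blast
    define s where "s = min \<epsilon> r / 2"
    have s: "0 < s" "s < \<epsilon>" "s < r" using \<epsilon> r by (auto simp: s_def)
    have "x + s *\<^sub>R e \<in> B" using r s chart_unit by (auto simp: dist_norm)
    then have "x + s *\<^sub>R e \<in> \<Omega>" using chart_iff chart_shift s 0 by simp
    then show "\<exists>y\<in>\<Omega>. dist y x < \<epsilon>" using s chart_unit by (intro bexI) (auto simp: dist_norm)
  qed
  ultimately show "x \<in> frontier \<Omega>" using chart_open by (simp add: frontier_def interior_open)
qed

text \<open>The curve obtained by sliding the tangent line back to the level set of \<open>\<rho>\<close>.\<close>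

definition cv :: "real^'n \<Rightarrow> real^'n \<Rightarrow> real \<Rightarrow> real^'n" where
  "cv x v s = x + s *\<^sub>R v - \<rho> (x + s *\<^sub>R v) *\<^sub>R e"

lemma rho_cv: "\<rho> (cv x v s + a *\<^sub>R e) = a"
proof -
  have "cv x v s + a *\<^sub>R e = (x + s *\<^sub>R v) + (a - \<rho> (x + s *\<^sub>R v)) *\<^sub>R e"
    by (simp add: cv_def algebra_simps)
  then show ?thesis by (simp only: chart_shift)
qed

lemma cv_0: "\<rho> x = 0 \<Longrightarrow> cv x v 0 = x"
  by (simp add: cv_def)

lemma cv_deriv: "(cv x v has_vector_derivative (v - (n (x + s *\<^sub>R v) \<bullet> v) *\<^sub>R e)) (at s)"
proof -
  have p: "((\<lambda>s. x + s *\<^sub>R v) has_derivative (\<lambda>h. h *\<^sub>R v)) (at s)"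
    by (auto intro!: derivative_eq_intros)
  have "((\<lambda>s. \<rho> (x + s *\<^sub>R v)) has_derivative (\<lambda>h. n (x + s *\<^sub>R v) \<bullet> (h *\<^sub>R v))) (at s)"
    by (rule has_derivative_compose[OF p chart_rho])
  then show ?thesis unfolding cv_def[abs_def] has_vector_derivative_def
    by (auto intro!: derivative_eq_intros simp: algebra_simps)
qed

lemma cv_cont: "continuous_on S (cv x v)"
  using cv_deriv by (meson continuous_at_imp_continuous_on has_vector_derivative_continuous)

lemma cv_in_B:
  assumes "x \<in> B" "\<rho> x = 0"
  obtains \<epsilon> where "0 < \<epsilon>" "\<And>s a. \<bar>s\<bar> < \<epsilon> \<Longrightarrow> \<bar>a\<bar> < \<epsilon> \<Longrightarrow> cv x v s + a *\<^sub>R e \<in> B"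
proof -
  obtain r where r: "0 < r" "ball x r \<subseteq> B" using assms chart_open open_contains_ball by blast
  have "isCont (cv x v) 0" using cv_deriv by (rule has_vector_derivative_continuous)
  then obtain q where q: "0 < q" "\<And>s. \<bar>s\<bar> < q \<Longrightarrow> dist (cv x v s) x < r / 2"
    unfolding continuous_at_eps_delta using r by (auto simp: cv_0[OF assms(2)] dist_real_def dest: spec[of _ "r/2"])
  have "cv x v s + a *\<^sub>R e \<in> B" if "\<bar>s\<bar> < min q (r/2)" "\<bar>a\<bar> < min q (r/2)" for s a
  proof -
    have "dist (cv x v s + a *\<^sub>R e) x \<le> dist (cv x v s + a *\<^sub>R e) (cv x v s) + dist (cv x v s) x"
      by (rule dist_triangle)
    also have "\<dots> < r / 2 + r / 2" using that q(2)[of s] chart_unit by (intro add_strict_mono) (auto simp: dist_norm)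
    finally show ?thesis using r by (auto simp: dist_commute)
  qed
  then show ?thesis using that[of "min q (r/2)"] q r by auto
qed

text \<open>Along a curve in the boundary \<open>\<rho>\<close> is constantly 0, which gives one
  inclusion; \<open>cv x v\<close> is a boundary curve with velocity \<open>v\<close> and gives the
  other.\<close>

lemma tangent_space_chart:
  assumes x: "x \<in> B" "x \<in> frontier \<Omega>"
  shows "tangent_space \<Omega> x = {v. n x \<bullet> v = 0}"
proof (safe)
  fix v assume "v \<in> tangent_space \<Omega> x"
  then obtain c \<epsilon> where c: "0 < \<epsilon>" "c 0 = x" "\<And>s. \<bar>s\<bar> < \<epsilon> \<Longrightarrow> c s \<in> frontier \<Omega>"
    "(c has_vector_derivative v) (at (0::real))"
    unfolding tangent_space_def by blast
  have d: "((\<lambda>s. \<rho> (c s)) has_derivative (\<lambda>h. n x \<bullet> (h *\<^sub>R v))) (at 0)"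
    using has_derivative_compose[OF c(4)[unfolded has_vector_derivative_def], of \<rho> "\<lambda>h. n x \<bullet> h"] chart_rho[of x] c(2)
    by simp
  have "open B" "isCont c 0" using chart_open c(4) has_vector_derivative_continuous by blast+
  then have "\<forall>\<^sub>F s in nhds 0. c s \<in> B"
    using x c(2) topological_tendstoD[of c "c 0" "nhds 0" B] tendsto_at_iff_tendsto_nhds[of c 0]
    by (simp add: isCont_def)
  then obtain q where q: "0 < q" "\<And>s. dist s 0 < q \<Longrightarrow> c s \<in> B"
    unfolding eventually_nhds_metric by blast
  have "((\<lambda>s. 0) has_derivative (\<lambda>h. n x \<bullet> (h *\<^sub>R v))) (at (0::real))"
    by (rule has_derivative_transform_within_open[OF d, of "ball 0 (min \<epsilon> q)"])
      (use c q frontier_chart in \<open>auto simp: dist_real_def\<close>)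
  from has_derivative_unique[OF this has_derivative_const] show "n x \<bullet> v = 0" by (metis scaleR_one)
next
  fix v assume v: "n x \<bullet> v = 0"
  have 0: "\<rho> x = 0" using frontier_chart x by simp
  obtain \<epsilon> where \<epsilon>: "0 < \<epsilon>" "\<And>s a. \<bar>s\<bar> < \<epsilon> \<Longrightarrow> \<bar>a\<bar> < \<epsilon> \<Longrightarrow> cv x v s + a *\<^sub>R e \<in> B"
    using cv_in_B[OF x(1) 0] by metis
  show "v \<in> tangent_space \<Omega> x" unfolding tangent_space_def
  proof (intro CollectI exI conjI allI impI)
    show "0 < \<epsilon>" by fact
    show "cv x v 0 = x" by (rule cv_0[OF 0])
    show "(cv x v has_vector_derivative v) (at 0)" using cv_deriv[of x v 0] v by simp
    fix s :: real assume "\<bar>s\<bar> < \<epsilon>"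
    then have "cv x v s \<in> B" using \<epsilon>(1) \<epsilon>(2)[of s 0] by simp
    then show "cv x v s \<in> frontier \<Omega>" using frontier_chart rho_cv[of x v s 0] by simp
  qed
qed

lemma chart_ray:
  assumes x: "x \<in> B" "\<rho> x = 0" and v: "0 < n x \<bullet> v"
  shows "\<exists>\<epsilon>>0. \<forall>s. 0 < s \<and> s < \<epsilon> \<longrightarrow> x + s *\<^sub>R v \<in> \<Omega> \<and> x - s *\<^sub>R v \<notin> \<Omega>"
proof -
  have d: "((\<lambda>s. \<rho> (x + s *\<^sub>R v)) has_real_derivative n x \<bullet> v) (at 0)"
    by (rule line_derivative) (simp add: chart_rho)
  obtain q where q: "0 < q" "\<And>h. 0 < h \<Longrightarrow> h < q \<Longrightarrow> 0 < \<rho> (x + h *\<^sub>R v)"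
    using DERIV_pos_inc_right[OF d v] x by auto
  obtain q' where q': "0 < q'" "\<And>h. 0 < h \<Longrightarrow> h < q' \<Longrightarrow> \<rho> (x - h *\<^sub>R v) < 0"
    using DERIV_pos_inc_left[OF d v] x by auto
  have "\<forall>\<^sub>F s in nhds 0. x + s *\<^sub>R v \<in> B"
  proof -
    have "isCont (\<lambda>s. x + s *\<^sub>R v) 0" by (intro continuous_intros)
    then show ?thesis using x chart_open topological_tendstoD[of "\<lambda>s. x + s *\<^sub>R v" x "nhds 0" B]
        tendsto_at_iff_tendsto_nhds[of "\<lambda>s. x + s *\<^sub>R v" 0]
      by (simp add: isCont_def)
  qed
  then obtain q'' where q'': "0 < q''" "\<And>s. dist s 0 < q'' \<Longrightarrow> x + s *\<^sub>R v \<in> B"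
    unfolding eventually_nhds_metric by blast
  show ?thesis
  proof (intro exI conjI allI impI)
    show "0 < min (min q q') q''" using q q' q'' by simp
    fix s assume s: "0 < s \<and> s < min (min q q') q''"
    then have "x + s *\<^sub>R v \<in> B" "x - s *\<^sub>R v \<in> B" using q''(2)[of s] q''(2)[of "-s"] by auto
    then show "x + s *\<^sub>R v \<in> \<Omega>" "x - s *\<^sub>R v \<notin> \<Omega>"
      using chart_iff q(2)[of s] q'(2)[of s] s by (auto simp: not_less less_imp_le)
  qed
qed

text \<open>A competing unit vector has no tangential component, so it is plus or minus the
  normalized \<open>n x\<close>. The minus sign is excluded because the opposite ray starts outside
  \<Omega>.\<close>

lemma inner_normal_chart:
  assumes x: "x \<in> B" "x \<in> frontier \<Omega>"
  shows "inner_normal \<Omega> x = (1 / norm (n x)) *\<^sub>R n x" (is "_ = ?\<nu>")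
proof -
  have 0: "\<rho> x = 0" using frontier_chart x by simp
  have nn: "0 < norm (n x)" using chart_n_nz by simp
  have pos: "0 < n x \<bullet> ?\<nu>" using nn by (simp add: chart_n_nz)
  have ray: "\<exists>\<epsilon>>0. \<forall>s. 0 < s \<and> s < \<epsilon> \<longrightarrow> x + s *\<^sub>R ?\<nu> \<in> \<Omega> \<and> x - s *\<^sub>R ?\<nu> \<notin> \<Omega>"
    by (rule chart_ray[OF x(1) 0 pos])
  show ?thesis unfolding inner_normal_def
  proof (rule the_equality)
    show "norm ?\<nu> = 1 \<and> (\<forall>\<xi>\<in>tangent_space \<Omega> x. \<xi> \<bullet> ?\<nu> = 0) \<and> (\<exists>\<epsilon>>0. \<forall>s. 0 < s \<and> s < \<epsilon> \<longrightarrow> x + s *\<^sub>R ?\<nu> \<in> \<Omega>)"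
      using nn ray chart_n_nz by (auto simp: tangent_space_chart[OF x] inner_commute)
  next
    fix \<mu> assume \<mu>: "norm \<mu> = 1 \<and> (\<forall>\<xi>\<in>tangent_space \<Omega> x. \<xi> \<bullet> \<mu> = 0) \<and> (\<exists>\<epsilon>>0. \<forall>s. 0 < s \<and> s < \<epsilon> \<longrightarrow> x + s *\<^sub>R \<mu> \<in> \<Omega>)"
    have \<nu>\<nu>: "?\<nu> \<bullet> ?\<nu> = 1" using nn by (simp add: dot_square_norm power2_eq_square)
    define w where "w = \<mu> - (?\<nu> \<bullet> \<mu>) *\<^sub>R ?\<nu>"
    have "?\<nu> \<bullet> w = 0" using \<nu>\<nu> by (simp add: w_def inner_diff_right)
    then have nw: "n x \<bullet> w = 0" using nn by simp
    then have "w \<bullet> \<mu> = 0" using \<mu> by (simp add: tangent_space_chart[OF x])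
    moreover have "w \<bullet> ?\<nu> = 0" using \<open>?\<nu> \<bullet> w = 0\<close> by (simp only: inner_commute)
    ultimately have "w \<bullet> w = 0" unfolding w_def[of ] by (metis (no_types) inner_diff_right inner_scaleR_right mult_zero_right right_minus_eq w_def)
    then have eq: "\<mu> = (?\<nu> \<bullet> \<mu>) *\<^sub>R ?\<nu>" by (simp add: w_def)
    have "\<bar>?\<nu> \<bullet> \<mu>\<bar> = 1"
    proof -
      have "norm \<mu> = \<bar>?\<nu> \<bullet> \<mu>\<bar> * norm ?\<nu>" using eq by (metis norm_scaleR)
      then show ?thesis using \<mu> nn by simp
    qed
    then consider "?\<nu> \<bullet> \<mu> = 1" | "?\<nu> \<bullet> \<mu> = -1" by linarith
    then show "\<mu> = ?\<nu>"
    proof cases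
      case 1
      show ?thesis using eq unfolding 1 by (simp only: scaleR_one)
    next
      case 2
      then have m: "\<mu> = - ?\<nu>" using eq by simp
      obtain \<epsilon>1 where e1: "0 < \<epsilon>1" "\<And>s. 0 < s \<Longrightarrow> s < \<epsilon>1 \<Longrightarrow> x + s *\<^sub>R \<mu> \<in> \<Omega>" using \<mu> by blast
      obtain \<epsilon>2 where e2: "0 < \<epsilon>2" "\<And>s. 0 < s \<Longrightarrow> s < \<epsilon>2 \<Longrightarrow> x - s *\<^sub>R ?\<nu> \<notin> \<Omega>" using ray by blast
      obtain s where s: "0 < s" "s < \<epsilon>1" "s < \<epsilon>2" using field_lbound_gt_zero[OF e1(1) e2(1)] by blast
      then show ?thesis using e1(2)[of s] e2(2)[of s] m by simp
    qed
  qed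
qed

text \<open>\<open>f\<close> is differentiable only inside \<Omega>, so it cannot be differentiated
  along a boundary curve. The curve is lifted by a small multiple of \<open>e\<close>, the mean
  value theorem is applied there, and continuity of \<open>f\<close> and \<open>g\<close> up to the
  boundary carries the result to \<open>x\<close>.\<close>

lemma tangential_derivative_zero:
  assumes x: "x \<in> B" "x \<in> frontier \<Omega>" and v: "n x \<bullet> v = 0"
    and f: "\<And>y. y \<in> \<Omega> \<Longrightarrow> (f has_derivative (\<lambda>h. g y \<bullet> h)) (at y)"
    and cf: "continuous_on (closure \<Omega>) f" and cg: "continuous_on (closure \<Omega>) g"
    and f0: "\<And>y. y \<in> frontier \<Omega> \<Longrightarrow> f y = 0"
  shows "g x \<bullet> v = 0"
proof -
  have 0: "\<rho> x = 0" using frontier_chart x by simp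
  obtain \<epsilon> where \<epsilon>: "0 < \<epsilon>" "\<And>s a. \<bar>s\<bar> < \<epsilon> \<Longrightarrow> \<bar>a\<bar> < \<epsilon> \<Longrightarrow> cv x v s + a *\<^sub>R e \<in> B"
    using cv_in_B[OF x(1) 0] by metis
  have in_\<Omega>: "cv x v s + a *\<^sub>R e \<in> \<Omega>" if "\<bar>s\<bar> < \<epsilon>" "0 < a" "a < \<epsilon>" for s a
    using \<epsilon>(2)[of s a] that chart_iff rho_cv by simp
  have fr: "cv x v s \<in> frontier \<Omega>" if "\<bar>s\<bar> < \<epsilon>" for s
    using \<epsilon>(2)[of s 0] \<epsilon>(1) that frontier_chart rho_cv[of x v s 0] by simp
  define dc where "dc s = v - (n (x + s *\<^sub>R v) \<bullet> v) *\<^sub>R e" for s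
  have cont_dc: "continuous_on UNIV dc" unfolding dc_def
    by (intro continuous_intros continuous_on_compose2[OF chart_cont]) auto
  have step: "\<exists>s a. 0 < s \<and> s < q \<and> 0 < a \<and> a < q \<and> \<bar>g (cv x v s + a *\<^sub>R e) \<bullet> dc s\<bar> \<le> q"
    if q: "0 < q" "q < \<epsilon>" for q
  proof -
    define s where "s = q / 2"
    have s: "0 < s" "s < q" "s < \<epsilon>" using q by (auto simp: s_def)
    \<comment> \<open>As the height \<open>a\<close> tends to 0, both values of \<open>f\<close>
      tend to 0. Choosing \<open>a\<close> with \<open>\<bar>D a\<bar> < q * s\<close> leaves
      \<open>q\<close> after division by the parameter length \<open>s\<close>.\<close>
    define D where "D a = f (cv x v s + a *\<^sub>R e) - f (cv x v 0 + a *\<^sub>R e)" for a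
    have cl: "cv x v \<sigma> + a *\<^sub>R e \<in> closure \<Omega>" if "\<bar>\<sigma>\<bar> < \<epsilon>" "0 \<le> a" "a < \<epsilon>" for \<sigma> a
      using fr[OF that(1)] in_\<Omega>[OF that(1), of a] that closure_subset[of \<Omega>]
      by (cases "a = 0") (auto simp: frontier_def)
    have "continuous_on {0..<\<epsilon>} D" unfolding D_def
      by (intro continuous_intros continuous_on_compose2[OF cf]) (use cl s \<epsilon> in auto)
    moreover have "D 0 = 0" using f0 fr[of s] fr[of 0] s \<epsilon> by (simp add: D_def)
    moreover from calculation(1)[unfolded continuous_on_iff, rule_format, of 0 "q * s"]
    obtain d where "0 < d" "\<And>a. a \<in> {0..<\<epsilon>} \<Longrightarrow> dist a 0 < d \<Longrightarrow> dist (D a) (D 0) < q * s"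
      using \<epsilon>(1) s q by auto
    ultimately obtain d where d: "0 < d" "\<And>a. 0 \<le> a \<Longrightarrow> a < \<epsilon> \<Longrightarrow> a < d \<Longrightarrow> \<bar>D a\<bar> < q * s"
      by (auto simp: dist_real_def)
    obtain a where a: "0 < a" "a < d" "a < q" using field_lbound_gt_zero[OF d(1) q(1)] by blast
    have der: "((\<lambda>\<sigma>. f (cv x v \<sigma> + a *\<^sub>R e)) has_real_derivative g (cv x v \<sigma> + a *\<^sub>R e) \<bullet> dc \<sigma>) (at \<sigma>)"
      if "0 \<le> \<sigma>" "\<sigma> \<le> s" for \<sigma>
    proof -
      have "((\<lambda>\<sigma>. cv x v \<sigma> + a *\<^sub>R e) has_derivative (\<lambda>h. h *\<^sub>R dc \<sigma>)) (at \<sigma>)"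
        using cv_deriv[of x v \<sigma>] unfolding has_vector_derivative_def dc_def
        by (auto intro!: derivative_eq_intros)
      from has_derivative_compose[OF this f[OF in_\<Omega>]] show ?thesis
        unfolding has_field_derivative_def
        by (rule has_derivative_eq_rhs) (use that s a q in \<open>auto simp: fun_eq_iff\<close>)
    qed
    obtain \<sigma> where \<sigma>: "0 < \<sigma>" "\<sigma> < s" "D a = (s - 0) * (g (cv x v \<sigma> + a *\<^sub>R e) \<bullet> dc \<sigma>)"
      using MVT2[OF s(1) der] unfolding D_def by blast
    have "s * \<bar>g (cv x v \<sigma> + a *\<^sub>R e) \<bullet> dc \<sigma>\<bar> \<le> s * q"
      using d(2)[of a] \<sigma>(3) a q s by (simp add: abs_mult mult.commute)
    then have "\<bar>g (cv x v \<sigma> + a *\<^sub>R e) \<bullet> dc \<sigma>\<bar> \<le> q" using s by simp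
    then show ?thesis using \<sigma> s a by (intro exI[of _ \<sigma>] exI[of _ a]) auto
  qed
  obtain q where q: "\<And>m. 0 < q m" "\<And>m. q m < \<epsilon>" and q0: "q \<longlonglongrightarrow> 0"
    using small_sequence[OF \<epsilon>(1)] by blast
  have "\<forall>m. \<exists>s a. 0 < s \<and> s < q m \<and> 0 < a \<and> a < q m \<and> \<bar>g (cv x v s + a *\<^sub>R e) \<bullet> dc s\<bar> \<le> q m"
    using step q by blast
  then obtain s a where sa: "\<And>m. 0 < s m \<and> s m < q m \<and> 0 < a m \<and> a m < q m
      \<and> \<bar>g (cv x v (s m) + a m *\<^sub>R e) \<bullet> dc (s m)\<bar> \<le> q m"
    by metis
  have s0: "s \<longlonglongrightarrow> 0" and a0: "a \<longlonglongrightarrow> 0"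
    by (rule tendsto_sandwich[OF _ _ tendsto_const q0]; use sa in \<open>simp add: less_imp_le\<close>)+
  have "(\<lambda>m. cv x v (s m) + a m *\<^sub>R e) \<longlonglongrightarrow> cv x v 0 + 0 *\<^sub>R e"
    by (intro tendsto_intros continuous_on_tendsto_compose[OF cv_cont[of UNIV] s0] a0) auto
  then have y: "(\<lambda>m. cv x v (s m) + a m *\<^sub>R e) \<longlonglongrightarrow> x" by (simp add: cv_0[OF 0])
  have "cv x v (s m) + a m *\<^sub>R e \<in> closure \<Omega>" for m
    using in_\<Omega>[of "s m" "a m"] sa[of m] q(2)[of m] closure_subset by force
  then have gy: "(\<lambda>m. g (cv x v (s m) + a m *\<^sub>R e)) \<longlonglongrightarrow> g x"
    by (intro continuous_on_tendsto_compose[OF cg y]) (use x in \<open>auto simp: frontier_def\<close>)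
  have "(\<lambda>m. dc (s m)) \<longlonglongrightarrow> dc 0"
    by (rule continuous_on_tendsto_compose[OF cont_dc s0]) auto
  then have dcv: "(\<lambda>m. dc (s m)) \<longlonglongrightarrow> v" using v by (simp add: dc_def)
  have "(\<lambda>m. \<bar>g (cv x v (s m) + a m *\<^sub>R e) \<bullet> dc (s m)\<bar>) \<longlonglongrightarrow> \<bar>g x \<bullet> v\<bar>"
    by (intro tendsto_intros gy dcv)
  then have "\<bar>g x \<bullet> v\<bar> \<le> 0" by (rule LIMSEQ_le[OF _ q0]) (use sa in auto)
  then show ?thesis by simp
qed

end

section \<open>One-sided derivatives and the distance function\<close>

text \<open>On each initial piece of the ray the mean value theorem finds a point with nonnegative
  slope. These points tend to \<open>x\<close>, and \<open>g\<close> is continuous on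
  \<open>S\<close>.\<close>

lemma boundary_min_derivative:
  fixes h :: "real^'n \<Rightarrow> real"
  assumes ray: "\<And>s. 0 < s \<Longrightarrow> s < \<epsilon> \<Longrightarrow> x + s *\<^sub>R \<nu> \<in> V" and \<epsilon>: "0 < \<epsilon>"
    and d: "\<And>y. y \<in> V \<Longrightarrow> (h has_derivative (\<lambda>k. g y \<bullet> k)) (at y)"
    and S: "V \<subseteq> S" "x \<in> S" and ch: "continuous_on S h" and cg: "continuous_on S g"
    and hx: "h x = 0" and min: "\<And>y. y \<in> V \<Longrightarrow> 0 \<le> h y"
  shows "0 \<le> g x \<bullet> \<nu>"
proof -
  have step: "\<exists>s. 0 < s \<and> s < q \<and> 0 \<le> g (x + s *\<^sub>R \<nu>) \<bullet> \<nu>" if q: "0 < q" "q < \<epsilon>" for q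
  proof -
    have c: "continuous_on {0..q} (\<lambda>s. h (x + s *\<^sub>R \<nu>))"
    proof (rule continuous_on_compose2[OF ch])
      show "(\<lambda>s. x + s *\<^sub>R \<nu>) ` {0..q} \<subseteq> S"
      proof safe
        fix s assume "s \<in> {0..q}"
        then show "x + s *\<^sub>R \<nu> \<in> S" using S ray[of s] q by (cases "s = 0") auto
      qed
    qed (intro continuous_intros)
    have dd: "((\<lambda>s. h (x + s *\<^sub>R \<nu>)) has_derivative (*) (g (x + s *\<^sub>R \<nu>) \<bullet> \<nu>)) (at s)"
      if "0 < s" "s < q" for s
      using line_derivative[OF d[OF ray]] that q unfolding has_field_derivative_def by simp
    obtain s where s: "0 < s" "s < q"
      "h (x + q *\<^sub>R \<nu>) - h (x + 0 *\<^sub>R \<nu>) = (g (x + s *\<^sub>R \<nu>) \<bullet> \<nu>) * (q - 0)"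
      using mvt[OF q(1) c dd] by blast
    have "0 \<le> h (x + q *\<^sub>R \<nu>)" using ray[OF q] by (rule min)
    then have "0 \<le> q * (g (x + s *\<^sub>R \<nu>) \<bullet> \<nu>)" using s(3) hx by (simp add: mult.commute)
    then show ?thesis using q s by (auto simp: zero_le_mult_iff)
  qed
  obtain q where q: "\<And>m. 0 < q m" "\<And>m. q m < \<epsilon>" and q0: "q \<longlonglongrightarrow> 0"
    using small_sequence[OF \<epsilon>] by blast
  have "\<forall>m. \<exists>s. 0 < s \<and> s < q m \<and> 0 \<le> g (x + s *\<^sub>R \<nu>) \<bullet> \<nu>" using step q by blast
  then obtain s where s: "\<And>m. 0 < s m \<and> s m < q m \<and> 0 \<le> g (x + s m *\<^sub>R \<nu>) \<bullet> \<nu>" by metis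
  have s0: "s \<longlonglongrightarrow> 0"
    by (rule tendsto_sandwich[OF _ _ tendsto_const q0]) (use s in \<open>simp_all add: less_imp_le\<close>)
  have "(\<lambda>m. x + s m *\<^sub>R \<nu>) \<longlonglongrightarrow> x + 0 *\<^sub>R \<nu>" by (intro tendsto_intros s0)
  then have y: "(\<lambda>m. x + s m *\<^sub>R \<nu>) \<longlonglongrightarrow> x" by simp
  have "x + s m *\<^sub>R \<nu> \<in> S" for m using S(1) ray[of "s m"] s[of m] q(2)[of m] by force
  then have "(\<lambda>m. g (x + s m *\<^sub>R \<nu>)) \<longlonglongrightarrow> g x"
    by (intro continuous_on_tendsto_compose[OF cg y S(2)]) auto
  then have "(\<lambda>m. g (x + s m *\<^sub>R \<nu>) \<bullet> \<nu>) \<longlonglongrightarrow> g x \<bullet> \<nu>" by (intro tendsto_intros)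
  then show ?thesis by (rule LIMSEQ_le_const) (use s in auto)
qed

lemma bdist_frontier: "x \<in> frontier \<Omega> \<Longrightarrow> bdist \<Omega> x = 0"
  by (simp add: bdist_def)

lemma bdist_nonneg: "0 \<le> bdist \<Omega> x"
  by (simp add: bdist_def infdist_nonneg)

lemma bdist_le: "y \<in> frontier \<Omega> \<Longrightarrow> bdist \<Omega> x \<le> dist x y"
  by (simp add: bdist_def infdist_le)

text \<open>Toward a nearest boundary point the distance decreases at unit rate. The lower bound
  ensures that \<open>a(Dd, Dd)\<close> can tend to 0 only through degeneration of
  \<open>a\<close>.\<close>

lemma norm_grad_bdist_ge:
  assumes \<Omega>: "open \<Omega>" and x: "x \<in> \<Omega>" and fr: "frontier \<Omega> \<noteq> {}"
    and d: "bdist \<Omega> differentiable (at x)"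
  shows "1 \<le> norm (grad \<Omega> (bdist \<Omega>) x)"
proof -
  let ?g = "grad \<Omega> (bdist \<Omega>) x"
  obtain y where y: "y \<in> frontier \<Omega>" "bdist \<Omega> x = dist x y"
    unfolding bdist_def using infdist_attains_inf[OF frontier_closed fr] by metis
  have "x \<noteq> y" using x y \<Omega> by (auto simp: frontier_def interior_open)
  then have D: "0 < dist x y" by simp
  have along: "bdist \<Omega> (x + s *\<^sub>R (y - x)) = dist x y - s * dist x y" if s: "0 \<le> s" "s \<le> 1" for s
  proof (rule antisym)
    have "(x + s *\<^sub>R (y - x)) - y = (1 - s) *\<^sub>R (x - y)" by (simp add: algebra_simps)
    then have "dist (x + s *\<^sub>R (y - x)) y = (1 - s) * dist x y" using s by (simp add: dist_norm)
    then show "bdist \<Omega> (x + s *\<^sub>R (y - x)) \<le> dist x y - s * dist x y"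
      using bdist_le[OF y(1), of "x + s *\<^sub>R (y - x)"] by (simp add: left_diff_distrib)
    have "dist x (x + s *\<^sub>R (y - x)) = s * dist x y" using s by (simp add: dist_norm norm_minus_commute)
    then show "dist x y - s * dist x y \<le> bdist \<Omega> (x + s *\<^sub>R (y - x))"
      using infdist_triangle[of x "frontier \<Omega>" "x + s *\<^sub>R (y - x)"] y(2) by (simp add: bdist_def)
  qed
  have "((\<lambda>s. bdist \<Omega> (x + s *\<^sub>R (y - x))) has_real_derivative ?g \<bullet> (y - x)) (at 0)"
    by (rule line_derivative) (use grad_has_derivative[OF x d] in simp)
  \<comment> \<open>A one-sided limit, because the formula \<open>along\<close> holds only for
    nonnegative \<open>s\<close>.\<close>
  then have "((\<lambda>s. (bdist \<Omega> (x + s *\<^sub>R (y - x)) - bdist \<Omega> x) / s) \<longlongrightarrow> ?g \<bullet> (y - x)) (at_right 0)"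
    using tendsto_mono[OF at_le[OF subset_UNIV]] by (fastforce simp: DERIV_def)
  moreover have "((\<lambda>s. (bdist \<Omega> (x + s *\<^sub>R (y - x)) - bdist \<Omega> x) / s) \<longlongrightarrow> - dist x y) (at_right 0)"
  proof (rule tendsto_eventually)
    have "\<forall>\<^sub>F s in at_right 0. s \<in> {0<..<1::real}" by (rule eventually_at_right_real) simp
    then show "\<forall>\<^sub>F s in at_right 0. (bdist \<Omega> (x + s *\<^sub>R (y - x)) - bdist \<Omega> x) / s = - dist x y"
      by eventually_elim (simp add: along y(2))
  qed
  ultimately have "?g \<bullet> (y - x) = - dist x y" by (rule tendsto_unique[rotated]) simp
  then have "dist x y \<le> norm ?g * dist x y"
    using Cauchy_Schwarz_ineq2[of ?g "y - x"] D by (simp add: dist_norm norm_minus_commute)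
  then show ?thesis using D by simp
qed

section \<open>Recession sequences\<close>

lemma continuous_on_compact_norm_bound:
  assumes "compact S" "continuous_on S f"
  obtains M where "0 < M" "\<And>x. x \<in> S \<Longrightarrow> norm (f x) \<le> M"
proof -
  have "bounded (f ` S)" using assms compact_continuous_image compact_imp_bounded by blast
  then show ?thesis using that unfolding bounded_pos by blast
qed

lemma collar_cball:
  assumes "x0 \<in> frontier \<Omega>" "0 < \<delta>"
  shows "closure \<Omega> \<inter> cball x0 (\<delta> / 2) \<subseteq> collar \<Omega> \<delta>"
proof
  fix x assume x: "x \<in> closure \<Omega> \<inter> cball x0 (\<delta> / 2)"
  then have "bdist \<Omega> x \<le> \<delta> / 2" using bdist_le[OF assms(1), of x] by (simp add: dist_commute)
  then show "x \<in> collar \<Omega> \<delta>" using x assms(2) by (simp add: collar_def)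
qed

lemma level_jetD:
  assumes "level_jet K \<theta> t p X" shows "t \<in> {0..1}" "p \<in> K" "X \<in> sym_mats"
  using assms by (auto simp: level_jet_def psd_def)

text \<open>\<open>X\<close> occurs explicitly in \<open>J\<close> only through the trace of
  \<open>a ** X\<close>, which is bounded for arbitrary \<open>X\<close>. Boundedness supplies the
  convergent subsequence of pairs.\<close>

lemma J_l_jet_bounded:
  fixes \<Omega> K :: "(real^'n) set"
  assumes bd: "bounded \<Omega>" and rc: "regular_collar \<Omega> \<delta>" and ub: "Ck_on 3 \<Omega> (closure \<Omega>) ub"
    and K: "bounded K" and x0: "x0 \<in> frontier \<Omega>"
  obtains C where "0 < C" "\<And>x t p X. x \<in> closure \<Omega> \<inter> cball x0 (\<delta> / 2) \<Longrightarrow> t \<in> {0..1} \<Longrightarrow> p \<in> K \<Longrightarrow> X \<in> sym_mats \<Longrightarrow>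
     \<bar>J_jet \<Omega> ub x t p X\<bar> \<le> C \<and> \<bar>l_jet \<Omega> x t p X\<bar> \<le> C"
proof -
  let ?S = "closure \<Omega> \<inter> cball x0 (\<delta> / 2)"
  have S: "compact ?S" using bd by (auto intro: compact_Int)
  have sub: "?S \<subseteq> collar \<Omega> \<delta>" using rc x0 by (intro collar_cball) (auto simp: regular_collar_def)
  have d: "Ck_on 4 \<Omega> (collar \<Omega> \<delta>) (bdist \<Omega>)" using rc by (simp add: regular_collar_def)
  obtain MK where MK: "0 < MK" "\<And>p. p \<in> K \<Longrightarrow> norm p \<le> MK" using K by (auto simp: bounded_pos)
  obtain C0 where C0: "0 < C0" "\<And>t p (X :: real^'n^'n). t \<in> {0..1} \<Longrightarrow> norm p \<le> MK \<Longrightarrow> X \<in> sym_mats \<Longrightarrow>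
       norm (a_mat t p X) \<le> C0 \<and> norm (b_vec t p X) \<le> C0 \<and> norm (a_mat t p X ** X) \<le> C0"
    using jet_bounds by metis
  obtain m1 where m1: "0 < m1" "\<And>x. x \<in> ?S \<Longrightarrow> norm (grad \<Omega> (bdist \<Omega>) x) \<le> m1"
    using continuous_on_compact_norm_bound[OF S continuous_on_subset[OF Ck_on_grad_continuous[OF d] sub]] by auto
  obtain m2 where m2: "0 < m2" "\<And>x. x \<in> ?S \<Longrightarrow> norm (hess \<Omega> (bdist \<Omega>) x) \<le> m2"
    using continuous_on_compact_norm_bound[OF S continuous_on_subset[OF Ck_on_hess_continuous[OF d] sub]] by auto
  obtain m3 where m3: "0 < m3" "\<And>x. x \<in> ?S \<Longrightarrow> norm (grad \<Omega> ub x) \<le> m3"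
    using continuous_on_compact_norm_bound[OF S continuous_on_subset[OF Ck_on_grad_continuous[OF ub]]] by auto
  obtain m4 where m4: "0 < m4" "\<And>x. x \<in> ?S \<Longrightarrow> norm (hess \<Omega> ub x) \<le> m4"
    using continuous_on_compact_norm_bound[OF S continuous_on_subset[OF Ck_on_hess_continuous[OF ub]]] by auto
  define C where "C = C0 * m2 + C0 * m1 + (C0 * m4 + norm (mat 1 :: real^'n^'n) * C0 + C0 * (m3 + MK))"
  have "0 < C" unfolding C_def using C0(1) m1(1) m2(1) m3(1) m4(1) MK(1) by (intro add_pos_pos add_nonneg_pos) (auto intro!: mult_pos_pos add_pos_nonneg add_nonneg_nonneg)
  moreover have "\<bar>J_jet \<Omega> ub x t p X\<bar> \<le> C \<and> \<bar>l_jet \<Omega> x t p X\<bar> \<le> C"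
    if x: "x \<in> ?S" and t: "t \<in> {0..1}" and p: "p \<in> K" and X: "X \<in> sym_mats" for x t p X
  proof -
    let ?a = "a_mat t p X" and ?b = "b_vec t p X"
    note c = C0(2)[OF t MK(2)[OF p] X]
    have fr: "\<bar>frob ?a H\<bar> \<le> C0 * m" if "norm H \<le> m" for H m
      by (rule order_trans[OF norm_frob_le]) (use c that C0(1) in \<open>auto intro: mult_mono\<close>)
    have ip: "\<bar>?b \<bullet> v\<bar> \<le> C0 * m" if "norm v \<le> m" for v m
      by (rule order_trans[OF Cauchy_Schwarz_ineq2]) (use c that C0(1) in \<open>auto intro: mult_mono\<close>)
    have aX: "\<bar>frob ?a X\<bar> \<le> norm (mat 1 :: real^'n^'n) * C0"
    proof -
      have "frob ?a X = frob (mat 1) (?a ** X)" by (simp add: frob_def)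
      also have "\<bar>\<dots>\<bar> \<le> norm (mat 1 :: real^'n^'n) * C0"
        by (rule order_trans[OF norm_frob_le]) (use c in \<open>auto intro: mult_left_mono\<close>)
      finally show ?thesis .
    qed
    have "frob ?a (hess \<Omega> ub x - X) = frob ?a (hess \<Omega> ub x) - frob ?a X"
      by (rule linear_diff[OF bounded_linear.linear[OF bounded_linear_frob]])
    moreover have "\<bar>?b \<bullet> (grad \<Omega> ub x - p)\<bar> \<le> C0 * (m3 + MK)"
      using m3(2)[OF x] MK(2)[OF p] norm_triangle_ineq4[of "grad \<Omega> ub x" p] by (intro ip) linarith
    ultimately have J: "\<bar>J_jet \<Omega> ub x t p X\<bar> \<le> C0 * m4 + norm (mat 1 :: real^'n^'n) * C0 + C0 * (m3 + MK)"
      unfolding J_jet_def using fr[OF m4(2)[OF x]] aX by linarith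
    have l: "\<bar>l_jet \<Omega> x t p X\<bar> \<le> C0 * m2 + C0 * m1"
      unfolding l_jet_def using fr[OF m2(2)[OF x]] ip[OF m1(2)[OF x]] by linarith
    have "0 \<le> C0 * m2 + C0 * m1" "0 \<le> C0 * m4 + norm (mat 1 :: real^'n^'n) * C0 + C0 * (m3 + MK)"
      using C0(1) m1(1) m2(1) m3(1) m4(1) MK(1) by (auto intro!: add_nonneg_nonneg mult_nonneg_nonneg)
    with J l show ?thesis unfolding C_def by linarith
  qed
  ultimately show ?thesis using that by blast
qed

text \<open>If none of the three alternatives held uniformly, a sequence of violating jets would be a
  doubly degenerate recession sequence (bounded Hessians are excluded by ellipticity), and a
  limit pair along it would contradict the margin.\<close>

lemma recession_trichotomy:
  fixes \<Omega> K :: "(real^'n) set"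
  assumes bd: "bounded \<Omega>" and op: "open \<Omega>" and rc: "regular_collar \<Omega> \<delta>" and ub: "Ck_on 3 \<Omega> (closure \<Omega>) ub"
    and K: "bounded K" and x0: "x0 \<in> frontier \<Omega>" and margin: "mrc_margin \<Omega> K \<theta> \<delta> ub x0 \<tau> > 0"
  obtains \<epsilon> where "0 < \<epsilon>" "\<And>x t p X. x \<in> \<Omega> \<Longrightarrow> dist x x0 < \<epsilon> \<Longrightarrow> level_jet K \<theta> t p X \<Longrightarrow>
     \<epsilon> \<le> bilin (a_mat t p X) (grad \<Omega> (bdist \<Omega>) x) (grad \<Omega> (bdist \<Omega>) x) \<or> \<epsilon> \<le> Q_jet \<Omega> ub x t p X
     \<or> \<epsilon> \<le> J_jet \<Omega> ub x t p X - \<tau> * l_jet \<Omega> x t p X"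
proof (rule ccontr)
  let ?Dd = "grad \<Omega> (bdist \<Omega>)"
  assume not: "\<not> thesis"
  note thesisI = that
  have no: "\<not> (\<forall>x t p X. x \<in> \<Omega> \<longrightarrow> dist x x0 < \<epsilon> \<longrightarrow> level_jet K \<theta> t p X \<longrightarrow>
     \<epsilon> \<le> bilin (a_mat t p X) (?Dd x) (?Dd x) \<or> \<epsilon> \<le> Q_jet \<Omega> ub x t p X
     \<or> \<epsilon> \<le> J_jet \<Omega> ub x t p X - \<tau> * l_jet \<Omega> x t p X)" if "0 < \<epsilon>" for \<epsilon>
    using thesisI[OF that] not by blast
  have \<delta>: "0 < \<delta>" and d: "Ck_on 4 \<Omega> (collar \<Omega> \<delta>) (bdist \<Omega>)" using rc by (auto simp: regular_collar_def)
  obtain MK where MK: "0 < MK" "\<And>p. p \<in> K \<Longrightarrow> norm p \<le> MK" using K by (auto simp: bounded_pos)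
  obtain q where q: "\<And>m. 0 < q m" "\<And>m. q m < \<delta> / 2" and q0: "q \<longlonglongrightarrow> 0"
    using small_sequence[OF half_gt_zero[OF \<delta>]] by blast
  \<comment> \<open>The negation is used with \<open>\<epsilon> = q m\<close>; staying below
    \<open>\<delta> / 2\<close> keeps the points in the collar.\<close>
  have "\<forall>m. \<exists>x t p X. x \<in> \<Omega> \<and> dist x x0 < q m \<and> level_jet K \<theta> t p X
     \<and> bilin (a_mat t p X) (?Dd x) (?Dd x) < q m \<and> Q_jet \<Omega> ub x t p X < q m
     \<and> J_jet \<Omega> ub x t p X - \<tau> * l_jet \<Omega> x t p X < q m"
    using no[OF q(1)] by (meson not_le)
  then obtain x t p X where jets: "\<And>m. x m \<in> \<Omega> \<and> dist (x m) x0 < q m \<and> level_jet K \<theta> (t m) (p m) (X m)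
     \<and> bilin (a_mat (t m) (p m) (X m)) (?Dd (x m)) (?Dd (x m)) < q m \<and> Q_jet \<Omega> ub (x m) (t m) (p m) (X m) < q m
     \<and> J_jet \<Omega> ub (x m) (t m) (p m) (X m) - \<tau> * l_jet \<Omega> (x m) (t m) (p m) (X m) < q m"
    by metis
  have x\<Omega>: "x m \<in> \<Omega>" and xd: "dist (x m) x0 < q m" and jet: "level_jet K \<theta> (t m) (p m) (X m)"
    and aq: "bilin (a_mat (t m) (p m) (X m)) (?Dd (x m)) (?Dd (x m)) < q m"
    and Qq: "Q_jet \<Omega> ub (x m) (t m) (p m) (X m) < q m"
    and Jq: "J_jet \<Omega> ub (x m) (t m) (p m) (X m) - \<tau> * l_jet \<Omega> (x m) (t m) (p m) (X m) < q m" for m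
    using jets[of m] by auto
  have xS: "x m \<in> closure \<Omega> \<inter> cball x0 (\<delta> / 2)" for m
    using x\<Omega>[of m] xd[of m] q(2)[of m] closure_subset[of \<Omega>] by (auto simp: dist_commute)
  have xc: "x m \<in> collar \<Omega> \<delta>" for m using xS collar_cball[OF x0 \<delta>] by blast
  have x_lim: "x \<longlonglongrightarrow> x0"
    unfolding tendsto_dist_iff[of x]
    by (rule tendsto_sandwich[OF _ _ tendsto_const q0]) (use xd in \<open>simp_all add: less_imp_le\<close>)
  have a_lim: "(\<lambda>m. bilin (a_mat (t m) (p m) (X m)) (?Dd (x m)) (?Dd (x m))) \<longlonglongrightarrow> 0"
    by (rule tendsto_sandwich[OF _ _ tendsto_const q0])
      (use aq bilin_a_mat_nonneg[OF level_jetD(3)[OF jet]] in \<open>simp_all add: less_imp_le\<close>)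
  have Q_lim: "(\<lambda>m. Q_jet \<Omega> ub (x m) (t m) (p m) (X m)) \<longlonglongrightarrow> 0"
    by (rule tendsto_sandwich[OF _ _ tendsto_const q0])
      (use Qq bilin_a_mat_nonneg[OF level_jetD(3)[OF jet]] in \<open>simp_all add: less_imp_le Q_jet_def\<close>)
  have grad1: "1 \<le> norm (?Dd (x m))" for m
    using op x\<Omega> x0 Ck_on_differentiable[OF d _ xc x\<Omega>] by (intro norm_grad_bdist_ge) auto
  have X_lim: "filterlim (\<lambda>m. mat_norm (X m)) at_top sequentially"
    unfolding filterlim_at_top
  proof
    fix Z :: real
    \<comment> \<open>If \<open>X m\<close> stayed below \<open>Z\<close>, ellipticity and
      \<open>|Dd| \<ge> 1\<close> would give \<open>a(Dd, Dd) \<ge> c\<close>, but this quantity is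
      less than \<open>q m\<close>.\<close>
    obtain c where c: "0 < c" "\<And>t p (X :: real^'n^'n) x. t \<in> {0..1} \<Longrightarrow> norm p \<le> MK \<Longrightarrow> X \<in> sym_mats \<Longrightarrow> mat_norm X \<le> Z \<Longrightarrow>
       c * (norm x)\<^sup>2 \<le> bilin (a_mat t p X) x x"
      using jet_elliptic by metis
    have "\<forall>\<^sub>F m in sequentially. q m < c" using order_tendstoD(2)[OF q0 c(1)] .
    then show "\<forall>\<^sub>F m in sequentially. Z \<le> mat_norm (X m)"
    proof eventually_elim
      fix m assume qc: "q m < c"
      show "Z \<le> mat_norm (X m)"
      proof (rule ccontr)
        assume "\<not> Z \<le> mat_norm (X m)"
        then have "c * (norm (?Dd (x m)))\<^sup>2 \<le> bilin (a_mat (t m) (p m) (X m)) (?Dd (x m)) (?Dd (x m))"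
          using level_jetD[OF jet] MK(2) by (intro c(2)) auto
        moreover have "c * 1 \<le> c * (norm (?Dd (x m)))\<^sup>2" using c(1) grad1 by (intro mult_left_mono one_le_power) auto
        ultimately show False using aq[of m] qc by simp
      qed
    qed
  qed
  have rs: "recession_seq \<Omega> K \<theta> \<delta> ub x0 x t p X"
    unfolding recession_seq_def using xc jet x_lim X_lim a_lim Q_lim by blast
  obtain C where C: "0 < C" "\<And>x t p X. x \<in> closure \<Omega> \<inter> cball x0 (\<delta> / 2) \<Longrightarrow> t \<in> {0..1} \<Longrightarrow> p \<in> K \<Longrightarrow> X \<in> sym_mats \<Longrightarrow>
     \<bar>J_jet \<Omega> ub x t p X\<bar> \<le> C \<and> \<bar>l_jet \<Omega> x t p X\<bar> \<le> C"
    using J_l_jet_bounded[OF bd rc ub K x0] by metis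
  let ?f = "\<lambda>m. (J_jet \<Omega> ub (x m) (t m) (p m) (X m), - l_jet \<Omega> (x m) (t m) (p m) (X m))"
  have "norm (?f m) \<le> C + C" for m
    using C(2)[OF xS level_jetD[OF jet], of m m m m] norm_Pair_le[of "fst (?f m)" "snd (?f m)"]
    by simp
  then have "bounded (range ?f)" by (auto simp: bounded_iff)
  then obtain jg r where r: "strict_mono (r :: nat \<Rightarrow> nat)" "(?f \<circ> r) \<longlonglongrightarrow> jg"
    using bounded_imp_convergent_subsequence by blast
  obtain j g where jg: "jg = (j, g)" by force
  have "(j, g) \<in> recession_pairs \<Omega> K \<theta> \<delta> ub x0"
    unfolding recession_pairs_def mem_Collect_eq case_prod_conv
    by (intro exI[of _ x] exI[of _ t] exI[of _ p] exI[of _ X] exI[of _ r])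
      (use rs r jg in \<open>simp add: comp_def\<close>)
  then have "mrc_margin \<Omega> K \<theta> \<delta> ub x0 \<tau> \<le> ereal (j + \<tau> * g)"
    unfolding mrc_margin_def by (rule INF_lower2) simp
  then have pos: "0 < j + \<tau> * g" using margin by (metis ereal_less(2) order_less_le_trans)
  have "(\<lambda>m. fst ((?f \<circ> r) m) + \<tau> * snd ((?f \<circ> r) m)) \<longlonglongrightarrow> fst jg + \<tau> * snd jg"
    by (intro tendsto_intros r(2))
  moreover have "(\<lambda>m. q (r m)) \<longlonglongrightarrow> 0" using LIMSEQ_subseq_LIMSEQ[OF q0 r(1)] by (simp add: comp_def)
  ultimately have "fst jg + \<tau> * snd jg \<le> 0"
    by (rule LIMSEQ_le) (use Jq in \<open>auto simp: less_imp_le\<close>)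
  then show False using pos jg by simp
qed

section \<open>The barrier\<close>

text \<open>The linearized operator acting on a gradient and a Hessian at a single point, so that
  its rules are pure algebra.\<close>

definition lin :: "real^'n^'n \<Rightarrow> real^'n \<Rightarrow> real^'n \<Rightarrow> real^'n^'n \<Rightarrow> real" where
  "lin a b g H = frob a H + b \<bullet> g"

lemma frob_linear: "linear (frob a)"
  by (rule bounded_linear.linear[OF bounded_linear_frob])

lemma lin_add: "lin a b (g1 + g2) (H1 + H2) = lin a b g1 H1 + lin a b g2 H2"
  by (simp add: lin_def linear_add[OF frob_linear] inner_add_right)

lemma lin_diff: "lin a b (g1 - g2) (H1 - H2) = lin a b g1 H1 - lin a b g2 H2"
  by (simp add: lin_def linear_diff[OF frob_linear] inner_diff_right)

lemma lin_scale: "lin a b (c *\<^sub>R g) (c *\<^sub>R H) = c * lin a b g H"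
  by (simp add: lin_def linear_scale[OF frob_linear] distrib_left)

lemma lin_sum: "lin a b (\<Sum>k\<in>A. g k) (\<Sum>k\<in>A. H k) = (\<Sum>k\<in>A. lin a b (g k) (H k))"
  by (simp add: lin_def linear_sum[OF frob_linear] inner_sum_right sum.distrib)

lemma lin_mult:
  assumes "a \<in> sym_mats"
  shows "lin a b (f1 *\<^sub>R g2 + f2 *\<^sub>R g1) (f1 *\<^sub>R H2 + f2 *\<^sub>R H1 + (outer g2 g1 + outer g1 g2))
    = f1 * lin a b g2 H2 + f2 * lin a b g1 H1 + 2 * bilin a g1 g2"
proof -
  have "g2 \<bullet> (a *v g1) = g1 \<bullet> (a *v g2)" using sym_matsD[OF assms, of g1 g2] by (simp add: inner_commute)
  then show ?thesis
    by (simp add: lin_def linear_add[OF frob_linear] linear_scale[OF frob_linear] inner_add_right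
        frob_outer bilin_def algebra_simps)
qed

lemma lin_bound:
  assumes "norm a \<le> m" "norm b \<le> m"
  shows "\<bar>lin a b g H\<bar> \<le> m * norm H + m * norm g"
proof -
  have "\<bar>frob a H\<bar> \<le> m * norm H"
    by (rule order_trans[OF norm_frob_le]) (use assms in \<open>auto intro: mult_right_mono\<close>)
  moreover have "\<bar>b \<bullet> g\<bar> \<le> m * norm g"
    by (rule order_trans[OF Cauchy_Schwarz_ineq2]) (use assms in \<open>auto intro: mult_right_mono\<close>)
  ultimately show ?thesis unfolding lin_def by linarith
qed

lemma norm_weighted_sum_le:
  fixes \<eta> :: "real^'n"
  assumes "norm \<eta> \<le> 1" "\<And>k. norm (f k) \<le> m"
  shows "norm (\<Sum>k\<in>UNIV. \<eta> $ k *\<^sub>R f k) \<le> real CARD('n) * m"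
proof -
  have "norm (\<eta> $ k *\<^sub>R f k) \<le> m" for k
  proof -
    have "\<bar>\<eta> $ k\<bar> \<le> 1" using component_le_norm_cart[of \<eta> k] assms(1) by linarith
    then have "\<bar>\<eta> $ k\<bar> * norm (f k) \<le> 1 * m" using assms(2)[of k] by (intro mult_mono) auto
    then show ?thesis by simp
  qed
  then show ?thesis using sum_norm_le[of UNIV "\<lambda>k. \<eta> $ k *\<^sub>R f k" "\<lambda>_. m"] by simp
qed

text \<open>There is no zero-order term and the inequality is strict, so semidefiniteness of
  \<open>a\<close> suffices: at an interior minimum the gradient vanishes and \<open>a : H\<close>
  is nonnegative. No ellipticity constant enters.\<close>

lemma weak_min_principle:
  assumes W: "open W" "W \<subseteq> S" and S: "compact S" and D: "D2 W h g H" and c: "continuous_on S h"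
    and a: "\<And>x. x \<in> W \<Longrightarrow> a x \<in> sym_mats" "\<And>x v. x \<in> W \<Longrightarrow> 0 \<le> bilin (a x) v v"
    and L: "\<And>x. x \<in> W \<Longrightarrow> lin (a x) (b x) (g x) (H x) < 0"
    and bdry: "\<And>x. x \<in> S \<Longrightarrow> x \<notin> W \<Longrightarrow> 0 \<le> h x" and x: "x \<in> S"
  shows "0 \<le> h x"
proof -
  obtain z where z: "z \<in> S" "\<And>y. y \<in> S \<Longrightarrow> h z \<le> h y"
    using continuous_attains_inf[OF S _ c] x by blast
  have "z \<notin> W"
  proof
    assume zW: "z \<in> W"
    have min: "h z \<le> h y" if "y \<in> W" for y using that W z by auto
    have "0 \<le> frob (a z) (H z)"
      using D2_local_min(2)[OF D W(1) zW min] a[OF zW] by (intro frob_nonneg) auto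
    then show False using L[OF zW] D2_local_min(1)[OF D W(1) zW min] by (simp add: lin_def)
  qed
  then show ?thesis using bdry[OF z(1)] z(2)[OF x] by linarith
qed

section \<open>The tangential auxiliary function and the barrier\<close>

text \<open>The gradient of \<open>g \<bullet> \<xi> - (n \<bullet> \<xi>) * (g \<bullet> e)\<close>
  when \<open>h\<close> is the derivative of \<open>g\<close> and \<open>G k\<close> the gradient of
  the \<open>k\<close>-th component of \<open>n\<close>; the sum is the gradient of
  \<open>n \<bullet> \<xi>\<close>.\<close>

definition tang_grad :: "real^'n \<Rightarrow> real^'n \<Rightarrow> real^'n \<Rightarrow> real^'n \<Rightarrow> real^'n^'n \<Rightarrow> ('n \<Rightarrow> real^'n) \<Rightarrow> real^'n" where
  "tang_grad \<xi> e n g h G = h *v \<xi> - ((n \<bullet> \<xi>) *\<^sub>R (h *v e) + (g \<bullet> e) *\<^sub>R (\<Sum>k\<in>UNIV. \<xi> $ k *\<^sub>R G k))"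

text \<open>The auxiliary function is \<open>T(u - ub)\<close> for the field \<open>T = \<partial>\<^sub>\<xi> - (n \<bullet> \<xi>) \<partial>\<^sub>e\<close>, which is tangential to the
  level sets of \<open>\<rho>\<close>. Second derivatives of \<open>u\<close> enter \<open>L T(u - ub)\<close> only through \<open>a D\<^sup>2u\<close>, which is bounded.\<close>

lemma tangential_operator:
  fixes \<Omega> V :: "(real^'n) set" and u ub :: "real^'n \<Rightarrow> real" and m t :: real
  defines "a \<equiv> \<lambda>x. a_mat t (grad \<Omega> u x) (hess \<Omega> u x)" and "b \<equiv> \<lambda>x. b_vec t (grad \<Omega> u x) (hess \<Omega> u x)"
  assumes \<Omega>: "open \<Omega>" and V: "open V" "V \<subseteq> \<Omega>"
    and u: "Ck_on 4 \<Omega> (closure \<Omega>) u" and ub: "Ck_on 3 \<Omega> (closure \<Omega>) ub"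
    and eq: "\<And>x. x \<in> \<Omega> \<Longrightarrow> G_op t (grad \<Omega> u x) (hess \<Omega> u x) = \<theta>"
    and n: "\<And>k. D2 V (\<lambda>x. n x $ k) (G k) (H k)"
    and e: "norm e \<le> 1" and \<xi>: "norm \<xi> \<le> 1" and m: "0 \<le> m"
    and bd: "\<And>x k. x \<in> V \<Longrightarrow> norm (G k x) \<le> m \<and> norm (H k x) \<le> m \<and> norm (n x) \<le> m \<and> norm (hess \<Omega> ub x) \<le> m
      \<and> norm (hess \<Omega> (pd \<Omega> k ub) x) \<le> m \<and> norm (grad \<Omega> ub x) \<le> m \<and> norm (grad \<Omega> u x) \<le> m
      \<and> norm (a x) \<le> m \<and> norm (b x) \<le> m
      \<and> norm (a x ** hess \<Omega> u x) \<le> m"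
  defines "g\<phi> \<equiv> \<lambda>x. grad \<Omega> u x - grad \<Omega> ub x" and "h\<phi> \<equiv> \<lambda>x. hess \<Omega> u x - hess \<Omega> ub x"
    and "N \<equiv> real CARD('n)"
  defines "CT \<equiv> (m * (N * m) + m * m) + (m * (m * (N * m) + m * m) + (2 * m) * (m * (N * m) + m * (N * m)) + 2 * (N * m * (m + m * m)))"
  obtains HT where
    "D2 V (\<lambda>x. g\<phi> x \<bullet> \<xi> - (n x \<bullet> \<xi>) * (g\<phi> x \<bullet> e))
       (\<lambda>x. tang_grad \<xi> e (n x) (g\<phi> x) (h\<phi> x) (\<lambda>k. G k x)) HT"
    "\<And>x. x \<in> V \<Longrightarrow> \<bar>lin (a x) (b x) (tang_grad \<xi> e (n x) (g\<phi> x) (h\<phi> x) (\<lambda>k. G k x)) (HT x)\<bar> \<le> CT"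
proof -
  have cl: "V \<subseteq> closure \<Omega>" using V closure_subset by blast
  have u3: "Ck_on 3 \<Omega> (closure \<Omega>) u" by (rule Ck_on_le[OF u]) simp
  define T where "T f \<eta> x = (\<Sum>k\<in>UNIV. \<eta> $ k *\<^sub>R hess \<Omega> (pd \<Omega> k f) x)" for f :: "real^'n \<Rightarrow> real" and \<eta> x
  have Du: "D2 V (\<lambda>x. grad \<Omega> u x \<bullet> \<eta>) (\<lambda>x. hess \<Omega> u x *v \<eta>) (T u \<eta>)" for \<eta>
    unfolding T_def by (rule D2_directional[OF V cl u3])
  have Dub: "D2 V (\<lambda>x. grad \<Omega> ub x \<bullet> \<eta>) (\<lambda>x. hess \<Omega> ub x *v \<eta>) (T ub \<eta>)" for \<eta>
    unfolding T_def by (rule D2_directional[OF V cl ub])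
  have D\<phi>: "D2 V (\<lambda>x. g\<phi> x \<bullet> \<eta>) (\<lambda>x. h\<phi> x *v \<eta>) (\<lambda>x. T u \<eta> x - T ub \<eta> x)" for \<eta>
    using D2_diff[OF Du Dub] by (simp add: g\<phi>_def h\<phi>_def inner_diff_left matrix_vector_mult_diff_rdistrib)
  define G\<xi> where "G\<xi> x = (\<Sum>k\<in>UNIV. \<xi> $ k *\<^sub>R G k x)" for x
  define H\<xi> where "H\<xi> x = (\<Sum>k\<in>UNIV. \<xi> $ k *\<^sub>R H k x)" for x
  have "D2 V (\<lambda>x. \<Sum>k\<in>UNIV. \<xi> $ k * (n x $ k)) G\<xi> H\<xi>"
    unfolding G\<xi>_def H\<xi>_def by (rule D2_sum[OF D2_scale[OF n]])
  then have D\<psi>: "D2 V (\<lambda>x. n x \<bullet> \<xi>) G\<xi> H\<xi>" by (simp add: inner_vec_def mult.commute)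
  note DT = D2_diff[OF D\<phi>[of \<xi>] D2_mult[OF D\<psi> D\<phi>[of e]]]
  show ?thesis
  proof (rule that[OF DT[unfolded G\<xi>_def, folded tang_grad_def]], goal_cases)
    case (1 x)
    note x = this
    have hs: "hess \<Omega> u x \<in> sym_mats"
      by (rule hess_symmetric[OF V cl Ck_on_le[OF u3] x]) simp
    have as: "a x \<in> sym_mats" unfolding a_def by (rule a_mat_symmetric[OF hs])
    have am: "norm (a x) \<le> m" and bm: "norm (b x) \<le> m" using bd[OF x] by auto
    note lb = lin_bound[OF am bm]
    \<comment> \<open>The differentiated equation, combined with weights \<open>\<eta> $ k\<close>,
      removes the third derivatives of \<open>u\<close>.\<close>
    have Lu: "lin (a x) (b x) (hess \<Omega> u x *v \<eta>) (T u \<eta> x) = 0" for \<eta>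
    proof -
      have "hess \<Omega> u x *v \<eta> = (\<Sum>k\<in>UNIV. \<eta> $ k *\<^sub>R grad \<Omega> (pd \<Omega> k u) x)"
        by (simp add: vec_eq_iff matrix_vector_mult_def hess_def grad_def mult.commute)
      then have "lin (a x) (b x) (hess \<Omega> u x *v \<eta>) (T u \<eta> x) = (\<Sum>k\<in>UNIV. \<eta> $ k * lin (a x) (b x) (grad \<Omega> (pd \<Omega> k u) x) (hess \<Omega> (pd \<Omega> k u) x))"
        unfolding T_def by (simp only: lin_sum lin_scale)
      also have "\<dots> = 0"
        using linearized_equation[OF \<Omega> u3 closure_subset eq] x V by (auto simp: lin_def a_def b_def)
      finally show ?thesis .
    qed
    have L\<phi>: "\<bar>lin (a x) (b x) (h\<phi> x *v \<eta>) (T u \<eta> x - T ub \<eta> x)\<bar> \<le> m * (N * m) + m * m" if \<eta>: "norm \<eta> \<le> 1" for \<eta>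
    proof -
      have "lin (a x) (b x) (h\<phi> x *v \<eta>) (T u \<eta> x - T ub \<eta> x) = - lin (a x) (b x) (hess \<Omega> ub x *v \<eta>) (T ub \<eta> x)"
        using Lu by (simp add: h\<phi>_def matrix_vector_mult_diff_rdistrib lin_diff)
      moreover have "norm (T ub \<eta> x) \<le> N * m"
        unfolding T_def N_def using bd[OF x] by (intro norm_weighted_sum_le \<eta>) auto
      moreover have "norm (hess \<Omega> ub x *v \<eta>) \<le> m * 1"
        by (intro order_trans[OF norm_matrix_vector_le] mult_mono) (use bd[OF x] \<eta> m in auto)
      ultimately show ?thesis using lb[of "hess \<Omega> ub x *v \<eta>" "T ub \<eta> x"] m
        by (auto intro: order_trans[OF _ add_mono[OF mult_left_mono mult_left_mono]])
    qed
    have G\<xi>m: "norm (G\<xi> x) \<le> N * m" and H\<xi>m: "norm (H\<xi> x) \<le> N * m"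
      unfolding G\<xi>_def H\<xi>_def N_def using bd[OF x] by (intro norm_weighted_sum_le \<xi>; auto)+
    have L\<psi>: "\<bar>lin (a x) (b x) (G\<xi> x) (H\<xi> x)\<bar> \<le> m * (N * m) + m * (N * m)"
      by (rule order_trans[OF lb add_mono[OF mult_left_mono mult_left_mono]]) (use G\<xi>m H\<xi>m m in auto)
    have \<psi>m: "\<bar>n x \<bullet> \<xi>\<bar> \<le> m"
    proof -
      have "\<bar>n x \<bullet> \<xi>\<bar> \<le> m * 1"
        by (intro order_trans[OF Cauchy_Schwarz_ineq2] mult_mono) (use bd[OF x] \<xi> m in auto)
      then show ?thesis by simp
    qed
    have em: "\<bar>g\<phi> x \<bullet> e\<bar> \<le> 2 * m"
    proof -
      have "norm (grad \<Omega> u x) \<le> m" "norm (grad \<Omega> ub x) \<le> m" using bd[OF x] by auto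
      then have "norm (g\<phi> x) \<le> 2 * m" unfolding g\<phi>_def
        using norm_triangle_ineq4[of "grad \<Omega> u x" "grad \<Omega> ub x"] by linarith
      then have "\<bar>g\<phi> x \<bullet> e\<bar> \<le> (2 * m) * 1"
        using m e by (intro order_trans[OF Cauchy_Schwarz_ineq2 mult_mono]) auto
      then show ?thesis by simp
    qed
    \<comment> \<open>The cross term of the product rule is the one place where second derivatives
      of \<open>u\<close> are not cancelled by the equation. They occur multiplied by
      \<open>a\<close>, and \<open>a ** D\<^sup>2u\<close> is bounded.\<close>
    have Bm: "\<bar>bilin (a x) (G\<xi> x) (h\<phi> x *v e)\<bar> \<le> N * m * (m + m * m)"
    proof -
      have "a x *v (h\<phi> x *v e) = (a x ** hess \<Omega> u x) *v e - a x *v (hess \<Omega> ub x *v e)"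
        by (simp add: h\<phi>_def matrix_vector_mult_diff_rdistrib matrix_vector_mult_diff_distrib matrix_vector_mul_assoc)
      moreover have "norm ((a x ** hess \<Omega> u x) *v e) \<le> m * 1"
        by (intro order_trans[OF norm_matrix_vector_le] mult_mono) (use bd[OF x] e m in auto)
      moreover have "norm (a x *v (hess \<Omega> ub x *v e)) \<le> m * (m * 1)"
        by (intro order_trans[OF norm_matrix_vector_le] mult_mono) (use bd[OF x] e m in auto)
      ultimately have "norm (a x *v (h\<phi> x *v e)) \<le> m + m * m"
        using norm_triangle_ineq4[of "(a x ** hess \<Omega> u x) *v e" "a x *v (hess \<Omega> ub x *v e)"] by simp
      then show ?thesis unfolding bilin_def
        using G\<xi>m by (intro order_trans[OF Cauchy_Schwarz_ineq2] mult_mono) (auto simp: N_def m)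
    qed
    have "\<bar>(n x \<bullet> \<xi>) * lin (a x) (b x) (h\<phi> x *v e) (T u e x - T ub e x)\<bar> \<le> m * (m * (N * m) + m * m)"
      unfolding abs_mult using \<psi>m L\<phi>[OF e] m by (intro mult_mono) auto
    moreover have "\<bar>(g\<phi> x \<bullet> e) * lin (a x) (b x) (G\<xi> x) (H\<xi> x)\<bar> \<le> (2 * m) * (m * (N * m) + m * (N * m))"
      unfolding abs_mult using em L\<psi> m by (intro mult_mono) auto
    ultimately show ?case
      unfolding tang_grad_def G\<xi>_def[symmetric] lin_diff lin_mult[OF as] CT_def
      using L\<phi>[OF \<xi>] Bm by linarith
  qed
qed

definition barrier_grad :: "real \<Rightarrow> real \<Rightarrow> real \<Rightarrow> real^'n \<Rightarrow> real \<Rightarrow> real^'n \<Rightarrow> real^'n" where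
  "barrier_grad \<tau> N \<phi> g\<phi> d gd =
     g\<phi> + \<tau> *\<^sub>R gd - N *\<^sub>R (d *\<^sub>R gd + d *\<^sub>R gd) - N *\<^sub>R (\<phi> *\<^sub>R g\<phi> + \<phi> *\<^sub>R g\<phi>)"

text \<open>The concave corrections \<open>- N d\<^sup>2\<close> and \<open>- N \<phi>\<^sup>2\<close> produce \<open>- 2 N a(Dd, Dd)\<close> and \<open>- 2 N Q\<close>; where both are
  small, the term \<open>- (J - \<tau> l)\<close> takes over.\<close>

lemma barrier_operator:
  fixes \<Omega> V :: "(real^'n) set" and \<tau> N t :: real
  assumes V: "open V" "V \<subseteq> \<Omega>" "V \<subseteq> S"
    and u: "Ck_on 2 \<Omega> (closure \<Omega>) u" and ub: "Ck_on 2 \<Omega> (closure \<Omega>) ub" and d: "Ck_on 2 \<Omega> S d"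
  defines "\<phi> \<equiv> \<lambda>x. u x - ub x" and "g\<phi> \<equiv> \<lambda>x. grad \<Omega> u x - grad \<Omega> ub x"
  obtains Hv where
    "D2 V (\<lambda>x. \<phi> x + \<tau> * d x - N * (d x * d x) - N * (\<phi> x * \<phi> x))
      (\<lambda>x. barrier_grad \<tau> N (\<phi> x) (g\<phi> x) (d x) (grad \<Omega> d x)) Hv"
    "\<And>a b x. a \<in> sym_mats \<Longrightarrow>
      lin a b (barrier_grad \<tau> N (\<phi> x) (g\<phi> x) (d x) (grad \<Omega> d x)) (Hv x)
      = lin a b (g\<phi> x) (hess \<Omega> u x - hess \<Omega> ub x) + \<tau> * lin a b (grad \<Omega> d x) (hess \<Omega> d x)
        - N * (2 * d x * lin a b (grad \<Omega> d x) (hess \<Omega> d x) + 2 * bilin a (grad \<Omega> d x) (grad \<Omega> d x))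
        - N * (2 * \<phi> x * lin a b (g\<phi> x) (hess \<Omega> u x - hess \<Omega> ub x) + 2 * bilin a (g\<phi> x) (g\<phi> x))"
proof -
  have cl: "V \<subseteq> closure \<Omega>" using V closure_subset by blast
  have D\<phi>: "D2 V \<phi> g\<phi> (\<lambda>x. hess \<Omega> u x - hess \<Omega> ub x)"
    unfolding \<phi>_def g\<phi>_def
    by (intro D2_diff Ck_on_D2[OF V(1,2) cl u] Ck_on_D2[OF V(1,2) cl ub]) auto
  have Dd: "D2 V d (grad \<Omega> d) (hess \<Omega> d)" by (rule Ck_on_D2[OF V d]) simp
  note D = D2_diff[OF D2_diff[OF D2_add[OF D\<phi> D2_scale[OF Dd]] D2_scale[OF D2_mult[OF Dd Dd]]] D2_scale[OF D2_mult[OF D\<phi> D\<phi>]]]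
  show ?thesis
    by (rule that[unfolded barrier_grad_def, OF D]) (simp only: lin_diff lin_scale lin_mult, simp only: lin_add lin_scale, simp add: algebra_simps)
qed

text \<open>Moving against \<open>e\<close>, \<open>\<rho>\<close> decreases at unit speed, so the
  boundary is reached after length \<open>\<rho> x\<close>; the mean value theorem on this segment
  bounds \<open>f\<close> by its gradient.\<close>

lemma chart_phi_bound:
  assumes ch: "chart \<Omega> B e \<rho> n"
    and x: "x \<in> \<Omega>" and seg: "\<And>s. 0 \<le> s \<Longrightarrow> s \<le> \<rho> x \<Longrightarrow> x - s *\<^sub>R e \<in> B"
    and f: "\<And>y. y \<in> \<Omega> \<Longrightarrow> (f has_derivative (\<lambda>h. g y \<bullet> h)) (at y)"
    and cf: "continuous_on (closure \<Omega>) f" and f0: "\<And>y. y \<in> frontier \<Omega> \<Longrightarrow> f y = 0"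
    and bd: "\<And>s. 0 \<le> s \<Longrightarrow> s < \<rho> x \<Longrightarrow> norm (g (x - s *\<^sub>R e)) \<le> M"
    and \<rho>x: "0 < \<rho> x"
  shows "f x \<le> \<rho> x * M"
proof -
  note sh = chart_shift[OF ch, of x "- s" for s, simplified]
  have in_\<Omega>: "x - s *\<^sub>R e \<in> \<Omega>" if "0 \<le> s" "s < \<rho> x" for s
    using chart_iff[OF ch seg[of s]] that sh[of s] by simp
  have end_fr: "x - \<rho> x *\<^sub>R e \<in> frontier \<Omega>"
    using frontier_chart[OF ch seg[of "\<rho> x"]] \<rho>x sh[of "\<rho> x"] by simp
  have c: "continuous_on {0..\<rho> x} (\<lambda>s. f (x - s *\<^sub>R e))"
  proof (rule continuous_on_compose2[OF cf])
    show "(\<lambda>s. x - s *\<^sub>R e) ` {0..\<rho> x} \<subseteq> closure \<Omega>"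
    proof safe
      fix s assume "s \<in> {0..\<rho> x}"
      then show "x - s *\<^sub>R e \<in> closure \<Omega>"
        using in_\<Omega>[of s] end_fr closure_subset[of \<Omega>] by (cases "s = \<rho> x") (auto simp: frontier_def)
    qed
  qed (intro continuous_intros)
  have dd: "((\<lambda>s. f (x - s *\<^sub>R e)) has_derivative (*) (- (g (x - s *\<^sub>R e) \<bullet> e))) (at s)"
    if "0 < s" "s < \<rho> x" for s
    using line_derivative[of f "\<lambda>h. g (x - s *\<^sub>R e) \<bullet> h" x s "- e"] f[OF in_\<Omega>] that
    unfolding has_field_derivative_def by simp
  obtain s where s: "0 < s" "s < \<rho> x"
    "f (x - \<rho> x *\<^sub>R e) - f (x - 0 *\<^sub>R e) = - (g (x - s *\<^sub>R e) \<bullet> e) * (\<rho> x - 0)"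
    using mvt[OF \<rho>x c dd] by blast
  have "f x = \<rho> x * (g (x - s *\<^sub>R e) \<bullet> e)" using s(3) f0[OF end_fr] by (simp add: mult.commute)
  also have "\<dots> \<le> \<rho> x * M"
  proof (intro mult_left_mono)
    have "g (x - s *\<^sub>R e) \<bullet> e \<le> norm (g (x - s *\<^sub>R e)) * norm e" by (rule norm_cauchy_schwarz)
    then show "g (x - s *\<^sub>R e) \<bullet> e \<le> M" using bd[of s] s chart_unit[OF ch] by simp
  qed (use \<rho>x in simp)
  finally show ?thesis .
qed

lemma defining_function_lipschitz:
  assumes ch: "chart \<Omega> B e \<rho> n" and S: "convex S" and bd: "\<And>x. x \<in> S \<Longrightarrow> norm (n x) \<le> m"
    and xy: "x \<in> S" "y \<in> S"
  shows "\<bar>\<rho> x - \<rho> y\<bar> \<le> m * dist x y"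
proof -
  have "norm (\<rho> x - \<rho> y) \<le> m * norm (x - y)"
  proof (rule differentiable_bound[OF S _ _ xy])
    fix z assume z: "z \<in> S"
    show "(\<rho> has_derivative (\<lambda>h. n z \<bullet> h)) (at z within S)"
      by (rule has_derivative_at_withinI[OF chart_rho[OF ch]])
    show "onorm (\<lambda>h. n z \<bullet> h) \<le> m"
    proof (rule onorm_le)
      fix h
      have "norm (n z \<bullet> h) \<le> norm (n z) * norm h" by (simp add: Cauchy_Schwarz_ineq2)
      also have "\<dots> \<le> m * norm h" using bd[OF z] by (rule mult_right_mono) simp
      finally show "norm (n z \<bullet> h) \<le> m * norm h" .
    qed
  qed
  then show ?thesis by (simp add: dist_norm)
qed

text \<open>The Hessian is continuous up to the boundary and the symmetric matrices form a closed
  set.\<close>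

lemma hess_symmetric_closure:
  assumes "open \<Omega>" "Ck_on 2 \<Omega> (closure \<Omega>) u" "x \<in> closure \<Omega>"
  shows "hess \<Omega> u x \<in> sym_mats"
proof -
  have "hess \<Omega> u ` closure \<Omega> \<subseteq> sym_mats"
  proof (rule image_closure_subset[OF Ck_on_hess_continuous[OF assms(2) order_refl]])
    show "closed (sym_mats :: (real^'a^'a) set)" by (rule closed_subspace[OF subspace_sym_mats])
    show "hess \<Omega> u ` \<Omega> \<subseteq> sym_mats"
      using hess_symmetric[OF assms(1) order_refl closure_subset assms(2)] by auto
  qed
  then show ?thesis using assms(3) by auto
qed

section \<open>The estimate near one boundary point\<close>

text \<open>All constants are fixed before \<open>x1\<close>, \<open>t\<close>, \<open>u\<close> and
  \<open>\<xi>\<close> appear, in an order dictated by their dependence: the radius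
  \<open>R\<close>, the common bound \<open>m\<close>, the concavity \<open>N\<close>, the small
  radius \<open>r1\<close>, then \<open>A2\<close> and finally \<open>A1\<close>.\<close>

lemma local_mixed_estimate:
  fixes \<Omega> K :: "(real^'n) set" and ub :: "real^'n \<Rightarrow> real" and \<theta> \<delta> :: real
  assumes bnd: "bounded \<Omega>" and dom: "Ck_domain 4 \<Omega>" and rc: "regular_collar \<Omega> \<delta>"
    and ub: "Ck_on 3 \<Omega> (closure \<Omega>) ub" and K: "compact K"
    and x0: "x0 \<in> frontier \<Omega>" and mrc: "mrc_at \<Omega> K \<theta> \<delta> ub x0"
  obtains s C where "0 < s" "\<And>x1 t u \<xi>. x1 \<in> frontier \<Omega> \<Longrightarrow> dist x1 x0 < s \<Longrightarrow> t \<in> {0..1} \<Longrightarrow>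
     admissible_solution \<Omega> K \<theta> ub t u \<Longrightarrow> \<xi> \<in> tangent_space \<Omega> x1 \<Longrightarrow> norm \<xi> = 1 \<Longrightarrow>
     \<bar>bilin (hess \<Omega> u x1) \<xi> (inner_normal \<Omega> x1)\<bar> \<le> C"
proof -
  let ?d = "bdist \<Omega>"
  have op: "open \<Omega>" using dom by (simp add: Ck_domain_def)
  have \<delta>: "0 < \<delta>" and d4: "Ck_on 4 \<Omega> (collar \<Omega> \<delta>) ?d" using rc by (auto simp: regular_collar_def)
  obtain \<tau> where \<tau>: "0 < \<tau>" "mrc_margin \<Omega> K \<theta> \<delta> ub x0 \<tau> > 0" using mrc by (auto simp: mrc_at_def)
  have three_le: "3 \<le> (4 :: nat)" by simp
  obtain r e \<rho> n G H where r: "0 < r" and ch: "chart \<Omega> (ball x0 r) e \<rho> n"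
    and nD: "\<And>k. D2 UNIV (\<lambda>x. n x $ k) (G k) (H k)"
    and cG: "\<And>k. continuous_on UNIV (G k)" and cH: "\<And>k. continuous_on UNIV (H k)"
    by (rule chart_exists[OF dom three_le x0]) (rule that)
  have bK: "bounded K" by (rule compact_imp_bounded[OF K])
  obtain \<epsilon> where \<epsilon>: "0 < \<epsilon>" and tri: "\<And>x t p X. x \<in> \<Omega> \<Longrightarrow> dist x x0 < \<epsilon> \<Longrightarrow> level_jet K \<theta> t p X \<Longrightarrow>
     \<epsilon> \<le> bilin (a_mat t p X) (grad \<Omega> ?d x) (grad \<Omega> ?d x) \<or> \<epsilon> \<le> Q_jet \<Omega> ub x t p X
     \<or> \<epsilon> \<le> J_jet \<Omega> ub x t p X - \<tau> * l_jet \<Omega> x t p X"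
    using recession_trichotomy[OF bnd op rc ub bK x0 \<tau>(2)] by metis
  obtain CJ where CJ: "0 < CJ" "\<And>x t p X. x \<in> closure \<Omega> \<inter> cball x0 (\<delta> / 2) \<Longrightarrow> t \<in> {0..1} \<Longrightarrow> p \<in> K \<Longrightarrow> X \<in> sym_mats \<Longrightarrow>
     \<bar>J_jet \<Omega> ub x t p X\<bar> \<le> CJ \<and> \<bar>l_jet \<Omega> x t p X\<bar> \<le> CJ"
    using J_l_jet_bounded[OF bnd rc ub bK x0] by metis
  obtain MK where MK: "0 < MK" "\<And>p. p \<in> K \<Longrightarrow> norm p \<le> MK" using bK by (auto simp: bounded_pos)
  obtain C0 where C0: "0 < C0" "\<And>t p (X :: real^'n^'n). t \<in> {0..1} \<Longrightarrow> norm p \<le> MK \<Longrightarrow> X \<in> sym_mats \<Longrightarrow>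
       norm (a_mat t p X) \<le> C0 \<and> norm (b_vec t p X) \<le> C0 \<and> norm (a_mat t p X ** X) \<le> C0"
    using jet_bounds by metis
  \<comment> \<open>Small enough for the chart, the collar bounds and the trichotomy to hold on the
    ball of radius \<open>R\<close>.\<close>
  define R where "R = min (r / 2) (min (\<delta> / 2) (\<epsilon> / 2))"
  have R: "0 < R" "R < r" "R \<le> \<delta> / 2" "R < \<epsilon>" using r \<delta> \<epsilon> by (auto simp: R_def)
  define S0 where "S0 = closure \<Omega> \<inter> cball x0 R"
  have cS0: "compact S0" unfolding S0_def using bnd by (auto intro: compact_Int)
  have S0_cl: "S0 \<subseteq> closure \<Omega>" and S0_d: "S0 \<subseteq> closure \<Omega> \<inter> cball x0 (\<delta> / 2)" using R by (auto simp: S0_def)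
  have S0_col: "S0 \<subseteq> collar \<Omega> \<delta>" using S0_d collar_cball[OF x0 \<delta>] by blast
  have cpd: "continuous_on S0 (hess \<Omega> (pd \<Omega> k ub))" for k
    by (rule continuous_on_subset[OF Ck_on_hess_continuous[of 2] S0_cl])
      (use ub in \<open>simp_all add: numeral_3_eq_3 numeral_2_eq_2\<close>)
  \<comment> \<open>Summing all the norms to be bounded requires a single compactness
    argument.\<close>
  define F where "F x = norm (grad \<Omega> ub x) + norm (hess \<Omega> ub x) + (\<Sum>k\<in>UNIV. norm (hess \<Omega> (pd \<Omega> k ub) x))
    + (\<Sum>k\<in>UNIV. norm (G k x)) + (\<Sum>k\<in>UNIV. norm (H k x)) + norm (grad \<Omega> ?d x)" for x
  have "continuous_on S0 F" unfolding F_def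
    by (intro continuous_intros cpd continuous_on_subset[OF Ck_on_grad_continuous[OF ub] S0_cl]
        continuous_on_subset[OF Ck_on_hess_continuous[OF ub] S0_cl] continuous_on_subset[OF cG]
        continuous_on_subset[OF cH] continuous_on_subset[OF Ck_on_grad_continuous[OF d4] S0_col]) auto
  then obtain m0 where m0: "0 < m0" "\<And>x. x \<in> S0 \<Longrightarrow> norm (F x) \<le> m0"
    using continuous_on_compact_norm_bound[OF cS0] by metis
  obtain mn where mn: "0 < mn" "\<And>x. x \<in> cball x0 R \<Longrightarrow> norm (n x) \<le> mn"
    using continuous_on_compact_norm_bound[OF compact_cball continuous_on_subset[OF chart_cont[OF ch]]] by (metis subset_UNIV)
  define m where "m = m0 + mn + MK + C0 + CJ"
  have m: "0 < m" "m0 \<le> m" "mn \<le> m" "MK \<le> m" "C0 \<le> m" "CJ \<le> m"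
    using m0(1) mn(1) MK(1) C0(1) CJ(1) by (auto simp: m_def)
  have Fbd: "norm (grad \<Omega> ub x) \<le> m \<and> norm (hess \<Omega> ub x) \<le> m \<and> norm (hess \<Omega> (pd \<Omega> k ub) x) \<le> m
      \<and> norm (G k x) \<le> m \<and> norm (H k x) \<le> m \<and> norm (grad \<Omega> ?d x) \<le> m" if x: "x \<in> S0" for x k
  proof -
    have s: "norm (f k) \<le> (\<Sum>k\<in>UNIV. norm (f k))" "0 \<le> (\<Sum>k\<in>UNIV. norm (f k))" for f :: "'n \<Rightarrow> 'b::real_normed_vector"
      by (auto intro!: member_le_sum sum_nonneg)
    have "F x \<le> m" using m0(2)[OF x] m(2) by simp
    then show ?thesis unfolding F_def
      using s[of "\<lambda>k. hess \<Omega> (pd \<Omega> k ub) x"] s[of "\<lambda>k. G k x"] s[of "\<lambda>k. H k x"]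
        norm_ge_zero[of "grad \<Omega> ub x"] norm_ge_zero[of "hess \<Omega> ub x"] norm_ge_zero[of "grad \<Omega> ?d x"]
      by linarith
  qed
  \<comment> \<open>Where \<open>a(Dd, Dd)\<close> or \<open>Q\<close> is at least
    \<open>\<epsilon>\<close>, the gain \<open>N * \<epsilon>\<close> must outweigh
    \<open>-J + \<tau> l\<close>, which is at most \<open>m + \<tau> * m\<close>.\<close>
  define N where "N = (m + \<tau> * m + \<epsilon>) / \<epsilon>"
  have N: "0 < N" "N * \<epsilon> = m + \<tau> * m + \<epsilon>" using m(1) \<tau>(1) \<epsilon> by (auto simp: N_def intro!: add_pos_pos divide_pos_pos)
  \<comment> \<open>Chosen so that \<open>d + \<phi> \<le> D0 * r1\<close> within distance
    \<open>r1\<close> of \<open>x1\<close>: \<open>d\<close> contributes \<open>r1\<close> and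
    \<open>\<phi>\<close> at most \<open>2 * m * m * r1\<close>.\<close>
  define D0 where "D0 = 1 + 2 * m * m"
  have D0: "0 < D0" using m(1) by (simp add: D0_def add_pos_pos)
  \<comment> \<open>The first bound keeps the small ball, and the segments from it back to the
    boundary, inside the ball of radius \<open>R\<close>. The second makes the errors of order
    \<open>N (d + \<phi>)\<close> at most \<open>\<epsilon> / 2\<close>. The last two give
    \<open>N \<phi> \<le> 1\<close> and \<open>N d \<le> \<tau>\<close>, hence
    \<open>v \<ge> 0\<close>.\<close>
  define r1 where "r1 = min (R / (4 * (1 + m))) (min (\<epsilon> / (4 * N * m * D0)) (min (1 / (N * D0)) (\<tau> / (N * D0))))"
  have r1: "0 < r1" using R(1) m(1) \<epsilon> N(1) D0 \<tau>(1) by (auto simp: r1_def)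
  have r1R: "(1 + m) * r1 \<le> R / 4"
  proof -
    have "r1 \<le> R / (4 * (1 + m))" by (simp add: r1_def)
    then show ?thesis using m(1) by (simp add: field_simps)
  qed
  have r1\<epsilon>: "2 * N * m * (D0 * r1) \<le> \<epsilon> / 2"
  proof -
    have "r1 \<le> \<epsilon> / (4 * N * m * D0)" by (simp add: r1_def)
    then have "r1 * (4 * N * m * D0) \<le> \<epsilon>" using m(1) N(1) D0 by (simp add: pos_le_divide_eq)
    then show ?thesis by (simp add: mult_ac)
  qed
  have r1N: "N * (D0 * r1) \<le> 1" "N * (D0 * r1) \<le> \<tau>"
  proof -
    have "r1 \<le> 1 / (N * D0)" "r1 \<le> \<tau> / (N * D0)" by (simp_all add: r1_def)
    then have "r1 * (N * D0) \<le> 1" "r1 * (N * D0) \<le> \<tau>" using N(1) D0 by (simp_all add: pos_le_divide_eq)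
    then show "N * (D0 * r1) \<le> 1" "N * (D0 * r1) \<le> \<tau>" by (simp_all add: mult_ac)
  qed
  have r1R': "r1 + m * r1 \<le> R / 4" "r1 \<le> R / 4"
  proof -
    show "r1 + m * r1 \<le> R / 4" using r1R by (simp add: distrib_right)
    then show "r1 \<le> R / 4" using mult_pos_pos[OF m(1) r1] by linarith
  qed
  define N' where "N' = real CARD('n)"
  define CT where "CT = (m * (N' * m) + m * m) + (m * (m * (N' * m) + m * m) + (2 * m) * (m * (N' * m) + m * (N' * m)) + 2 * (N' * m * (m + m * m)))"
  \<comment> \<open>\<open>A2 * r1\<^sup>2\<close> equals the bound for
    \<open>\<bar>T\<bar>\<close>, so the quadratic term compensates \<open>T\<close> on the sphere.
    \<open>Lq\<close> bounds \<open>L\<close> of \<open>|x - x1|\<^sup>2\<close>. \<open>A1\<close>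
    is such that \<open>A1 * (\<epsilon> / 2)\<close> exceeds everything else by 1, which makes the
    differential inequality strict.\<close>
  define A2 where "A2 = (2 * m + m * (2 * m)) / (r1 * r1)"
  define Lq where "Lq = m * norm (2 *\<^sub>R (mat 1 :: real^'n^'n)) + m * (2 * r1)"
  define A1 where "A1 = (A2 * Lq + CT + 1) / (\<epsilon> / 2)"
  have A2: "0 < A2" unfolding A2_def using m(1) r1 by (intro divide_pos_pos add_pos_pos mult_pos_pos) auto
  have Lq: "0 \<le> Lq" using m(1) r1 by (simp add: Lq_def)
  have CT: "0 \<le> CT" using m(1) by (simp add: CT_def N'_def)
  have A1: "0 < A1" unfolding A1_def using A2 Lq CT \<epsilon> by (intro divide_pos_pos add_nonneg_pos add_nonneg_nonneg mult_nonneg_nonneg) auto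
  \<comment> \<open>The first summand bounds the normal derivative of \<open>T\<close>. The second
    bounds its difference from \<open>D\<^sup>2u(\<xi>, \<nu>)\<close>: the Hessian of
    \<open>ub\<close> and the derivative of the coefficient
    \<open>n \<bullet> \<xi>\<close>.\<close>
  define C where "C = A1 * (2 * m + \<tau> * m) + (m + 2 * m * (N' * m))"
  have "\<bar>bilin (hess \<Omega> u x1) \<xi> (inner_normal \<Omega> x1)\<bar> \<le> C"
    if x1: "x1 \<in> frontier \<Omega>" "dist x1 x0 < R / 2" and t: "t \<in> {0..1}"
      and adm: "admissible_solution \<Omega> K \<theta> ub t u" and \<xi>: "\<xi> \<in> tangent_space \<Omega> x1" "norm \<xi> = 1" for x1 t u \<xi>
  proof -
    have u4: "Ck_on 4 \<Omega> (closure \<Omega>) u" and uconv: "hess_convex \<Omega> u"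
      and eq: "\<And>x. x \<in> \<Omega> \<Longrightarrow> G_op t (grad \<Omega> u x) (hess \<Omega> u x) = \<theta>"
      and ubd: "\<And>x. x \<in> frontier \<Omega> \<Longrightarrow> u x = ub x"
      and uK: "\<And>x. x \<in> closure \<Omega> \<Longrightarrow> grad \<Omega> u x \<in> K"
      and uge: "\<And>x. x \<in> \<Omega> \<Longrightarrow> ub x \<le> u x"
      using adm unfolding admissible_solution_def by auto
    have u2: "Ck_on 2 \<Omega> (closure \<Omega>) u" and ub2: "Ck_on 2 \<Omega> (closure \<Omega>) ub" and d2: "Ck_on 2 \<Omega> (collar \<Omega> \<delta>) ?d"
      by (rule Ck_on_le[OF u4] Ck_on_le[OF ub] Ck_on_le[OF d4]; simp)+
    define a where "a x = a_mat t (grad \<Omega> u x) (hess \<Omega> u x)" for x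
    define b where "b x = b_vec t (grad \<Omega> u x) (hess \<Omega> u x)" for x
    define \<phi> where "\<phi> x = u x - ub x" for x
    define g\<phi> where "g\<phi> x = grad \<Omega> u x - grad \<Omega> ub x" for x
    define h\<phi> where "h\<phi> x = hess \<Omega> u x - hess \<Omega> ub x" for x
    define V where "V = \<Omega> \<inter> ball x0 R"
    have V: "open V" "V \<subseteq> \<Omega>" "V \<subseteq> S0" using op closure_subset[of \<Omega>] by (auto simp: V_def S0_def)
    have V_col: "V \<subseteq> collar \<Omega> \<delta>" using V(3) S0_col by blast
    \<comment> \<open>Every interior point yields a level jet of \<open>u\<close>, so the jet
      estimates apply with constants that do not depend on \<open>u\<close>.\<close>
    have jet: "level_jet K \<theta> t (grad \<Omega> u x) (hess \<Omega> u x)" if "x \<in> \<Omega>" for x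
      using that t uK[of x] uconv eq closure_subset[of \<Omega>] by (auto simp: level_jet_def hess_convex_def)
    have hsym: "hess \<Omega> u x \<in> sym_mats" if "x \<in> \<Omega>" for x by (rule level_jetD(3)[OF jet[OF that]])
    have asym: "a x \<in> sym_mats" if "x \<in> \<Omega>" for x unfolding a_def by (rule a_mat_symmetric[OF hsym[OF that]])
    have apos: "0 \<le> bilin (a x) v v" if "x \<in> \<Omega>" for x v unfolding a_def by (rule bilin_a_mat_nonneg[OF hsym[OF that]])
    have gum: "norm (grad \<Omega> u x) \<le> m" if "x \<in> closure \<Omega>" for x using MK(2)[OF uK[OF that]] m(4) by linarith
    have abm: "norm (a x) \<le> m \<and> norm (b x) \<le> m \<and> norm (a x ** hess \<Omega> u x) \<le> m" if "x \<in> \<Omega>" for x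
      using C0(2)[OF t MK(2)[OF uK] hsym[OF that]] that closure_subset[of \<Omega>] m(5) unfolding a_def b_def by (meson order_trans subsetD)
    have g\<phi>m: "norm (g\<phi> x) \<le> 2 * m" if "x \<in> S0" for x
      using norm_triangle_ineq4[of "grad \<Omega> u x" "grad \<Omega> ub x"] gum[of x] Fbd[OF that] S0_cl that
      unfolding g\<phi>_def by fastforce
    have d\<phi>: "(\<phi> has_derivative (\<lambda>h. g\<phi> x \<bullet> h)) (at x)" if "x \<in> \<Omega>" for x
    proof -
      have "D2 \<Omega> (\<lambda>x. u x - ub x) (\<lambda>x. grad \<Omega> u x - grad \<Omega> ub x) (\<lambda>x. hess \<Omega> u x - hess \<Omega> ub x)"
        by (intro D2_diff Ck_on_D2[OF op order_refl closure_subset u2] Ck_on_D2[OF op order_refl closure_subset ub2]) auto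
      then show ?thesis using that by (simp add: D2_def \<phi>_def[abs_def] g\<phi>_def)
    qed
    have c\<phi>: "continuous_on (closure \<Omega>) \<phi>" unfolding \<phi>_def
      by (intro continuous_intros Ck_on_continuous[OF u2] Ck_on_continuous[OF ub2])
    have cg\<phi>: "continuous_on (closure \<Omega>) g\<phi>" unfolding g\<phi>_def
      by (intro continuous_intros Ck_on_grad_continuous[OF u2] Ck_on_grad_continuous[OF ub2]) auto
    have \<phi>0: "\<phi> x = 0" if "x \<in> frontier \<Omega>" for x using ubd[OF that] by (simp add: \<phi>_def)
    have e1: "norm e = 1" by (rule chart_unit[OF ch])
    have x1B: "x1 \<in> ball x0 r" "x1 \<in> cball x0 R" using x1(2) R by (auto simp: dist_commute)
    have near: "dist x x0 < R" if "dist x x1 \<le> r1" for x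
      using dist_triangle[of x x0 x1] that x1(2) r1R'(2) R(1) by linarith
    have \<phi>_le: "0 \<le> \<phi> x" "\<phi> x \<le> 2 * m * m * r1" if x: "x \<in> \<Omega>" "dist x x1 \<le> r1" for x
    proof -
      show "0 \<le> \<phi> x" using uge[OF x(1)] by (simp add: \<phi>_def)
      have xR: "dist x x0 < R" by (rule near[OF x(2)])
      have \<rho>pos: "0 < \<rho> x" using chart_iff[OF ch, of x] x(1) xR R by (auto simp: dist_commute)
      \<comment> \<open>Since \<open>\<rho>\<close> vanishes at \<open>x1\<close>, the Lipschitz
        bound controls the length of the segment from \<open>x\<close> to the boundary, and with it
        \<open>\<phi> x\<close>.\<close>
      have "\<bar>\<rho> x - \<rho> x1\<bar> \<le> m * dist x x1"
      proof (rule defining_function_lipschitz[OF ch convex_cball[of x0 R]])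
        show "norm (n z) \<le> m" if "z \<in> cball x0 R" for z using mn(2)[OF that] m(3) by linarith
      qed (use xR x1B in \<open>auto simp: dist_commute\<close>)
      moreover have "\<rho> x1 = 0" using frontier_chart[OF ch x1B(1)] x1(1) by simp
      moreover have "m * dist x x1 \<le> m * r1" using m(1) x(2) by simp
      ultimately have \<rho>le: "\<rho> x \<le> m * r1" by linarith
      have segR: "dist (x - s *\<^sub>R e) x0 < R" if "0 \<le> s" "s \<le> \<rho> x" for s
      proof -
        have "dist (x - s *\<^sub>R e) x = s" using that e1 by (simp add: dist_norm)
        then have "dist (x - s *\<^sub>R e) x0 \<le> s + (dist x x1 + dist x1 x0)"
          using dist_triangle[of "x - s *\<^sub>R e" x0 x] dist_triangle[of x x0 x1] by linarith
        then show ?thesis using that \<rho>le x(2) x1(2) r1R'(1) R(1) by linarith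
      qed
      have "\<phi> x \<le> \<rho> x * (2 * m)"
      proof (rule chart_phi_bound[OF ch x(1) _ d\<phi> c\<phi> \<phi>0 _ \<rho>pos])
        show "x - s *\<^sub>R e \<in> ball x0 r" if "0 \<le> s" "s \<le> \<rho> x" for s
          using segR[OF that] R(2) by (auto simp: dist_commute)
        show "norm (g\<phi> (x - s *\<^sub>R e)) \<le> 2 * m" if s: "0 \<le> s" "s < \<rho> x" for s
        proof (rule g\<phi>m)
          have "x - s *\<^sub>R e \<in> ball x0 r" using segR[of s] s R(2) by (auto simp: dist_commute)
          then have "x - s *\<^sub>R e \<in> \<Omega>"
            using chart_iff[OF ch] chart_shift[OF ch, of x "- s"] s by simp
          then show "x - s *\<^sub>R e \<in> S0"
            using closure_subset[of \<Omega>] segR[of s] s by (auto simp: S0_def dist_commute)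
        qed
      qed
      also have "\<dots> \<le> (m * r1) * (2 * m)" using \<rho>le m(1) by (intro mult_right_mono) auto
      finally show "\<phi> x \<le> 2 * m * m * r1" by (simp add: mult_ac)
    qed
    have d_le: "0 \<le> ?d x" "?d x \<le> r1" if "dist x x1 \<le> r1" for x
      using bdist_nonneg bdist_le[OF x1(1), of x] that by (auto intro: order_trans)
    have small: "?d x + \<phi> x \<le> D0 * r1" if "x \<in> \<Omega>" "dist x x1 \<le> r1" for x
      using d_le(2)[OF that(2)] \<phi>_le(2)[OF that] by (simp add: D0_def distrib_right)
    define v where "v x = \<phi> x + \<tau> * ?d x - N * (?d x * ?d x) - N * (\<phi> x * \<phi> x)" for x
    define gv where "gv x = barrier_grad \<tau> N (\<phi> x) (g\<phi> x) (?d x) (grad \<Omega> ?d x)" for x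
    obtain Hv where Dv: "D2 V v gv Hv"
      and Lv: "\<And>a b x. a \<in> sym_mats \<Longrightarrow> lin a b (gv x) (Hv x)
      = lin a b (g\<phi> x) (hess \<Omega> u x - hess \<Omega> ub x) + \<tau> * lin a b (grad \<Omega> ?d x) (hess \<Omega> ?d x)
        - N * (2 * ?d x * lin a b (grad \<Omega> ?d x) (hess \<Omega> ?d x) + 2 * bilin a (grad \<Omega> ?d x) (grad \<Omega> ?d x))
        - N * (2 * \<phi> x * lin a b (g\<phi> x) (hess \<Omega> u x - hess \<Omega> ub x) + 2 * bilin a (g\<phi> x) (g\<phi> x))"
      using barrier_operator[OF V(1,2) V_col u2 ub2 d2, of \<tau> N, folded \<phi>_def g\<phi>_def, folded v_def gv_def] by blast
    have v_op: "lin (a x) (b x) (gv x) (Hv x) \<le> - (\<epsilon> / 2)" if x: "x \<in> \<Omega>" "dist x x1 \<le> r1" for x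
    proof -
      define J l q A where "J = J_jet \<Omega> ub x t (grad \<Omega> u x) (hess \<Omega> u x)"
        and "l = l_jet \<Omega> x t (grad \<Omega> u x) (hess \<Omega> u x)"
        and "q = Q_jet \<Omega> ub x t (grad \<Omega> u x) (hess \<Omega> u x)"
        and "A = bilin (a x) (grad \<Omega> ?d x) (grad \<Omega> ?d x)"
      have xS: "x \<in> closure \<Omega> \<inter> cball x0 (\<delta> / 2)"
        using x(1) closure_subset[of \<Omega>] near[OF x(2)] R(3) by (auto simp: dist_commute)
      have "\<bar>J\<bar> \<le> m" "\<bar>l\<bar> \<le> m"
        using CJ(2)[OF xS t level_jetD(2,3)[OF jet[OF x(1)]]] m(6) unfolding J_def l_def by linarith+
      have lJ: "lin (a x) (b x) (g\<phi> x) (hess \<Omega> u x - hess \<Omega> ub x) = - J"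
        unfolding J_def J_jet_def a_def b_def g\<phi>_def lin_def
        by (simp add: linear_diff[OF frob_linear] inner_diff_right)
      have ll: "lin (a x) (b x) (grad \<Omega> ?d x) (hess \<Omega> ?d x) = l"
        unfolding l_def l_jet_def a_def b_def lin_def ..
      have lq: "bilin (a x) (g\<phi> x) (g\<phi> x) = q" unfolding q_def Q_jet_def a_def g\<phi>_def ..
      have form: "lin (a x) (b x) (gv x) (Hv x) = - J + \<tau> * l - N * (2 * ?d x * l + 2 * A) - N * (2 * \<phi> x * (- J) + 2 * q)"
        using Lv[OF asym[OF x(1)], of "b x" x] unfolding lJ ll lq A_def .
      have A0: "0 \<le> A" and q0: "0 \<le> q" using apos[OF x(1)] lq unfolding A_def by (auto simp flip: lq)
      have tri': "\<epsilon> \<le> A \<or> \<epsilon> \<le> q \<or> \<epsilon> \<le> J - \<tau> * l"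
        using tri[OF x(1) _ jet[OF x(1)]] near[OF x(2)] R(4) unfolding A_def a_def q_def J_def l_def by auto
      have e1: "- (N * (?d x * l)) \<le> N * (?d x * m)"
      proof -
        have "?d x * (- l) \<le> ?d x * m" using d_le(1)[OF x(2)] \<open>\<bar>l\<bar> \<le> m\<close> by (intro mult_left_mono) auto
        from mult_left_mono[OF this less_imp_le[OF N(1)]] show ?thesis by simp
      qed
      have e2: "N * (\<phi> x * J) \<le> N * (\<phi> x * m)"
        using \<phi>_le(1)[OF x] \<open>\<bar>J\<bar> \<le> m\<close> N(1) by (intro mult_left_mono) auto
      have e3: "2 * (N * (?d x * m)) + 2 * (N * (\<phi> x * m)) \<le> \<epsilon> / 2"
      proof -
        have "2 * (N * (?d x * m)) + 2 * (N * (\<phi> x * m)) = 2 * N * m * (?d x + \<phi> x)" by (simp add: algebra_simps)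
        also have "\<dots> \<le> 2 * N * m * (D0 * r1)" using small[OF x] N(1) m(1) by (intro mult_left_mono) auto
        finally show ?thesis using r1\<epsilon> by linarith
      qed
      have e4: "\<tau> * l \<le> \<tau> * m" using \<tau>(1) \<open>\<bar>l\<bar> \<le> m\<close> by (intro mult_left_mono) auto
      have NA: "0 \<le> N * A" "0 \<le> N * q" using N(1) A0 q0 by auto
      have form': "lin (a x) (b x) (gv x) (Hv x) = - J + \<tau> * l - 2 * (N * (?d x * l)) - 2 * (N * A) + 2 * (N * (\<phi> x * J)) - 2 * (N * q)"
        unfolding form by (simp add: algebra_simps)
      \<comment> \<open>In the first two cases the concavity term absorbs
        \<open>-J + \<tau> l\<close>; in the third this expression is itself at most
        \<open>-\<epsilon>\<close>. The errors \<open>e1\<close> to \<open>e3\<close> cost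
        \<open>\<epsilon> / 2\<close> in each case.\<close>
      from tri' consider "N * \<epsilon> \<le> N * A" | "N * \<epsilon> \<le> N * q" | "\<epsilon> \<le> J - \<tau> * l"
        using N(1) by auto
      then show ?thesis
      proof cases
        case 1 then show ?thesis unfolding form' using e1 e2 e3 e4 NA N(2) \<open>\<bar>J\<bar> \<le> m\<close> \<epsilon> m(1) mult_pos_pos[OF \<tau>(1) m(1)] by linarith
      next
        case 2 then show ?thesis unfolding form' using e1 e2 e3 e4 NA N(2) \<open>\<bar>J\<bar> \<le> m\<close> \<epsilon> m(1) mult_pos_pos[OF \<tau>(1) m(1)] by linarith
      next
        case 3 then show ?thesis unfolding form' using e1 e2 e3 NA by linarith
      qed
    qed
    have v_pos: "0 \<le> v x" if x: "x \<in> \<Omega>" "dist x x1 \<le> r1" for x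
    proof -
      have "N * ?d x \<le> N * (D0 * r1)" "N * \<phi> x \<le> N * (D0 * r1)"
        using small[OF x] d_le(1)[OF x(2)] \<phi>_le(1)[OF x] N(1) by (auto intro!: mult_left_mono)
      then have "N * ?d x \<le> \<tau>" "N * \<phi> x \<le> 1" using r1N by linarith+
      then have "(N * ?d x) * ?d x \<le> \<tau> * ?d x" "(N * \<phi> x) * \<phi> x \<le> 1 * \<phi> x"
        using d_le(1)[OF x(2)] \<phi>_le(1)[OF x] by (intro mult_right_mono; simp)+
      then show ?thesis unfolding v_def by (simp add: mult.assoc)
    qed
    define T where "T x = g\<phi> x \<bullet> \<xi> - (n x \<bullet> \<xi>) * (g\<phi> x \<bullet> e)" for x
    define gT where "gT x = tang_grad \<xi> e (n x) (g\<phi> x) (h\<phi> x) (\<lambda>k. G k x)" for x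
    have nm: "norm (n x) \<le> m" if "x \<in> S0" for x using mn(2)[of x] m(3) that by (auto simp: S0_def)
    have bdV: "norm (G k x) \<le> m \<and> norm (H k x) \<le> m \<and> norm (n x) \<le> m \<and> norm (hess \<Omega> ub x) \<le> m
      \<and> norm (hess \<Omega> (pd \<Omega> k ub) x) \<le> m \<and> norm (grad \<Omega> ub x) \<le> m \<and> norm (grad \<Omega> u x) \<le> m
      \<and> norm (a x) \<le> m \<and> norm (b x) \<le> m \<and> norm (a x ** hess \<Omega> u x) \<le> m" if "x \<in> V" for x k
    proof -
      have "x \<in> S0" "x \<in> \<Omega>" "x \<in> closure \<Omega>" using that V S0_cl by auto
      then show ?thesis using Fbd[of x k] nm[of x] gum[of x] abm[of x] by blast
    qed
    have nDV: "D2 V (\<lambda>x. n x $ k) (G k) (H k)" for k by (rule D2_subset[OF nD]) simp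
    obtain HT where DT: "D2 V T gT HT" and LT: "\<And>x. x \<in> V \<Longrightarrow> \<bar>lin (a x) (b x) (gT x) (HT x)\<bar> \<le> CT"
      using tangential_operator[OF op V(1,2) u4 ub eq nDV _ _ less_imp_le[OF m(1)] bdV[unfolded a_def b_def], of e \<xi>] e1 \<xi>(2)
      unfolding T_def[abs_def] gT_def[abs_def] g\<phi>_def[abs_def] h\<phi>_def[abs_def] a_def b_def CT_def N'_def by auto
    \<comment> \<open>Points of \<open>Wc\<close> outside \<open>W\<close> are either boundary
      points of \<Omega>, where \<open>v = T = 0\<close>, or points of \<Omega> on the sphere, where
      the quadratic term dominates \<open>T\<close>.\<close>
    define W where "W = \<Omega> \<inter> ball x1 r1"
    define Wc where "Wc = closure \<Omega> \<inter> cball x1 r1"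
    have W: "open W" "W \<subseteq> Wc" "W \<subseteq> V"
      using op closure_subset[of \<Omega>] near by (auto simp: W_def Wc_def V_def dist_commute)
    have Wc: "compact Wc" "Wc \<subseteq> S0"
    proof -
      show "compact Wc" unfolding Wc_def using bnd by (auto intro: compact_Int)
      show "Wc \<subseteq> S0" using near by (force simp: Wc_def S0_def dist_commute)
    qed
    have x1W: "x1 \<in> Wc" "x1 \<in> S0" "x1 \<in> closure \<Omega>"
      using x1 r1 Wc(2) by (auto simp: Wc_def frontier_def)
    have Wc_cl: "Wc \<subseteq> closure \<Omega>" by (auto simp: Wc_def)
    have Wc_col: "Wc \<subseteq> collar \<Omega> \<delta>" using Wc(2) S0_col by blast
    have cts: "continuous_on Wc \<phi>" "continuous_on Wc g\<phi>" "continuous_on Wc ?d" "continuous_on Wc (grad \<Omega> ?d)"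
      "continuous_on Wc n" "continuous_on Wc h\<phi>" "continuous_on Wc (G k)" for k
    proof -
      show "continuous_on Wc h\<phi>" unfolding h\<phi>_def
        by (intro continuous_intros continuous_on_subset[OF Ck_on_hess_continuous[OF u2] Wc_cl]
            continuous_on_subset[OF Ck_on_hess_continuous[OF ub2] Wc_cl]) auto
      show "continuous_on Wc (grad \<Omega> ?d)"
        by (rule continuous_on_subset[OF Ck_on_grad_continuous[OF d2] Wc_col]) simp
    qed (use continuous_on_subset[OF c\<phi> Wc_cl] continuous_on_subset[OF cg\<phi> Wc_cl]
        continuous_on_subset[OF Ck_on_continuous[OF d2] Wc_col] continuous_on_subset[OF chart_cont[OF ch]]
        continuous_on_subset[OF cG] in auto)
    have cmv: "continuous_on Wc (\<lambda>x. h\<phi> x *v w)" for w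
      unfolding matrix_vector_mult_def by (intro continuous_on_vec_lambda continuous_intros cts)
    have Tbd: "\<bar>T x\<bar> \<le> 2 * m + m * (2 * m)" if "x \<in> S0" for x
    proof -
      have "\<bar>g\<phi> x \<bullet> \<xi>\<bar> \<le> 2 * m" "\<bar>g\<phi> x \<bullet> e\<bar> \<le> 2 * m" "\<bar>n x \<bullet> \<xi>\<bar> \<le> m"
        using Cauchy_Schwarz_ineq2[of "g\<phi> x" \<xi>] Cauchy_Schwarz_ineq2[of "g\<phi> x" e] Cauchy_Schwarz_ineq2[of "n x" \<xi>]
          g\<phi>m[OF that] nm[OF that] e1 \<xi>(2) by auto
      moreover from this have "\<bar>(n x \<bullet> \<xi>) * (g\<phi> x \<bullet> e)\<bar> \<le> m * (2 * m)"
        unfolding abs_mult using m(1) by (intro mult_mono) auto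
      ultimately show ?thesis unfolding T_def by linarith
    qed
    have n1: "n x1 \<bullet> \<xi> = 0" using \<xi>(1) tangent_space_chart[OF ch x1B(1) x1(1)] by simp
    have T0: "T x = 0" if x: "x \<in> frontier \<Omega>" "x \<in> S0" for x
    proof -
      have xB: "x \<in> ball x0 r" using x(2) R(2) by (auto simp: S0_def)
      \<comment> \<open>The field \<open>\<xi> - (n x \<bullet> \<xi>) *\<^sub>R e\<close> is
        tangent to the boundary because \<open>n x \<bullet> e = 1\<close>, so it annihilates
        \<open>\<phi>\<close> there.\<close>
      have "n x \<bullet> (\<xi> - (n x \<bullet> \<xi>) *\<^sub>R e) = 0" by (simp add: inner_diff_right chart_n_e[OF ch])
      from tangential_derivative_zero[OF ch xB x(1) this d\<phi> c\<phi> cg\<phi> \<phi>0]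
      show ?thesis by (simp add: T_def inner_diff_right)
    qed
    define \<nu> where "\<nu> = inner_normal \<Omega> x1"
    have \<nu>: "\<nu> = (1 / norm (n x1)) *\<^sub>R n x1" unfolding \<nu>_def by (rule inner_normal_chart[OF ch x1B(1) x1(1)])
    have \<nu>1: "norm \<nu> = 1" using chart_n_nz[OF ch, of x1] by (simp add: \<nu>)
    have "0 < n x1 \<bullet> \<nu>" using chart_n_nz[OF ch, of x1] by (simp add: \<nu>)
    moreover have "\<rho> x1 = 0" using frontier_chart[OF ch x1B(1)] x1(1) by simp
    ultimately obtain \<epsilon>1 where \<epsilon>1: "0 < \<epsilon>1" "\<And>s. 0 < s \<Longrightarrow> s < \<epsilon>1 \<Longrightarrow> x1 + s *\<^sub>R \<nu> \<in> \<Omega>"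
      using chart_ray[OF ch x1B(1)] by blast
    \<comment> \<open>The two signs of \<open>\<sigma>\<close> together give a bound on the absolute
      value.\<close>
    have key: "- (\<sigma> * (gT x1 \<bullet> \<nu>)) \<le> A1 * (2 * m + \<tau> * m)" if \<sigma>: "\<bar>\<sigma>\<bar> = 1" for \<sigma>
    proof -
      define h where "h x = A1 * v x + A2 * ((x - x1) \<bullet> (x - x1)) + \<sigma> * T x" for x
      define gh where "gh x = A1 *\<^sub>R gv x + A2 *\<^sub>R (2 *\<^sub>R (x - x1)) + \<sigma> *\<^sub>R gT x" for x
      define Hh where "Hh x = A1 *\<^sub>R Hv x + A2 *\<^sub>R (2 *\<^sub>R mat 1) + \<sigma> *\<^sub>R HT x" for x
      have Dh: "D2 W h gh Hh"
        unfolding h_def gh_def Hh_def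
        by (intro D2_add D2_scale D2_sq_dist D2_subset[OF Dv W(3)] D2_subset[OF DT W(3)])
      have ch_h: "continuous_on Wc h" unfolding h_def v_def T_def by (intro continuous_intros cts)
      have ch_gh: "continuous_on Wc gh" unfolding gh_def gv_def gT_def barrier_grad_def tang_grad_def by (intro continuous_intros cts cmv)
      have Lh: "lin (a x) (b x) (gh x) (Hh x) < 0" if x: "x \<in> W" for x
      proof -
        have x': "x \<in> \<Omega>" "dist x x1 \<le> r1" "x \<in> V" using x W(3) by (auto simp: W_def dist_commute)
        have "lin (a x) (b x) (gh x) (Hh x) = A1 * lin (a x) (b x) (gv x) (Hv x)
            + A2 * lin (a x) (b x) (2 *\<^sub>R (x - x1)) (2 *\<^sub>R mat 1) + \<sigma> * lin (a x) (b x) (gT x) (HT x)"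
          unfolding gh_def Hh_def by (simp only: lin_add lin_scale)
        moreover have "A1 * lin (a x) (b x) (gv x) (Hv x) \<le> A1 * (- (\<epsilon> / 2))"
          using v_op[OF x'(1,2)] A1 by (intro mult_left_mono) auto
        moreover have "A1 * (- (\<epsilon> / 2)) = - (A2 * Lq + CT + 1)" using \<epsilon> by (simp add: A1_def field_simps)
        moreover have "lin (a x) (b x) (2 *\<^sub>R (x - x1)) (2 *\<^sub>R mat 1) \<le> Lq"
        proof -
          have "norm (a x) \<le> m" "norm (b x) \<le> m" using abm[OF x'(1)] by auto
          note lb = lin_bound[OF this, of "2 *\<^sub>R (x - x1)" "2 *\<^sub>R mat 1"]
          have "m * norm (2 *\<^sub>R (x - x1)) \<le> m * (2 * r1)"
            using x'(2) m(1) by (intro mult_left_mono) (auto simp: dist_norm)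
          then show ?thesis using lb unfolding Lq_def by linarith
        qed
        then have "A2 * lin (a x) (b x) (2 *\<^sub>R (x - x1)) (2 *\<^sub>R mat 1) \<le> A2 * Lq" using A2 by (intro mult_left_mono) auto
        moreover have "\<sigma> * lin (a x) (b x) (gT x) (HT x) \<le> CT"
        proof -
          have "\<bar>\<sigma> * lin (a x) (b x) (gT x) (HT x)\<bar> \<le> CT" using LT[OF x'(3)] \<sigma> by (simp add: abs_mult)
          then show ?thesis by linarith
        qed
        ultimately show ?thesis by linarith
      qed
      have bdry: "0 \<le> h x" if x: "x \<in> Wc" "x \<notin> W" for x
      proof (cases "x \<in> \<Omega>")
        case True
        then have dx: "dist x x1 = r1" using x by (auto simp: Wc_def W_def dist_commute)
        have "A2 * ((x - x1) \<bullet> (x - x1)) = 2 * m + m * (2 * m)"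
          using dx r1 by (simp add: A2_def dist_norm dot_square_norm power2_eq_square)
        moreover have "\<bar>\<sigma> * T x\<bar> \<le> 2 * m + m * (2 * m)" using Tbd[of x] Wc(2) x(1) \<sigma> by (auto simp: abs_mult)
        moreover have "0 \<le> A1 * v x" using v_pos[OF True] dx A1 by simp
        ultimately show ?thesis unfolding h_def by linarith
      next
        case False
        then have fr: "x \<in> frontier \<Omega>" using x(1) op by (auto simp: Wc_def frontier_def interior_open)
        then have "v x = 0" "T x = 0" using \<phi>0 bdist_frontier T0[OF fr] Wc(2) x(1) by (auto simp: v_def)
        then show ?thesis unfolding h_def using A2 by simp
      qed
      have W\<Omega>: "W \<subseteq> \<Omega>" by (auto simp: W_def)
      have hpos: "0 \<le> h x" if "x \<in> Wc" for x
        by (rule weak_min_principle[OF W(1,2) Wc(1) Dh ch_h, where a = a and b = b])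
          (use asym apos W\<Omega> Lh bdry that in auto)
      have "0 \<le> gh x1 \<bullet> \<nu>"
      proof (rule boundary_min_derivative[where \<epsilon> = "min \<epsilon>1 r1" and V = W and S = Wc and h = h
            and g = gh and x = x1 and \<nu> = \<nu>])
        show "x1 + s *\<^sub>R \<nu> \<in> W" if "0 < s" "s < min \<epsilon>1 r1" for s
          using \<epsilon>1(2)[of s] that \<nu>1 by (auto simp: W_def dist_norm)
        show "(h has_derivative (\<lambda>k. gh y \<bullet> k)) (at y)" if "y \<in> W" for y using Dh that by (simp add: D2_def)
        show "h x1 = 0" using \<phi>0[OF x1(1)] bdist_frontier[OF x1(1)] T0[OF x1(1) x1W(2)] by (simp add: h_def v_def)
        show "0 \<le> h y" if "y \<in> W" for y using hpos W(2) that by blast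
      qed (use \<epsilon>1(1) r1 W(2) x1W(1) ch_h ch_gh in auto)
      \<comment> \<open>At \<open>x1\<close> the functions \<open>\<phi>\<close> and
        \<open>d\<close> vanish, so the gradients of the two concave corrections drop out, as does
        that of the quadratic term.\<close>
      moreover have "gh x1 = A1 *\<^sub>R (g\<phi> x1 + \<tau> *\<^sub>R grad \<Omega> ?d x1) + \<sigma> *\<^sub>R gT x1"
        using \<phi>0[OF x1(1)] bdist_frontier[OF x1(1)] by (simp add: gh_def gv_def barrier_grad_def)
      moreover have "(g\<phi> x1 + \<tau> *\<^sub>R grad \<Omega> ?d x1) \<bullet> \<nu> \<le> 2 * m + \<tau> * m"
      proof -
        have "norm (g\<phi> x1 + \<tau> *\<^sub>R grad \<Omega> ?d x1) \<le> norm (g\<phi> x1) + \<tau> * norm (grad \<Omega> ?d x1)"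
          using norm_triangle_ineq[of "g\<phi> x1" "\<tau> *\<^sub>R grad \<Omega> ?d x1"] \<tau>(1) by simp
        also have "\<dots> \<le> 2 * m + \<tau> * m"
          using g\<phi>m[OF x1W(2)] Fbd[OF x1W(2)] \<tau>(1) by (intro add_mono mult_left_mono) auto
        finally show ?thesis using norm_cauchy_schwarz[of "g\<phi> x1 + \<tau> *\<^sub>R grad \<Omega> ?d x1" \<nu>] \<nu>1 by simp
      qed
      then have "A1 * ((g\<phi> x1 + \<tau> *\<^sub>R grad \<Omega> ?d x1) \<bullet> \<nu>) \<le> A1 * (2 * m + \<tau> * m)" using A1 by (intro mult_left_mono) auto
      ultimately show ?thesis by (simp add: inner_add_left)
    qed
    have "\<bar>gT x1 \<bullet> \<nu>\<bar> \<le> A1 * (2 * m + \<tau> * m)" using key[of 1] key[of "-1"] by linarith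
    \<comment> \<open>Tangency of \<open>\<xi>\<close> at \<open>x1\<close> gives
      \<open>n x1 \<bullet> \<xi> = 0\<close>, which removes the uncontrolled term with
      \<open>h\<phi> x1 *v e\<close>.\<close>
    moreover have "(hess \<Omega> u x1 *v \<xi>) \<bullet> \<nu> = gT x1 \<bullet> \<nu> + ((hess \<Omega> ub x1 *v \<xi>) \<bullet> \<nu> + (g\<phi> x1 \<bullet> e) * ((\<Sum>k\<in>UNIV. \<xi> $ k *\<^sub>R G k x1) \<bullet> \<nu>))"
      unfolding gT_def tang_grad_def n1 h\<phi>_def by (simp add: matrix_vector_mult_diff_rdistrib inner_diff_left)
    moreover have "\<bar>(hess \<Omega> ub x1 *v \<xi>) \<bullet> \<nu>\<bar> \<le> m"
    proof -
      have "\<bar>(hess \<Omega> ub x1 *v \<xi>) \<bullet> \<nu>\<bar> \<le> norm (hess \<Omega> ub x1 *v \<xi>)"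
        using Cauchy_Schwarz_ineq2[of "hess \<Omega> ub x1 *v \<xi>" \<nu>] \<nu>1 by simp
      also have "\<dots> \<le> norm (hess \<Omega> ub x1)" using norm_matrix_vector_le[of "hess \<Omega> ub x1" \<xi>] \<xi>(2) by simp
      also have "\<dots> \<le> m" using Fbd[OF x1W(2)] by blast
      finally show ?thesis .
    qed
    moreover have "\<bar>(g\<phi> x1 \<bullet> e) * ((\<Sum>k\<in>UNIV. \<xi> $ k *\<^sub>R G k x1) \<bullet> \<nu>)\<bar> \<le> 2 * m * (N' * m)"
      unfolding abs_mult
    proof (intro mult_mono)
      show "\<bar>g\<phi> x1 \<bullet> e\<bar> \<le> 2 * m" using Cauchy_Schwarz_ineq2[of "g\<phi> x1" e] g\<phi>m[OF x1W(2)] e1 by simp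
      have "norm (\<Sum>k\<in>UNIV. \<xi> $ k *\<^sub>R G k x1) \<le> N' * m"
        unfolding N'_def using \<xi>(2) Fbd[OF x1W(2)] by (intro norm_weighted_sum_le) auto
      then show "\<bar>(\<Sum>k\<in>UNIV. \<xi> $ k *\<^sub>R G k x1) \<bullet> \<nu>\<bar> \<le> N' * m"
        using Cauchy_Schwarz_ineq2[of "\<Sum>k\<in>UNIV. \<xi> $ k *\<^sub>R G k x1" \<nu>] \<nu>1 by simp
    qed (use m(1) in auto)
    ultimately have "\<bar>(hess \<Omega> u x1 *v \<xi>) \<bullet> \<nu>\<bar> \<le> C" unfolding C_def by linarith
    moreover have "bilin (hess \<Omega> u x1) \<xi> \<nu> = (hess \<Omega> u x1 *v \<xi>) \<bullet> \<nu>"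
      unfolding bilin_def by (rule sym_matsD[OF hess_symmetric_closure[OF op u2 x1W(3)], symmetric])
    ultimately show ?thesis by (simp add: \<nu>_def)
  qed
  then show ?thesis using that[of "R / 2" C] R(1) by (meson half_gt_zero)
qed

section \<open>From local estimates to the whole boundary\<close>

theorem theorem1p4:
  fixes \<Omega> K :: "(real^'n) set" and ub :: "real^'n \<Rightarrow> real" and \<theta> \<delta> :: real
  assumes "2 \<le> CARD('n)"
    and "bounded \<Omega>" and "Ck_domain 4 \<Omega>"
    and "regular_collar \<Omega> \<delta>"
    and "0 < \<theta>" and "\<theta> < real CARD('n) * pi / 2"
    and "Ck_on 3 \<Omega> (closure \<Omega>) ub" and "hess_convex \<Omega> ub"
    and "compact K" and "convex K"
    and "mrc_on_boundary \<Omega> K \<theta> \<delta> ub"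
  shows "(\<forall>t\<in>{0..1}. \<forall>u. admissible_solution \<Omega> K \<theta> ub t u \<longrightarrow>
            (\<exists>C::real. mixed_sup \<Omega> u \<le> ereal C)) \<and>
         (mrc_uniform \<Omega> K \<theta> \<delta> ub \<longrightarrow>
            (\<exists>C::real. \<forall>t\<in>{0..1}. \<forall>u. admissible_solution \<Omega> K \<theta> ub t u \<longrightarrow>
               mixed_sup \<Omega> u \<le> ereal C))"
proof -
  \<comment> \<open>Packaging the local estimate as a predicate lets the radius and the constant be
    chosen as functions of the centre.\<close>
  define P where "P x0 s C \<longleftrightarrow> 0 < s \<and> (\<forall>x1\<in>frontier \<Omega>. dist x1 x0 < s \<longrightarrow> (\<forall>t\<in>{0..1}. \<forall>u \<xi>.
     admissible_solution \<Omega> K \<theta> ub t u \<longrightarrow> \<xi> \<in> tangent_space \<Omega> x1 \<longrightarrow> norm \<xi> = 1 \<longrightarrow>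
     \<bar>bilin (hess \<Omega> u x1) \<xi> (inner_normal \<Omega> x1)\<bar> \<le> C))" for x0 s C
  have "\<exists>s C. P x0 s C" if x0: "x0 \<in> frontier \<Omega>" for x0
  proof -
    have "mrc_at \<Omega> K \<theta> \<delta> ub x0" using assms(11) x0 by (simp add: mrc_on_boundary_def)
    from local_mixed_estimate[OF assms(2,3,4,7,9) x0 this] show ?thesis unfolding P_def by metis
  qed
  then obtain s C where sC: "\<And>x0. x0 \<in> frontier \<Omega> \<Longrightarrow> P x0 (s x0) (C x0)" by metis
  have "compact (frontier \<Omega>)" using assms(2) by (rule compact_frontier_bounded)
  moreover have "frontier \<Omega> \<subseteq> (\<Union>x0\<in>frontier \<Omega>. ball x0 (s x0))" using sC by (force simp: P_def)
  ultimately obtain A where A: "A \<subseteq> frontier \<Omega>" "finite A" "frontier \<Omega> \<subseteq> (\<Union>x0\<in>A. ball x0 (s x0))"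
    using compactE_image[of "frontier \<Omega>" "frontier \<Omega>" "\<lambda>x0. ball x0 (s x0)"] by (metis open_ball)
  \<comment> \<open>A sum of absolute values dominates each local constant of the finite cover; it
    is fixed before any \<open>t\<close> and \<open>u\<close>.\<close>
  define C' where "C' = (\<Sum>x0\<in>A. \<bar>C x0\<bar>)"
  have main: "mixed_sup \<Omega> u \<le> ereal C'" if t: "t \<in> {0..1}" and u: "admissible_solution \<Omega> K \<theta> ub t u" for t u
    unfolding mixed_sup_def
  proof (intro SUP_least)
    fix x \<xi> assume x: "x \<in> frontier \<Omega>" and \<xi>: "\<xi> \<in> {\<xi> \<in> tangent_space \<Omega> x. norm \<xi> = 1}"
    obtain x0 where x0: "x0 \<in> A" "dist x x0 < s x0" using A(3) x by (auto simp: dist_commute)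
    have "\<bar>bilin (hess \<Omega> u x) \<xi> (inner_normal \<Omega> x)\<bar> \<le> C x0"
      using sC[of x0] x0 A(1) x t u \<xi> unfolding P_def by blast
    also have "\<dots> \<le> \<bar>C x0\<bar>" by simp
    also have "\<dots> \<le> C'" unfolding C'_def by (rule member_le_sum[OF x0(1)]) (use A(2) in auto)
    finally show "ereal \<bar>bilin (hess \<Omega> u x) \<xi> (inner_normal \<Omega> x)\<bar> \<le> ereal C'" by simp
  qed
  then show ?thesis by blast
qed

end
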